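(* Let $M$ be a $\mathrm{II}_1$ factor and let $N\subseteq M$ be a singular subfactor such that the relative commutant $N'\cap\langle M,e_N\rangle$ is 2-dimensional. (1) If $[M:N]<\infty$, then $N$ is $\sqrt{\frac{[M:N]-2}{[M:N]-1}}$-strongly singular in $M$. (2) If $[M:N]=\infty$, then $N$ is strongly singular in $M$.
   Context: $M$ is a $\mathrm{II}_1$ factor with its unique normal faithful tracial state $\tau$, acting on $L^2(M)=L^2(M,\tau)$, and $\Vert x\Vert_2=\tau(x^*x)^{1/2}$; $\Vert x\Vert$ is the operator norm. For a subfactor $N\subseteq M$, $[M:N]$ is the Jones index (the dimension of $L^2(M)$ as a left Hilbert $N$-module), $e_N$ is the orthogonal projection of $L^2(M)$ onto $L^2(N)$, $\langle M,e_N\rangle$ is the von Neumann algebra on $L^2(M)$ generated by $M$ and $e_N$, and $N'$ is the commutant of $N$ in $B(L^2(M))$. The condition that $N'\cap\langle M,e_N\rangle$ is 2-dimensional is called 2-transitivity. A subfactor $N\subseteq M$ is singular if every unitary $u\in M$ with $uNu^*=N$ belongs to $N$. For a von Neumann subalgebra $B\subseteq M$, $\mathbb{E}_B$ denotes the unique normal faithful $\tau$-preserving conditional expectation of $M$ onto $B$. For a linear map $T:M\to M$ put $\Vert T\Vert_{\infty,2}=\sup\{\Vert T(x)\Vert_2 : x\in M,\ \Vert x\Vert\le 1\}$. For $0<\alpha\le 1$, $B$ is $\alpha$-strongly singular in $M$ if for all unitaries $u\in M$, $\alpha\Vert u-\mathbb{E}_B(u)\Vert_2\le \Vert \mathbb{E}_B-\mathbb{E}_{uBu^*}\Vert_{\infty,2}$.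 $B$ is strongly singular if this holds with $\alpha=1$. *)

theory Defs
  imports "HOL-Analysis.Analysis"
begin

text \<open>
  The complex inner product is linear in the first argument. The underlying real Hilbert space
  is the one of the library, so that norm, topology and real-linear bounded operators
  are available.
\<close>

class complex_hilbert_space = real_inner + banach +
  fixes scaleC :: "complex \<Rightarrow> 'a \<Rightarrow> 'a"  (infixr \<open>*\<^sub>C\<close> 75)
    and cinner :: "'a \<Rightarrow> 'a \<Rightarrow> complex"
  assumes scaleC_add_right: "c *\<^sub>C (x + y) = c *\<^sub>C x + c *\<^sub>C y"
    and scaleC_add_left: "(c + d) *\<^sub>C x = c *\<^sub>C x + d *\<^sub>C x"
    and scaleC_scaleC: "c *\<^sub>C d *\<^sub>C x = (c * d) *\<^sub>C x"
    and scaleC_of_real: "complex_of_real r *\<^sub>C x = r *\<^sub>R x"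
    and cinner_commute: "cinner y x = cnj (cinner x y)"
    and cinner_add_left: "cinner (x + y) z = cinner x z + cinner y z"
    and cinner_scaleC_left: "cinner (c *\<^sub>C x) y = c * cinner x y"
    and inner_eq_Re_cinner: "inner x y = Re (cinner x y)"

text \<open>\<open>'h \<Rightarrow>\<^sub>L 'h\<close> consists of the bounded real-linear maps; \<open>BH\<close> is the set of
  complex-linear ones. The norm of \<open>'h \<Rightarrow>\<^sub>L 'h\<close> is the operator norm.\<close>

definition BH :: "('h::complex_hilbert_space \<Rightarrow>\<^sub>L 'h) set" where
  "BH = {T. \<forall>c x. blinfun_apply T (c *\<^sub>C x) = c *\<^sub>C blinfun_apply T x}"

definition scalar_op :: "complex \<Rightarrow> ('h::complex_hilbert_space \<Rightarrow>\<^sub>L 'h)" where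
  "scalar_op c = Blinfun (\<lambda>x. c *\<^sub>C x)"

definition op_scale ::
    "complex \<Rightarrow> ('h::complex_hilbert_space \<Rightarrow>\<^sub>L 'h) \<Rightarrow> ('h \<Rightarrow>\<^sub>L 'h)" where
  "op_scale c T = scalar_op c o\<^sub>L T"

lemma norm_scaleC: "norm (c *\<^sub>C x) = cmod c * norm (x::'h::complex_hilbert_space)"
proof -
  have r: "cinner (c *\<^sub>C x) (c *\<^sub>C x) = c * cnj c * cinner x x"
    by (metis cinner_commute cinner_scaleC_left complex_cnj_cnj complex_cnj_mult mult.assoc)
  have "(norm (c *\<^sub>C x))\<^sup>2 = Re (cinner (c *\<^sub>C x) (c *\<^sub>C x))"
    by (simp add: power2_norm_eq_inner inner_eq_Re_cinner)
  also have "\<dots> = (cmod c)\<^sup>2 * Re (cinner x x)"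
    unfolding r complex_norm_square[symmetric] by simp
  also have "\<dots> = (cmod c * norm x)\<^sup>2"
    by (simp add: power_mult_distrib power2_norm_eq_inner inner_eq_Re_cinner)
  finally show ?thesis
    by (simp add: power2_eq_iff_nonneg)
qed

lemma bounded_linear_scaleC: "bounded_linear (\<lambda>x::'h::complex_hilbert_space. c *\<^sub>C x)"
proof (rule bounded_linear_intro)
  fix x y :: 'h and r :: real
  show "c *\<^sub>C (x + y) = c *\<^sub>C x + c *\<^sub>C y" by (rule scaleC_add_right)
  show "c *\<^sub>C (r *\<^sub>R x) = r *\<^sub>R (c *\<^sub>C x)"
    by (simp add: scaleC_of_real[symmetric] scaleC_scaleC mult.commute)
  show "norm (c *\<^sub>C x) \<le> norm x * cmod c"
    by (simp add: norm_scaleC mult.commute)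
qed

lemma scalar_op_apply [simp]: "blinfun_apply (scalar_op c) x = c *\<^sub>C x"
  by (simp add: scalar_op_def bounded_linear_Blinfun_apply bounded_linear_scaleC)

lemma op_scale_apply [simp]: "blinfun_apply (op_scale c T) x = c *\<^sub>C blinfun_apply T x"
  by (simp add: op_scale_def)

lemma scaleC_one: "1 *\<^sub>C x = (x::'h::complex_hilbert_space)"
  using scaleC_of_real[of 1 x] by simp

global_interpretation cop: vector_space
  "op_scale :: complex \<Rightarrow> ('h::complex_hilbert_space \<Rightarrow>\<^sub>L 'h) \<Rightarrow> ('h \<Rightarrow>\<^sub>L 'h)"
  by unfold_locales
    (auto intro!: blinfun_eqI
      simp: blinfun.add_left scaleC_add_right scaleC_add_left scaleC_scaleC scaleC_one)

definition adj :: "('h::complex_hilbert_space \<Rightarrow>\<^sub>L 'h) \<Rightarrow> ('h \<Rightarrow>\<^sub>L 'h)" where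
  "adj T = (THE S. \<forall>x y. cinner (blinfun_apply T x) y = cinner x (blinfun_apply S y))"

definition positive_op :: "('h::complex_hilbert_space \<Rightarrow>\<^sub>L 'h) \<Rightarrow> bool" where
  "positive_op T \<longleftrightarrow> T \<in> BH \<and> (\<forall>x. cinner (blinfun_apply T x) x \<in> \<real>\<^sub>\<ge>\<^sub>0)"

definition op_le :: "('h::complex_hilbert_space \<Rightarrow>\<^sub>L 'h) \<Rightarrow> ('h \<Rightarrow>\<^sub>L 'h) \<Rightarrow> bool" where
  "op_le S T \<longleftrightarrow> positive_op (T - S)"

definition is_projection :: "('h::complex_hilbert_space \<Rightarrow>\<^sub>L 'h) \<Rightarrow> bool" where
  "is_projection p \<longleftrightarrow> p \<in> BH \<and> adj p = p \<and> p o\<^sub>L p = p"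

definition orth_proj :: "'h::complex_hilbert_space set \<Rightarrow> ('h \<Rightarrow>\<^sub>L 'h)" where
  "orth_proj K = (THE P. \<forall>x. blinfun_apply P x \<in> K \<and>
     (\<forall>y\<in>K. cinner (x - blinfun_apply P x) y = 0))"

definition commutant ::
    "('h::complex_hilbert_space \<Rightarrow>\<^sub>L 'h) set \<Rightarrow> ('h \<Rightarrow>\<^sub>L 'h) set" where
  "commutant S = {T \<in> BH. \<forall>A\<in>S. T o\<^sub>L A = A o\<^sub>L T}"

definition von_neumann_algebra :: "('h::complex_hilbert_space \<Rightarrow>\<^sub>L 'h) set \<Rightarrow> bool" where
  "von_neumann_algebra M \<longleftrightarrow>
     (\<forall>x\<in>M. adj x \<in> M) \<and> commutant (commutant M) = M"

definition generated_vna ::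
    "('h::complex_hilbert_space \<Rightarrow>\<^sub>L 'h) set \<Rightarrow> ('h \<Rightarrow>\<^sub>L 'h) set" where
  "generated_vna S = \<Inter>{A. von_neumann_algebra A \<and> S \<subseteq> A}"

text \<open>The first condition excludes the zero Hilbert space.\<close>

definition is_factor :: "('h::complex_hilbert_space \<Rightarrow>\<^sub>L 'h) set \<Rightarrow> bool" where
  "is_factor M \<longleftrightarrow> (id_blinfun :: 'h \<Rightarrow>\<^sub>L 'h) \<noteq> 0 \<and>
     von_neumann_algebra M \<and> M \<inter> commutant M = range scalar_op"

definition minimal_projection ::
    "('h::complex_hilbert_space \<Rightarrow>\<^sub>L 'h) set \<Rightarrow> ('h \<Rightarrow>\<^sub>L 'h) \<Rightarrow> bool" where
  "minimal_projection M p \<longleftrightarrow> p \<in> M \<and> is_projection p \<and> p \<noteq> 0 \<and>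
     (\<forall>q\<in>M. is_projection q \<and> op_le q p \<longrightarrow> q = 0 \<or> q = p)"

text \<open>A factor is of type \<open>II\<^sub>1\<close> if its unit is a finite projection and it is not of type \<open>I\<close>,
  that is, has no minimal projection.\<close>

definition II1_factor :: "('h::complex_hilbert_space \<Rightarrow>\<^sub>L 'h) set \<Rightarrow> bool" where
  "II1_factor M \<longleftrightarrow> is_factor M \<and>
     (\<forall>v\<in>M. adj v o\<^sub>L v = id_blinfun \<longrightarrow> v o\<^sub>L adj v = id_blinfun) \<and>
     (\<nexists>p. minimal_projection M p)"

definition subfactor ::
    "('h::complex_hilbert_space \<Rightarrow>\<^sub>L 'h) set \<Rightarrow> ('h \<Rightarrow>\<^sub>L 'h) set \<Rightarrow> bool" where
  "subfactor N M \<longleftrightarrow> is_factor N \<and> N \<subseteq> M"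

definition unitaries :: "('h::complex_hilbert_space \<Rightarrow>\<^sub>L 'h) set \<Rightarrow> ('h \<Rightarrow>\<^sub>L 'h) set" where
  "unitaries M = {u \<in> M. adj u o\<^sub>L u = id_blinfun \<and> u o\<^sub>L adj u = id_blinfun}"

definition conjugate ::
    "('h::complex_hilbert_space \<Rightarrow>\<^sub>L 'h) \<Rightarrow> ('h \<Rightarrow>\<^sub>L 'h) set \<Rightarrow> ('h \<Rightarrow>\<^sub>L 'h) set" where
  "conjugate u B = (\<lambda>x. u o\<^sub>L x o\<^sub>L adj u) ` B"

definition singular_in ::
    "('h::complex_hilbert_space \<Rightarrow>\<^sub>L 'h) set \<Rightarrow> ('h \<Rightarrow>\<^sub>L 'h) set \<Rightarrow> bool" where
  "singular_in N M \<longleftrightarrow> (\<forall>u\<in>unitaries M. conjugate u N = N \<longrightarrow> u \<in> N)"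

definition bounded_directed_sup ::
    "('h::complex_hilbert_space \<Rightarrow>\<^sub>L 'h) set \<Rightarrow> ('h \<Rightarrow>\<^sub>L 'h) set \<Rightarrow> ('h \<Rightarrow>\<^sub>L 'h) \<Rightarrow> bool" where
  "bounded_directed_sup M D s \<longleftrightarrow>
     D \<noteq> {} \<and> D \<subseteq> M \<and> (\<forall>x\<in>D. positive_op x) \<and>
     (\<forall>x\<in>D. \<forall>y\<in>D. \<exists>z\<in>D. op_le x z \<and> op_le y z) \<and>
     s \<in> M \<and> (\<forall>x\<in>D. op_le x s) \<and>
     (\<forall>t\<in>M. (\<forall>x\<in>D. op_le x t) \<longrightarrow> op_le s t)"

definition linear_on_alg ::
    "('h::complex_hilbert_space \<Rightarrow>\<^sub>L 'h) set \<Rightarrow> (complex \<Rightarrow> 'b \<Rightarrow> 'b::plus) \<Rightarrow>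
     (('h \<Rightarrow>\<^sub>L 'h) \<Rightarrow> 'b) \<Rightarrow> bool" where
  "linear_on_alg M sc f \<longleftrightarrow>
     (\<forall>x\<in>M. \<forall>y\<in>M. f (x + y) = f x + f y) \<and>
     (\<forall>c. \<forall>x\<in>M. f (op_scale c x) = sc c (f x))"

definition normal_faithful_tracial_state ::
    "('h::complex_hilbert_space \<Rightarrow>\<^sub>L 'h) set \<Rightarrow> (('h \<Rightarrow>\<^sub>L 'h) \<Rightarrow> complex) \<Rightarrow> bool" where
  "normal_faithful_tracial_state M \<tau> \<longleftrightarrow>
     linear_on_alg M (*) \<tau> \<and>
     \<tau> id_blinfun = 1 \<and>
     (\<forall>x\<in>M. \<tau> (adj x o\<^sub>L x) \<in> \<real>\<^sub>\<ge>\<^sub>0) \<and>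
     (\<forall>x\<in>M. \<tau> (adj x o\<^sub>L x) = 0 \<longrightarrow> x = 0) \<and>
     (\<forall>x\<in>M. \<forall>y\<in>M. \<tau> (x o\<^sub>L y) = \<tau> (y o\<^sub>L x)) \<and>
     (\<forall>D s. bounded_directed_sup M D s \<longrightarrow> Re (\<tau> s) = (SUP x\<in>D. Re (\<tau> x)))"

text \<open>The Hilbert space \<open>'h\<close>, with the embedding of \<open>M\<close> by \<open>x \<mapsto> x \<Omega>\<close>, is the completion
  \<open>L\<^sup>2(M,\<tau>)\<close> of \<open>M\<close> for the inner product \<open>(x,y) \<mapsto> \<tau>(y* x)\<close>, on which \<open>M\<close> acts by left
  multiplication; \<open>\<Omega>\<close> is the vector of the unit of \<open>M\<close>.\<close>

definition acts_on_L2 ::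
    "('h::complex_hilbert_space \<Rightarrow>\<^sub>L 'h) set \<Rightarrow> (('h \<Rightarrow>\<^sub>L 'h) \<Rightarrow> complex) \<Rightarrow> 'h \<Rightarrow> bool" where
  "acts_on_L2 M \<tau> \<Omega> \<longleftrightarrow>
     (\<forall>x\<in>M. \<forall>y\<in>M. cinner (blinfun_apply x \<Omega>) (blinfun_apply y \<Omega>) = \<tau> (adj y o\<^sub>L x)) \<and>
     closure ((\<lambda>x. blinfun_apply x \<Omega>) ` M) = UNIV"

definition L2 :: "'h::complex_hilbert_space \<Rightarrow> ('h \<Rightarrow>\<^sub>L 'h) set \<Rightarrow> 'h set" where
  "L2 \<Omega> B = closure ((\<lambda>x. blinfun_apply x \<Omega>) ` B)"

definition jones_projection ::
    "'h::complex_hilbert_space \<Rightarrow> ('h \<Rightarrow>\<^sub>L 'h) set \<Rightarrow> ('h \<Rightarrow>\<^sub>L 'h)" where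
  "jones_projection \<Omega> N = orth_proj (L2 \<Omega> N)"

definition basic_construction ::
    "'h::complex_hilbert_space \<Rightarrow> ('h \<Rightarrow>\<^sub>L 'h) set \<Rightarrow> ('h \<Rightarrow>\<^sub>L 'h) set \<Rightarrow> ('h \<Rightarrow>\<^sub>L 'h) set" where
  "basic_construction \<Omega> M N = generated_vna (insert (jones_projection \<Omega> N) M)"

text \<open>
  A left Hilbert \<open>N\<close>-module \<open>H\<close> is isomorphic to \<open>p (L\<^sup>2(N) \<otimes> \<ell>\<^sup>2(I))\<close> for some \<open>I\<close> and some
  projection \<open>p\<close> in the commutant of \<open>N\<close>, and its dimension is the trace of \<open>p\<close>, for the tensor
  product of the vector state of \<open>\<Omega>\<close> and the usual trace on \<open>B(\<ell>\<^sup>2(I))\<close>. Such an isomorphism is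
  given by an \<open>N\<close>-linear isometry \<open>V\<close> from \<open>H\<close> to the direct sum of \<open>I\<close> copies of \<open>L\<^sup>2(N)\<close>, with
  components \<open>V i\<close>. Then \<open>p = V V*\<close> has the diagonal entries \<open>V i (V i)*\<close>, and its trace is the
  sum over \<open>i\<close> of the numbers \<open>\<langle>V i (V i)* \<Omega>, \<Omega>\<rangle> = \<parallel>(V i)* \<Omega>\<parallel>\<^sup>2\<close>. Here \<open>H = L\<^sup>2(M)\<close> is the whole
  space. Taking \<open>I\<close> to be a set of elements of \<open>H\<close> is no restriction on its size, as \<open>H\<close> is a direct
  sum of cyclic modules generated by pairwise orthogonal nonzero vectors.
\<close>

definition module_embedding ::
    "'h::complex_hilbert_space \<Rightarrow> ('h \<Rightarrow>\<^sub>L 'h) set \<Rightarrow> 'h set \<Rightarrow> ('h \<Rightarrow> ('h \<Rightarrow>\<^sub>L 'h)) \<Rightarrow> bool" where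
  "module_embedding \<Omega> N I V \<longleftrightarrow>
     (\<forall>i\<in>I. V i \<in> commutant N \<and> range (blinfun_apply (V i)) \<subseteq> L2 \<Omega> N) \<and>
     (\<forall>\<xi>. ((\<lambda>i. (norm (blinfun_apply (V i) \<xi>))\<^sup>2) has_sum (norm \<xi>)\<^sup>2) I)"

definition jones_index :: "'h::complex_hilbert_space \<Rightarrow> ('h \<Rightarrow>\<^sub>L 'h) set \<Rightarrow> ennreal" where
  "jones_index \<Omega> N = (THE d. \<exists>I V. module_embedding \<Omega> N I V \<and>
     d = (\<Sum>\<^sub>\<infinity>i\<in>I. ennreal ((norm (blinfun_apply (adj (V i)) \<Omega>))\<^sup>2)))"

definition norm2 ::
    "(('h::complex_hilbert_space \<Rightarrow>\<^sub>L 'h) \<Rightarrow> complex) \<Rightarrow> ('h \<Rightarrow>\<^sub>L 'h) \<Rightarrow> real" where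
  "norm2 \<tau> x = sqrt (Re (\<tau> (adj x o\<^sub>L x)))"

definition norm_inf2 ::
    "('h::complex_hilbert_space \<Rightarrow>\<^sub>L 'h) set \<Rightarrow> (('h \<Rightarrow>\<^sub>L 'h) \<Rightarrow> complex) \<Rightarrow>
     (('h \<Rightarrow>\<^sub>L 'h) \<Rightarrow> ('h \<Rightarrow>\<^sub>L 'h)) \<Rightarrow> ereal" where
  "norm_inf2 M \<tau> T = (SUP x\<in>{x \<in> M. norm x \<le> 1}. ereal (norm2 \<tau> (T x)))"

definition is_cond_exp ::
    "('h::complex_hilbert_space \<Rightarrow>\<^sub>L 'h) set \<Rightarrow> (('h \<Rightarrow>\<^sub>L 'h) \<Rightarrow> complex) \<Rightarrow> ('h \<Rightarrow>\<^sub>L 'h) set \<Rightarrow>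
     (('h \<Rightarrow>\<^sub>L 'h) \<Rightarrow> ('h \<Rightarrow>\<^sub>L 'h)) \<Rightarrow> bool" where
  "is_cond_exp M \<tau> B E \<longleftrightarrow>
     linear_on_alg M op_scale E \<and>
     (\<forall>x\<in>M. E x \<in> B) \<and>
     (\<forall>b\<in>B. E b = b) \<and>
     (\<forall>x\<in>M. positive_op x \<longrightarrow> positive_op (E x)) \<and>
     (\<forall>a\<in>B. \<forall>b\<in>B. \<forall>x\<in>M. E (a o\<^sub>L x o\<^sub>L b) = a o\<^sub>L E x o\<^sub>L b) \<and>
     (\<forall>x\<in>M. \<tau> (E x) = \<tau> x) \<and>
     (\<forall>x\<in>M. E (adj x o\<^sub>L x) = 0 \<longrightarrow> x = 0) \<and>
     (\<forall>D s. bounded_directed_sup M D s \<longrightarrow> bounded_directed_sup B (E ` D) (E s))"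

text \<open>The values outside \<open>M\<close> are fixed by \<open>extensional\<close> to make the map unique.\<close>

definition cond_exp ::
    "('h::complex_hilbert_space \<Rightarrow>\<^sub>L 'h) set \<Rightarrow> (('h \<Rightarrow>\<^sub>L 'h) \<Rightarrow> complex) \<Rightarrow> ('h \<Rightarrow>\<^sub>L 'h) set \<Rightarrow>
     ('h \<Rightarrow>\<^sub>L 'h) \<Rightarrow> ('h \<Rightarrow>\<^sub>L 'h)" where
  "cond_exp M \<tau> B = (THE E. is_cond_exp M \<tau> B E \<and> E \<in> extensional M)"

text \<open>The range of \<open>\<alpha>\<close> is part of the notion.\<close>

definition strongly_singular_with ::
    "real \<Rightarrow> ('h::complex_hilbert_space \<Rightarrow>\<^sub>L 'h) set \<Rightarrow> (('h \<Rightarrow>\<^sub>L 'h) \<Rightarrow> complex) \<Rightarrow>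
     ('h \<Rightarrow>\<^sub>L 'h) set \<Rightarrow> bool" where
  "strongly_singular_with \<alpha> M \<tau> B \<longleftrightarrow> 0 < \<alpha> \<and> \<alpha> \<le> 1 \<and>
     (\<forall>u\<in>unitaries M.
        ereal (\<alpha> * norm2 \<tau> (u - cond_exp M \<tau> B u))
          \<le> norm_inf2 M \<tau> (\<lambda>x. cond_exp M \<tau> B x - cond_exp M \<tau> (conjugate u B) x))"

definition strongly_singular ::
    "('h::complex_hilbert_space \<Rightarrow>\<^sub>L 'h) set \<Rightarrow> (('h \<Rightarrow>\<^sub>L 'h) \<Rightarrow> complex) \<Rightarrow>
     ('h \<Rightarrow>\<^sub>L 'h) set \<Rightarrow> bool" where
  "strongly_singular M \<tau> B \<longleftrightarrow> strongly_singular_with 1 M \<tau> B"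

end

theory Submission
  imports Defs
begin

text \<open>
  Let \<open>u\<close> be a unitary of \<open>M\<close>, \<open>\<lambda> = [M:N]\<close> and \<open>a = \<parallel>E\<^sub>N(u)\<parallel>\<^sub>2\<^sup>2\<close>, so that \<open>\<parallel>u - E\<^sub>N(u)\<parallel>\<^sub>2\<^sup>2 = 1 - a\<close>.
  Averaging the projections \<open>w u e\<^sub>N u\<^sup>* w\<^sup>*\<close> over the unitaries \<open>w\<close> of \<open>N\<close> gives an operator \<open>h\<close> that
  commutes with \<open>N\<close>: it is the limit of the convex combinations nearest to 0 in the Hilbert-Schmidt norm
  of the trace of \<open>\<langle>M, e\<^sub>N\<rangle>\<close>. As the relative commutant is 2-dimensional, \<open>h = a e\<^sub>N + b (1 - e\<^sub>N)\<close>.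
  Since \<open>e\<^sub>N\<close> has trace 1 and 1 has trace \<open>\<lambda>\<close>, we get \<open>a + b (\<lambda> - 1) \<le> 1\<close>, and \<open>b = 0\<close> if \<open>\<lambda> = \<infinity>\<close>.
  Testing \<open>h\<close> at the vector \<open>u\<close>, the average of \<open>\<parallel>E\<^sub>N(u\<^sup>* w\<^sup>* u)\<parallel>\<^sub>2\<^sup>2\<close> is \<open>a\<^sup>2 + b (1 - a)\<close>, so some \<open>w\<close>
  satisfies \<open>\<parallel>w - E(w)\<parallel>\<^sub>2\<^sup>2 \<ge> 1 - a\<^sup>2 - b (1 - a) - \<epsilon>\<close>, where \<open>E\<close> is the expectation onto \<open>u N u\<^sup>*\<close>. The
  right-hand side is at least \<open>(1 - a) (\<lambda> - 2) / (\<lambda> - 1) - \<epsilon>\<close>. Singularity enters through \<open>\<lambda> > 2\<close>.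
\<close>

text \<open>The averaging is carried out after conjugation by \<open>J\<close>, inside the commutant
  of \<open>N\<close>. There the definition of the index already contains a trace: the sum of
  squared norms attached to a module embedding. It is shown to be tracial, faithful and independent
  of the embedding. The averages converge only strongly, so the trace of the limit is controlled
  through finite partial sums; this yields only an inequality for
  \<open>a + b (\<lambda> - 1)\<close>, which suffices because \<open>b\<close> enters the final
  estimate from above. With k = 1 - a the inequality says b \<le> k / (\<lambda> - 1), and k \<le> 1
  makes 1 - (1 - k)^2 - b k at least k - k / (\<lambda> - 1); this is the origin of the constant. It
  has to be positive, so index at most 2 must be excluded: a proper subfactor of such index is
  normalized by a unitary outside it.\<close>

section \<open>Bounded operators on a Hilbert space\<close>

text \<open>A minimizing sequence for the distance from \<open>x\<close> to \<open>K\<close> is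
  Cauchy by the parallelogram law, since midpoints stay in \<open>K\<close>. Its limit cannot be
  improved by moving along any \<open>y\<close> in \<open>K\<close>, which is orthogonality.\<close>

lemma projection_point_exists:
  fixes K :: "'a::{real_inner,banach} set"
  assumes K: "subspace K" "closed K"
  shows "\<exists>p\<in>K. \<forall>y\<in>K. inner (x - p) y = 0"
proof -
  define D where "D = (\<lambda>p. (norm (x - p))\<^sup>2) ` K"
  define d where "d = Inf D"
  have ne: "D \<noteq> {}" using subspace_0[OF K(1)] by (auto simp: D_def)
  have bdd: "bdd_below D" by (rule bdd_belowI[of _ 0]) (auto simp: D_def)
  have d_le: "d \<le> (norm (x - p))\<^sup>2" if "p \<in> K" for p
    unfolding d_def by (rule cInf_lower[OF _ bdd]) (use that in \<open>auto simp: D_def\<close>)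
  have "\<exists>p\<in>K. (norm (x - p))\<^sup>2 < d + 1 / real (Suc n)" for n
  proof -
    have "Inf D < d + 1 / real (Suc n)" unfolding d_def by simp
    then show ?thesis
      using cInf_lessD[OF ne] by (auto simp: D_def)
  qed
  then obtain p where pK: "\<And>n. p n \<in> K" and p: "\<And>n. (norm (x - p n))\<^sup>2 < d + 1 / real (Suc n)"
    by metis
  have par: "(norm (a - b))\<^sup>2 \<le> 2 * (norm (x - a))\<^sup>2 + 2 * (norm (x - b))\<^sup>2 - 4 * d"
    if "a \<in> K" "b \<in> K" for a b
  proof -
    have m: "(1/2) *\<^sub>R (a + b) \<in> K" using that K(1) by (simp add: subspace_add subspace_scale)
    have "(norm (a - b))\<^sup>2 = 2 * (norm (x - a))\<^sup>2 + 2 * (norm (x - b))\<^sup>2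
            - 4 * (norm (x - (1/2) *\<^sub>R (a + b)))\<^sup>2"
      by (simp add: power2_norm_eq_inner inner_diff_left inner_diff_right inner_add_left inner_add_right
          inner_commute algebra_simps)
    then show ?thesis using d_le[OF m] by simp
  qed
  have C: "Cauchy p"
  proof (rule metric_CauchyI)
    fix e :: real assume e: "0 < e"
    obtain N where N: "4 / e\<^sup>2 < real N" using reals_Archimedean2 by blast
    have "dist (p m) (p n) < e" if mn: "m \<ge> Suc N" "n \<ge> Suc N" for m n
    proof -
      have N0: "0 < real N" using N e by (smt (verit) divide_nonneg_pos zero_less_power)
      have i: "1 / real (Suc k) < 1 / real N" if "k \<ge> Suc N" for k
        using that N0 by (simp add: field_simps)
      have "(norm (p m - p n))\<^sup>2 \<le> 2 * (1 / real (Suc m)) + 2 * (1 / real (Suc n))"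
        using par[OF pK pK, of m n] p[of m] p[of n] by simp
      also have "\<dots> < 4 / real N" using i[OF mn(1)] i[OF mn(2)] by simp
      also have "\<dots> < e\<^sup>2" using N N0 e by (simp add: field_simps)
      finally show ?thesis using e by (simp add: dist_norm power2_less_imp_less)
    qed
    then show "\<exists>M. \<forall>m\<ge>M. \<forall>n\<ge>M. dist (p m) (p n) < e" by blast
  qed
  then obtain q where q: "p \<longlonglongrightarrow> q" using Cauchy_convergent convergent_def by blast
  have qK: "q \<in> K" using closed_sequentially[OF K(2)] pK q by blast
  have "(norm (x - q))\<^sup>2 \<le> d"
  proof -
    have l1: "(\<lambda>n. (norm (x - p n))\<^sup>2) \<longlonglongrightarrow> (norm (x - q))\<^sup>2" by (intro tendsto_intros q)
    have l2: "(\<lambda>n. d + 1 / real (Suc n)) \<longlonglongrightarrow> d + 0"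
      by (intro tendsto_intros LIMSEQ_Suc[OF lim_1_over_n])
    have "(norm (x - q))\<^sup>2 \<le> d + 0"
      by (rule LIMSEQ_le[OF l1 l2]) (meson p less_imp_le)
    then show ?thesis by simp
  qed
  then have qd: "(norm (x - q))\<^sup>2 \<le> (norm (x - q - t *\<^sub>R y))\<^sup>2" if "y \<in> K" for t y
    using d_le[of "q + t *\<^sub>R y"] qK that K(1) by (simp add: subspace_add subspace_scale diff_diff_add del: power_mono_iff power2_le_iff_abs_le)
  have "inner (x - q) y = 0" if y: "y \<in> K" for y
  proof (cases "y = 0")
    case False
    \<comment> \<open>This \<open>t\<close> minimizes the squared norm of
      \<open>x - q - t *\<^sub>R y\<close>, a quadratic polynomial in \<open>t\<close>; a nonzero
      inner product would bring the distance below the minimum.\<close>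
    define t where "t = inner (x - q) y / inner y y"
    have yy: "inner y y > 0" using False by simp
    have "(norm (x - q - t *\<^sub>R y))\<^sup>2 = (norm (x - q))\<^sup>2 - 2 * t * inner (x - q) y + t * t * inner y y"
      by (simp add: power2_norm_eq_inner inner_diff_left inner_diff_right inner_commute algebra_simps)
    also have "t * t * inner y y = t * inner (x - q) y" using yy by (simp add: t_def)
    finally have "t * inner (x - q) y \<le> 0" using qd[OF y, of t] by simp
    then have "(inner (x - q) y)\<^sup>2 / inner y y \<le> 0" by (simp add: t_def power2_eq_square)
    then have "(inner (x - q) y)\<^sup>2 \<le> 0" using yy by (simp add: divide_le_0_iff)
    then show ?thesis by simp
  qed simp
  with qK show ?thesis by blast
qed

text \<open>A vector orthogonal to the kernel of \<open>f\<close> represents \<open>f\<close> after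
  rescaling, because the kernel has codimension at most one.\<close>

lemma riesz_representation:
  fixes f :: "'a::{real_inner,banach} \<Rightarrow> real"
  assumes f: "bounded_linear f"
  shows "\<exists>y. \<forall>v. f v = inner v y"
proof -
  interpret f: bounded_linear f by (rule f)
  define K where "K = {v. f v = 0}"
  have sub: "subspace K" by (auto simp: K_def subspace_def f.zero f.add f.scaleR)
  have "closed (f -` {0})"
    by (rule closed_vimage) (auto intro: f.continuous_on continuous_on_id)
  then have cl: "closed K" by (simp add: K_def vimage_def)
  show ?thesis
  proof (cases "K = UNIV")
    case True
    then have "\<forall>v. f v = inner v 0" by (auto simp: K_def)
    then show ?thesis by blast
  next
    case False
    then obtain x where x: "x \<notin> K" by blast
    obtain p where p: "p \<in> K" "\<forall>y\<in>K. inner (x - p) y = 0"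
      using projection_point_exists[OF sub cl] by blast
    define z where "z = x - p"
    have z0: "z \<noteq> 0" using x p(1) by (auto simp: z_def)
    have fz: "f z \<noteq> 0"
    proof
      assume "f z = 0"
      then have "inner z z = 0" using p(2) by (auto simp: z_def K_def)
      then show False using z0 by simp
    qed
    have "f v = inner v ((f z / inner z z) *\<^sub>R z)" for v
    proof -
      have "v - (f v / f z) *\<^sub>R z \<in> K" using fz by (simp add: K_def f.diff f.scaleR)
      then have "inner z (v - (f v / f z) *\<^sub>R z) = 0" using p(2) by (simp add: z_def)
      then have "inner v z = f v / f z * inner z z"
        by (simp add: inner_diff_right inner_commute)
      then show ?thesis using fz z0 by simp
    qed
    then show ?thesis by blast
  qed
qed

lemma real_adjoint_exists:
  fixes T :: "'a::{real_inner,banach} \<Rightarrow>\<^sub>L 'a"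
  shows "\<exists>S::'a \<Rightarrow>\<^sub>L 'a. \<forall>x y. inner (T x) y = inner x (S y)"
proof -
  have "\<exists>s. \<forall>x. inner (T x) y = inner x s" for y
    by (rule riesz_representation) (intro bounded_linear_intros)
  then obtain s where s: "\<And>x y. inner (T x) y = inner x (s y)" by metis
  have eqI: "a = b" if "\<And>x. inner x a = inner x b" for a b :: 'a
    using that inner_eq_zero_iff[of "a - b"] by (simp add: inner_diff_right)
  have "bounded_linear s"
  proof (rule bounded_linear_intro)
    show "s (x + y) = s x + s y" for x y
      by (rule eqI) (simp add: s[symmetric] inner_add_right)
    show "s (r *\<^sub>R x) = r *\<^sub>R s x" for r x
      by (rule eqI) (simp add: s[symmetric])
    show "norm (s x) \<le> norm x * norm T" for x
    proof (cases "s x = 0")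
      case False
      have "norm (s x) * norm (s x) = inner (T (s x)) x"
        by (simp add: s power2_norm_eq_inner[symmetric] power2_eq_square)
      also have "\<dots> \<le> norm (T (s x)) * norm x" by (rule norm_cauchy_schwarz)
      also have "\<dots> \<le> norm T * norm (s x) * norm x"
        by (intro mult_right_mono norm_blinfun) simp
      finally show ?thesis using False by (simp add: mult.assoc mult.commute)
    qed simp
  qed
  then have "\<forall>x y. inner (T x) y = inner x (Blinfun s y)"
    by (simp add: bounded_linear_Blinfun_apply s)
  then show ?thesis by blast
qed

text \<open>The adjoint for the real inner product. It also exists for operators that are not
  complex-linear, such as the conjugation \<open>J\<close> below, and it agrees with
  \<open>adj\<close> on \<open>BH\<close> by \<open>adj_eq_radj\<close>.\<close>

definition radj :: "('a::{real_inner,banach} \<Rightarrow>\<^sub>L 'a) \<Rightarrow> ('a \<Rightarrow>\<^sub>L 'a)" where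
  "radj T = (SOME S. \<forall>x y. inner (blinfun_apply T x) y = inner x (blinfun_apply S y))"

lemma inner_radj: "inner (blinfun_apply T x) y = inner x (blinfun_apply (radj T) y)"
proof -
  have "\<forall>x y. inner (T x) y = inner x (radj T y)"
    unfolding radj_def by (rule someI_ex[OF real_adjoint_exists])
  then show ?thesis by blast
qed

lemma inner_radj': "inner (blinfun_apply (radj T) x) y = inner x (blinfun_apply T y)"
  by (rule trans[OF inner_commute trans[OF inner_radj[symmetric] inner_commute]])

lemma vector_inner_eqI: "a = b" if "\<And>x. inner a x = inner b x" for a b :: "'a::real_inner"
  using that inner_eq_zero_iff[of "a - b"] by (simp add: inner_diff_left)

lemma radj_eqI:
  assumes "\<And>x y. inner (blinfun_apply T x) y = inner x (blinfun_apply S y)"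
  shows "radj T = S"
proof (rule blinfun_eqI, rule vector_inner_eqI)
  fix y x
  show "inner (radj T y) x = inner (S y) x"
    by (rule trans[OF trans[OF inner_commute inner_radj[symmetric]] trans[OF assms inner_commute]])
qed

lemma radj_radj [simp]: "radj (radj T) = T"
  by (rule radj_eqI) (rule inner_radj')

lemma radj_compose [simp]: "radj (S o\<^sub>L T) = radj T o\<^sub>L radj S"
  by (rule radj_eqI) (simp add: inner_radj)

lemma radj_id [simp]: "radj id_blinfun = id_blinfun"
  by (rule radj_eqI) simp

lemma radj_zero [simp]: "radj 0 = 0"
  by (rule radj_eqI) simp

lemma radj_add [simp]: "radj (S + T) = radj S + radj T"
  by (rule radj_eqI) (simp add: blinfun.add_left inner_radj inner_add_left inner_add_right)

lemma radj_diff [simp]: "radj (S - T) = radj S - radj T"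
  by (rule radj_eqI) (simp add: blinfun.diff_left inner_radj inner_diff_left inner_diff_right)

lemma radj_minus [simp]: "radj (- T) = - radj T"
  by (rule radj_eqI) (simp add: blinfun.minus_left inner_radj)

lemma radj_scaleR [simp]: "radj (c *\<^sub>R T) = c *\<^sub>R radj T"
  by (rule radj_eqI) (simp add: blinfun.scaleR_left inner_radj)

lemma norm_radj_le: "norm (radj T) \<le> norm T"
proof (rule norm_blinfun_bound)
  fix x
  show "norm (radj T x) \<le> norm T * norm x"
  proof (cases "radj T x = 0")
    case False
    have "norm (radj T x) * norm (radj T x) = inner (radj T x) (radj T x)"
      by (simp add: dot_square_norm power2_eq_square)
    also have "\<dots> = inner x (T (radj T x))" by (rule inner_radj')
    also have "\<dots> \<le> norm x * norm (T (radj T x))" by (rule norm_cauchy_schwarz)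
    also have "\<dots> \<le> norm x * (norm T * norm (radj T x))"
      by (intro mult_left_mono norm_blinfun) simp
    finally show ?thesis using False by (simp add: mult.assoc mult.commute)
  qed simp
qed simp

lemma norm_isometry:
  assumes "radj u o\<^sub>L u = id_blinfun"
  shows "norm (blinfun_apply u x) = norm x"
proof -
  have "inner (u x) (u x) = inner x ((radj u o\<^sub>L u) x)" by (simp add: inner_radj)
  then show ?thesis by (simp add: assms norm_eq_sqrt_inner)
qed

lemma blinfun_compose_assoc: "(A o\<^sub>L B) o\<^sub>L C = A o\<^sub>L (B o\<^sub>L C)"
  by (rule blinfun_eqI) simp
lemma blinfun_compose_add_left: "(A + B) o\<^sub>L C = (A o\<^sub>L C) + (B o\<^sub>L C)"
  by (rule blinfun_eqI) (simp add: blinfun.add_left)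
lemma blinfun_compose_add_right: "A o\<^sub>L (B + C) = (A o\<^sub>L B) + (A o\<^sub>L C)"
  by (rule blinfun_eqI) (simp add: blinfun.add_left blinfun.add_right)
lemma blinfun_compose_diff_left: "(A - B) o\<^sub>L C = (A o\<^sub>L C) - (B o\<^sub>L C)"
  by (rule blinfun_eqI) (simp add: blinfun.diff_left)
lemma blinfun_compose_diff_right: "A o\<^sub>L (B - C) = (A o\<^sub>L B) - (A o\<^sub>L C)"
  by (rule blinfun_eqI) (simp add: blinfun.diff_left blinfun.diff_right)
lemma blinfun_compose_scaleR_left: "(c *\<^sub>R A) o\<^sub>L B = c *\<^sub>R (A o\<^sub>L B)"
  by (rule blinfun_eqI) (simp add: blinfun.scaleR_left)
lemma blinfun_compose_scaleR_right: "A o\<^sub>L (c *\<^sub>R B) = c *\<^sub>R (A o\<^sub>L B)"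
  by (rule blinfun_eqI) (simp add: blinfun.scaleR_left blinfun.scaleR_right)
lemma blinfun_compose_minus_left: "(- A) o\<^sub>L B = - (A o\<^sub>L B)"
  by (rule blinfun_eqI) (simp add: blinfun.minus_left)
lemma blinfun_compose_minus_right: "A o\<^sub>L (- B) = - (A o\<^sub>L B)"
  by (rule blinfun_eqI) (simp add: blinfun.minus_left blinfun.minus_right)
lemma blinfun_compose_id_left [simp]: "id_blinfun o\<^sub>L A = A"
  by (rule blinfun_eqI) simp
lemma blinfun_compose_id_right [simp]: "A o\<^sub>L id_blinfun = A"
  by (rule blinfun_eqI) simp

lemmas blinfun_compose_linear = blinfun_compose_add_left blinfun_compose_add_right
  blinfun_compose_diff_left blinfun_compose_diff_right
  blinfun_compose_scaleR_left blinfun_compose_scaleR_right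
  blinfun_compose_minus_left blinfun_compose_minus_right

lemmas blinfun_apply_linear = blinfun.add_left blinfun.diff_left blinfun.scaleR_left blinfun.minus_left

text \<open>The limit of \<open>C\<^sub>n\<^sub>+\<^sub>1 = (Z + C\<^sub>n\<^sup>2)/2\<close> solves \<open>(1 - C)\<^sup>2 = 1 - Z\<close>. For \<open>\<parallel>Z\<parallel> \<le> 1\<close> the iteration is
  dominated in norm by the same iteration for the number 1, which increases and is bounded by 1.\<close>

lemma sqrt_iteration:
  fixes Z :: "'a::{real_inner,banach} \<Rightarrow>\<^sub>L 'a"
  assumes Z: "norm Z \<le> 1" "radj Z = Z"
  shows "\<exists>R. R o\<^sub>L R = id_blinfun - Z \<and> radj R = R \<and>
     (\<forall>T. T o\<^sub>L Z = Z o\<^sub>L T \<longrightarrow> T o\<^sub>L R = R o\<^sub>L T)"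
proof -
  define C where "C = rec_nat 0 (\<lambda>_ c. (1/2) *\<^sub>R (Z + (c o\<^sub>L c)))"
  define t :: "nat \<Rightarrow> real" where "t = rec_nat 0 (\<lambda>_ c. (1/2) * (1 + c * c))"
  have C0: "C 0 = 0" and CS: "C (Suc n) = (1/2) *\<^sub>R (Z + (C n o\<^sub>L C n))" for n
    by (simp_all add: C_def)
  have t0: "t 0 = 0" and tS: "t (Suc n) = (1/2) * (1 + t n * t n)" for n
    by (simp_all add: t_def)
  have t01: "0 \<le> t n \<and> t n \<le> 1" for n
    by (induction n) (auto simp: t0 tS mult_le_one)
  have inc: "t n \<le> t (Suc n)" for n
  proof -
    have "0 \<le> (1 - t n)\<^sup>2" by simp
    then show ?thesis by (simp add: tS power2_eq_square algebra_simps)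
  qed
  have comm: "T o\<^sub>L C n = C n o\<^sub>L T" if "T o\<^sub>L Z = Z o\<^sub>L T" for T n
  proof (induction n)
    case (Suc n)
    have "T o\<^sub>L (C n o\<^sub>L C n) = (C n o\<^sub>L C n) o\<^sub>L T"
      by (metis Suc blinfun_compose_assoc)
    then show ?case using that by (simp add: CS blinfun_compose_linear)
  qed (simp add: C0)
  have commC: "C m o\<^sub>L C n = C n o\<^sub>L C m" for m n
    by (rule comm, rule comm[symmetric], rule refl)
  have sa: "radj (C n) = C n" for n
    by (induction n) (auto simp: C0 CS Z)
  have nC: "norm (C n) \<le> t n" for n
  proof (induction n)
    case (Suc n)
    have "norm (C n o\<^sub>L C n) \<le> norm (C n) * norm (C n)" by (rule norm_blinfun_compose)
    also have "\<dots> \<le> t n * t n" using Suc t01 by (intro mult_mono) auto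
    finally have "norm (Z + (C n o\<^sub>L C n)) \<le> 1 + t n * t n"
      using Z(1) norm_triangle_le by (smt (verit))
    then show ?case by (simp add: CS tS)
  qed (simp add: C0 t0)
  have nD: "norm (C (Suc n) - C n) \<le> t (Suc n) - t n" for n
  proof (induction n)
    case 0
    then show ?case using Z(1) by (simp add: CS C0 tS t0)
  next
    case (Suc n)
    have "C (Suc (Suc n)) - C (Suc n) = (1/2) *\<^sub>R ((C (Suc n) o\<^sub>L C (Suc n)) - (C n o\<^sub>L C n))"
      by (simp add: CS[of "Suc n"] CS[of n] algebra_simps)
    \<comment> \<open>All iterates commute, so the difference of squares factors as it does for
      numbers; hence the increments of \<open>C\<close> are dominated by those of
      \<open>t\<close>.\<close>
    also have "(C (Suc n) o\<^sub>L C (Suc n)) - (C n o\<^sub>L C n) = (C (Suc n) - C n) o\<^sub>L (C (Suc n) + C n)"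
      using commC[of "Suc n" n] by (simp add: blinfun_compose_linear)
    finally have "norm (C (Suc (Suc n)) - C (Suc n))
        = (1/2) * norm ((C (Suc n) - C n) o\<^sub>L (C (Suc n) + C n))" by simp
    also have "\<dots> \<le> (1/2) * (norm (C (Suc n) - C n) * norm (C (Suc n) + C n))"
      by (intro mult_left_mono norm_blinfun_compose) simp
    also have "\<dots> \<le> (1/2) * ((t (Suc n) - t n) * (t (Suc n) + t n))"
      using Suc inc[of n] nC[of n] nC[of "Suc n"] norm_triangle_ineq[of "C (Suc n)" "C n"]
      by (intro mult_left_mono mult_mono) auto
    also have "\<dots> = t (Suc (Suc n)) - t (Suc n)"
      by (simp add: tS[of "Suc n"] tS[of n] algebra_simps)
    finally show ?case .
  qed
  have nD2: "norm (C (n + k) - C n) \<le> t (n + k) - t n" for n k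
  proof (induction k)
    case (Suc k)
    have "norm (C (n + Suc k) - C n) \<le> norm (C (Suc (n + k)) - C (n + k)) + norm (C (n + k) - C n)"
      using norm_triangle_ineq[of "C (Suc (n + k)) - C (n + k)" "C (n + k) - C n"] by simp
    then show ?case using Suc nD[of "n + k"] by simp
  qed simp
  have "incseq t" using inc by (rule incseq_SucI)
  then have "convergent t"
    using t01 by (metis incseq_convergent convergent_def)
  then have "Cauchy t" by (rule convergent_Cauchy)
  have "Cauchy C"
  proof (rule metric_CauchyI)
    fix e :: real assume "0 < e"
    then obtain M where M: "\<And>m n. m \<ge> M \<Longrightarrow> n \<ge> M \<Longrightarrow> dist (t m) (t n) < e"
      using \<open>Cauchy t\<close> metric_CauchyD by blast
    have "dist (C m) (C n) < e" if "n \<ge> M" "m \<ge> n" for m n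
      using nD2[of n "m - n"] M[of m n] that by (simp add: dist_norm)
    then show "\<exists>M. \<forall>m\<ge>M. \<forall>n\<ge>M. dist (C m) (C n) < e"
      by (metis dist_commute nle_le)
  qed
  then obtain L where L: "C \<longlonglongrightarrow> L" using Cauchy_convergent convergent_def by blast
  have LL: "(\<lambda>n. C n o\<^sub>L C n) \<longlonglongrightarrow> (L o\<^sub>L L)"
    by (intro bounded_bilinear.tendsto[OF bounded_bilinear_blinfun_compose] L)
  have "(\<lambda>n. C (Suc n)) \<longlonglongrightarrow> (1/2) *\<^sub>R (Z + (L o\<^sub>L L))"
    unfolding CS by (intro tendsto_intros LL)
  moreover have "(\<lambda>n. C (Suc n)) \<longlonglongrightarrow> L" using L by (rule LIMSEQ_Suc)
  ultimately have "L = (1/2) *\<^sub>R (Z + (L o\<^sub>L L))" using LIMSEQ_unique by blast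
  then have eq: "2 *\<^sub>R L = Z + (L o\<^sub>L L)" by (metis field_sum_of_halves scaleR_half_double scaleR_2 scaleR_right_distrib)
  have "(id_blinfun - L) o\<^sub>L (id_blinfun - L) = id_blinfun - Z"
    using eq by (simp add: blinfun_compose_linear scaleR_2 algebra_simps)
  moreover have "radj (id_blinfun - L) = id_blinfun - L"
  proof -
    have "inner (L x) y = inner x (L y)" for x y
    proof (rule LIMSEQ_unique)
      have Lx: "(\<lambda>n. C n v) \<longlonglongrightarrow> L v" for v
        by (intro tendsto_intros L)
      show "(\<lambda>n. inner (C n x) y) \<longlonglongrightarrow> inner (L x) y" by (intro tendsto_intros Lx)
      have "(\<lambda>n. inner x (C n y)) \<longlonglongrightarrow> inner x (L y)" by (intro tendsto_intros Lx)
      then show "(\<lambda>n. inner (C n x) y) \<longlonglongrightarrow> inner x (L y)" by (simp add: inner_radj sa)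
    qed
    then show ?thesis by (simp add: radj_eqI)
  qed
  moreover have "T o\<^sub>L (id_blinfun - L) = (id_blinfun - L) o\<^sub>L T" if "T o\<^sub>L Z = Z o\<^sub>L T" for T
  proof -
    have "T o\<^sub>L L = L o\<^sub>L T"
    proof (rule LIMSEQ_unique)
      show "(\<lambda>n. T o\<^sub>L C n) \<longlonglongrightarrow> (T o\<^sub>L L)"
        by (intro bounded_bilinear.tendsto[OF bounded_bilinear_blinfun_compose] L tendsto_const)
      show "(\<lambda>n. T o\<^sub>L C n) \<longlonglongrightarrow> (L o\<^sub>L T)" unfolding comm[OF that]
        by (intro bounded_bilinear.tendsto[OF bounded_bilinear_blinfun_compose] L tendsto_const)
    qed
    then show ?thesis by (simp add: blinfun_compose_linear)
  qed
  ultimately show ?thesis by blast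
qed

text \<open>Scaling \<open>A\<close> to an operator \<open>B\<close> between 0 and 1 makes
  \<open>id_blinfun - B\<close> a contraction, to which \<open>sqrt_iteration\<close> applies. The
  commutation clause stands in for functional calculus: it places the root in every von Neumann
  algebra that contains \<open>A\<close>.\<close>

lemma sqrt_exists:
  fixes A :: "'a::{real_inner,banach} \<Rightarrow>\<^sub>L 'a"
  assumes sa: "radj A = A" and pos: "\<And>x. 0 \<le> inner (A x) x"
  obtains R where "R o\<^sub>L R = A" "radj R = R" "\<And>T. T o\<^sub>L A = A o\<^sub>L T \<Longrightarrow> T o\<^sub>L R = R o\<^sub>L T"
proof -
  define c where "c = norm A + 1"
  have c: "c > 0" "norm A \<le> c" by (auto simp: c_def add_nonneg_pos)
  define B where "B = (1 / c) *\<^sub>R A"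
  have B: "radj B = B" "\<And>x. 0 \<le> inner (B x) x" "norm B \<le> 1"
    using c by (simp_all add: B_def sa pos blinfun_apply_linear)
  \<comment> \<open>The positive form of \<open>B\<close>, evaluated at \<open>x - B x\<close>,
    gives this bound.\<close>
  have nB: "(norm (B x))\<^sup>2 \<le> inner (B x) x" for x
  proof -
    have "inner (B (B x)) (B x) \<le> norm (B (B x)) * norm (B x)" by (rule norm_cauchy_schwarz)
    also have "\<dots> \<le> norm B * norm (B x) * norm (B x)"
      by (intro mult_right_mono norm_blinfun) simp
    also have "\<dots> \<le> (norm (B x))\<^sup>2"
      using B(3) by (simp add: power2_eq_square mult.assoc mult_left_le_one_le)
    finally have 1: "inner (B (B x)) (B x) \<le> (norm (B x))\<^sup>2" .
    have "0 \<le> inner (B (x - B x)) (x - B x)" by (rule B)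
    also have "\<dots> = inner (B x) x - inner (B x) (B x) - inner (B (B x)) x + inner (B (B x)) (B x)"
      by (simp add: blinfun.diff_right inner_diff_left inner_diff_right)
    also have "inner (B (B x)) x = inner (B x) (B x)" using inner_radj[of B "B x" x] B(1) by simp
    finally show ?thesis using 1 by (simp add: power2_norm_eq_inner)
  qed
  have "norm (id_blinfun - B) \<le> 1"
  proof (rule norm_blinfun_bound)
    fix x
    have "(norm ((id_blinfun - B) x))\<^sup>2 = (norm x)\<^sup>2 - 2 * inner (B x) x + (norm (B x))\<^sup>2"
      by (simp add: blinfun_apply_linear power2_norm_eq_inner inner_diff_left inner_diff_right inner_commute)
    also have "\<dots> \<le> (norm x)\<^sup>2" using nB[of x] B(2)[of x] by simp
    finally show "norm ((id_blinfun - B) x) \<le> 1 * norm x"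
      unfolding mult_1 by (rule power2_le_imp_le) (rule norm_ge_zero)
  qed simp
  then obtain R where R: "R o\<^sub>L R = B" "radj R = R"
      "\<And>T. T o\<^sub>L (id_blinfun - B) = (id_blinfun - B) o\<^sub>L T \<Longrightarrow> T o\<^sub>L R = R o\<^sub>L T"
    using sqrt_iteration[of "id_blinfun - B"] B(1) by (metis diff_diff_eq2 add_diff_cancel_left' radj_diff radj_id)
  show ?thesis
  proof
    show "(sqrt c *\<^sub>R R) o\<^sub>L (sqrt c *\<^sub>R R) = A"
      using c by (simp add: blinfun_compose_linear R(1) B_def)
    show "radj (sqrt c *\<^sub>R R) = sqrt c *\<^sub>R R" by (simp add: R)
    show "T o\<^sub>L (sqrt c *\<^sub>R R) = (sqrt c *\<^sub>R R) o\<^sub>L T" if "T o\<^sub>L A = A o\<^sub>L T" for T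
      using R(3)[of T] that by (simp add: blinfun_compose_linear B_def)
  qed
qed

section \<open>Extension of densely defined operators\<close>

lemma subspace_closure:
  fixes G :: "'a::real_normed_vector set"
  assumes G: "subspace G"
  shows "subspace (closure G)"
proof (unfold subspace_def, intro conjI ballI allI)
  show "0 \<in> closure G" using subspace_0[OF G] closure_subset by blast
  show "x + y \<in> closure G" if xy: "x \<in> closure G" "y \<in> closure G" for x y
  proof -
    obtain s t where s: "\<And>n. s n \<in> G" "s \<longlonglongrightarrow> x" and t: "\<And>n. t n \<in> G" "t \<longlonglongrightarrow> y"
      using xy unfolding closure_sequential by metis
    have "(\<lambda>n. s n + t n) \<longlonglongrightarrow> x + y" by (intro tendsto_intros s t)
    moreover have "\<And>n. s n + t n \<in> G" using s t by (simp add: subspace_add[OF G])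
    ultimately show ?thesis unfolding closure_sequential by (metis (no_types))
  qed
  show "c *\<^sub>R x \<in> closure G" if x: "x \<in> closure G" for c x
  proof -
    obtain s where s: "\<And>n. s n \<in> G" "s \<longlonglongrightarrow> x" using x unfolding closure_sequential by metis
    have "(\<lambda>n. c *\<^sub>R s n) \<longlonglongrightarrow> c *\<^sub>R x" by (intro tendsto_intros s)
    moreover have "\<And>n. c *\<^sub>R s n \<in> G" using s by (simp add: subspace_scale[OF G])
    ultimately show ?thesis unfolding closure_sequential by (metis (no_types))
  qed
qed

text \<open>The closure of \<open>G\<close> is the graph of the operator. Giving a graph instead of
  a map allows a redundant parametrization, such as all pairs (T v, T w) for T in a commutant: the
  bound alone makes it single-valued.\<close>

lemma graph_extension:
  fixes G :: "('a::banach \<times> 'a) set"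
  assumes G: "subspace G" and bound: "\<And>a b. (a, b) \<in> G \<Longrightarrow> norm b \<le> c * norm a"
    and dense: "closure (fst ` G) = UNIV"
  shows "\<exists>T :: 'a \<Rightarrow>\<^sub>L 'a. \<forall>(a, b)\<in>G. T a = b"
proof -
  have sub: "subspace (closure G)" by (rule subspace_closure) (rule G)
  have bound': "norm b \<le> c * norm a" if ab: "(a, b) \<in> closure G" for a b
  proof -
    obtain s where s: "\<And>n. s n \<in> G" "s \<longlonglongrightarrow> (a, b)" using ab by (auto simp: closure_sequential)
    have 1: "(\<lambda>n. norm (snd (s n))) \<longlonglongrightarrow> norm (snd (a, b))" by (intro tendsto_intros s)
    have 2: "(\<lambda>n. c * norm (fst (s n))) \<longlonglongrightarrow> c * norm (fst (a, b))" by (intro tendsto_intros s)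
    have "norm (snd (s n)) \<le> c * norm (fst (s n))" for n
      using bound[of "fst (s n)" "snd (s n)"] s(1)[of n] by simp
    then show ?thesis using LIMSEQ_le[OF 1 2] by auto
  qed
  have ex: "\<exists>b. (a, b) \<in> closure G" for a
  proof -
    have "a \<in> closure (fst ` G)" using dense by simp
    then obtain s where s: "\<And>n. s n \<in> fst ` G" "s \<longlonglongrightarrow> a" by (auto simp: closure_sequential)
    have "\<exists>b. (s n, b) \<in> G" for n using s(1)[of n] by force
    then obtain r where r: "\<And>n. (s n, r n) \<in> G" by metis
    have b: "norm (r m - r n) \<le> \<bar>c\<bar> * norm (s m - s n)" for m n
    proof -
      have "(s m - s n, r m - r n) \<in> G" using subspace_diff[OF G r[of m] r[of n]] by simp
      then have "norm (r m - r n) \<le> c * norm (s m - s n)" by (rule bound)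
      also have "\<dots> \<le> \<bar>c\<bar> * norm (s m - s n)" by (intro mult_right_mono) auto
      finally show ?thesis .
    qed
    have "Cauchy r"
    proof (rule metric_CauchyI)
      fix e :: real assume e: "0 < e"
      have "Cauchy s" using s(2) by (rule LIMSEQ_imp_Cauchy)
      then obtain M where M: "\<And>m n. m \<ge> M \<Longrightarrow> n \<ge> M \<Longrightarrow> dist (s m) (s n) < e / (\<bar>c\<bar> + 1)"
        using metric_CauchyD[of s "e / (\<bar>c\<bar> + 1)"] e by (auto simp: add_nonneg_pos)
      have "dist (r m) (r n) < e" if "m \<ge> M" "n \<ge> M" for m n
      proof -
        have "norm (r m - r n) \<le> (\<bar>c\<bar> + 1) * norm (s m - s n)"
          using b[of m n] norm_ge_zero[of "s m - s n"] unfolding distrib_right mult_1 by linarith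
        also have "\<dots> < e"
          using M[OF that] by (simp add: dist_norm pos_less_divide_eq add_nonneg_pos mult.commute)
        finally show ?thesis by (simp add: dist_norm)
      qed
      then show "\<exists>M. \<forall>m\<ge>M. \<forall>n\<ge>M. dist (r m) (r n) < e" by blast
    qed
    then obtain l where "r \<longlonglongrightarrow> l" using Cauchy_convergent convergent_def by blast
    then have "(\<lambda>n. (s n, r n)) \<longlonglongrightarrow> (a, l)" by (intro tendsto_Pair s)
    then have "(a, l) \<in> closure G" unfolding closure_sequential
      using r by (intro exI[of _ "\<lambda>n. (s n, r n)"]) auto
    then show ?thesis by blast
  qed
  then obtain T where T: "\<And>a. (a, T a) \<in> closure G" by metis
  have uniq: "b = T a" if "(a, b) \<in> closure G" for a b
  proof -
    have "(0, b - T a) \<in> closure G" using subspace_diff[OF sub that T[of a]] by simp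
    then show ?thesis using bound' by fastforce
  qed
  have "bounded_linear T"
  proof (rule bounded_linear_intro)
    show "T (x + y) = T x + T y" for x y
      using subspace_add[OF sub T[of x] T[of y]] uniq by simp
    show "T (r *\<^sub>R x) = r *\<^sub>R T x" for r x
      using subspace_scale[OF sub T[of x], of r] uniq by simp
    show "norm (T x) \<le> norm x * c" for x using bound'[OF T[of x]] by (simp add: mult.commute)
  qed
  then have "\<forall>(a, b)\<in>G. Blinfun T a = b"
    using uniq closure_subset[of G] by (auto simp: bounded_linear_Blinfun_apply)
  then show ?thesis by blast
qed

section \<open>Commutants and von Neumann algebras\<close>

lemma cinner_scaleC_right: "cinner x (c *\<^sub>C y) = cnj c * cinner x y"
  by (metis cinner_commute cinner_scaleC_left complex_cnj_cnj complex_cnj_mult)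

lemma scaleC_decompose: "c *\<^sub>C x = Re c *\<^sub>R x + Im c *\<^sub>R (\<i> *\<^sub>C x)"
proof -
  have "c *\<^sub>C x = (complex_of_real (Re c) + complex_of_real (Im c) * \<i>) *\<^sub>C x"
    by (metis complex_eq mult.commute)
  then show ?thesis by (simp only: scaleC_add_left scaleC_scaleC[symmetric] scaleC_of_real)
qed

lemma scaleC_minus_one: "(- 1) *\<^sub>C x = - (x::'h::complex_hilbert_space)"
  using scaleC_of_real[of "- 1" x] by simp

lemma ii_ii_scaleC [simp]: "\<i> *\<^sub>C \<i> *\<^sub>C x = - (x::'h::complex_hilbert_space)"
  by (simp add: scaleC_scaleC scaleC_minus_one)

lemma inner_scaleC_left: "inner (c *\<^sub>C x) y = inner x (cnj c *\<^sub>C (y::'h::complex_hilbert_space))"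
  by (simp add: inner_eq_Re_cinner cinner_scaleC_left cinner_scaleC_right)

lemma minus_ii_scaleC: "(- \<i>) *\<^sub>C x = - (\<i> *\<^sub>C (x::'h::complex_hilbert_space))"
proof -
  have "(- \<i>) *\<^sub>C x = ((- 1) * \<i>) *\<^sub>C x" by simp
  then show ?thesis by (simp only: scaleC_scaleC[symmetric] scaleC_minus_one)
qed

lemma Im_cinner: "Im (cinner x y) = inner x (\<i> *\<^sub>C y)"
  by (simp add: inner_eq_Re_cinner cinner_scaleC_right)

lemma cinner_eq_inner: "cinner x y = Complex (inner x y) (inner x (\<i> *\<^sub>C y))"
  by (rule complex_eqI) (simp_all add: inner_eq_Re_cinner[symmetric] Im_cinner)

lemma cinner_self: "cinner x x = complex_of_real ((norm x)\<^sup>2)"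
proof -
  have "Im (cinner x x) = Im (cnj (cinner x x))" by (rule arg_cong[OF cinner_commute])
  then have "Im (cinner x x) = 0" by simp
  then show ?thesis by (simp add: complex_eq_iff inner_eq_Re_cinner[symmetric] power2_norm_eq_inner)
qed

abbreviation iop :: "'h::complex_hilbert_space \<Rightarrow>\<^sub>L 'h" where "iop \<equiv> scalar_op \<i>"

text \<open>Complex linearity becomes commutation with one operator, so it is proved by the same
  arguments as membership in a commutant.\<close>

lemma BH_iff: "T \<in> BH \<longleftrightarrow> T o\<^sub>L iop = iop o\<^sub>L T"
proof
  assume "T o\<^sub>L iop = iop o\<^sub>L T"
  then have "T (\<i> *\<^sub>C x) = \<i> *\<^sub>C T x" for x
    by (metis blinfun_apply_blinfun_compose scalar_op_apply)
  then have "T (c *\<^sub>C x) = c *\<^sub>C T x" for c x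
    by (simp only: scaleC_decompose[of c] blinfun.add_right blinfun.scaleR_right)
  then show "T \<in> BH" by (simp add: BH_def)
next
  assume "T \<in> BH"
  then show "T o\<^sub>L iop = iop o\<^sub>L T" by (intro blinfun_eqI) (simp add: BH_def)
qed

lemma BH_scaleC: "T \<in> BH \<Longrightarrow> T (c *\<^sub>C x) = c *\<^sub>C T x"
  by (simp add: BH_def)

lemma scalar_op_decompose: "scalar_op c = Re c *\<^sub>R id_blinfun + Im c *\<^sub>R (iop :: 'h::complex_hilbert_space \<Rightarrow>\<^sub>L 'h)"
  by (rule blinfun_eqI) (simp add: blinfun_apply_linear scaleC_decompose[of c])

lemma radj_iop [simp]: "radj iop = - (iop :: 'h::complex_hilbert_space \<Rightarrow>\<^sub>L 'h)"
  by (rule radj_eqI) (simp add: inner_scaleC_left minus_ii_scaleC blinfun.minus_left)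

lemma BH_radj [simp]: "radj T \<in> BH" if "T \<in> BH"
proof -
  have "radj (T o\<^sub>L iop) = radj (iop o\<^sub>L T)" using that by (simp only: BH_iff)
  then show ?thesis by (simp add: BH_iff blinfun_compose_linear)
qed

lemma adj_eq_radj: "adj T = radj T" if "T \<in> BH" for T :: "'h::complex_hilbert_space \<Rightarrow>\<^sub>L 'h"
  unfolding adj_def
proof (rule the_equality)
  show "\<forall>x y. cinner (T x) y = cinner x (radj T y)"
    using BH_radj[OF that] by (simp add: cinner_eq_inner inner_radj BH_scaleC)
  show "S = radj T" if "\<forall>x y. cinner (T x) y = cinner x (S y)" for S :: "'h \<Rightarrow>\<^sub>L 'h"
    by (rule radj_eqI[symmetric]) (use that in \<open>simp add: inner_eq_Re_cinner\<close>)
qed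

lemma cinner_radj: "T \<in> BH \<Longrightarrow> cinner (T x) y = cinner x (radj T y)"
  using BH_radj[of T] by (simp add: cinner_eq_inner inner_radj BH_scaleC)

text \<open>The imaginary part of the complex form vanishes at \<open>x + y\<close>; polarizing this
  and replacing \<open>y\<close> by -i y turns it into self-adjointness for the real inner
  product.\<close>

lemma positive_op_iff:
  "positive_op T \<longleftrightarrow> T \<in> BH \<and> radj T = T \<and> (\<forall>x. 0 \<le> inner (T x) x)"
proof
  assume "positive_op T"
  then have T: "T \<in> BH" "\<And>x. cinner (T x) x \<in> \<real>\<^sub>\<ge>\<^sub>0" by (auto simp: positive_op_def)
  have im: "inner (T x) (\<i> *\<^sub>C x) = 0" and re: "0 \<le> inner (T x) x" for x
    using T(2)[of x] by (simp_all add: complex_nonneg_Reals_iff cinner_eq_inner)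
  have sym: "inner (T x) (\<i> *\<^sub>C y) + inner (T y) (\<i> *\<^sub>C x) = 0" for x y
    using im[of "x + y"] im[of x] im[of y]
    by (simp add: scaleC_add_right blinfun.add_right inner_add_left inner_add_right)
  have "inner (T x) y = inner x (T y)" for x y
  proof -
    have "inner (T x) y + inner (T (- (\<i> *\<^sub>C y))) (\<i> *\<^sub>C x) = 0"
      using sym[of x "- (\<i> *\<^sub>C y)"] by (simp flip: minus_ii_scaleC add: scaleC_scaleC scaleC_one)
    moreover have "inner (T (- (\<i> *\<^sub>C y))) (\<i> *\<^sub>C x) = - inner (T y) x"
      using T(1) by (simp add: blinfun.minus_right BH_scaleC inner_scaleC_left minus_ii_scaleC)
    ultimately show ?thesis by (simp add: inner_commute)
  qed
  then show "T \<in> BH \<and> radj T = T \<and> (\<forall>x. 0 \<le> inner (T x) x)"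
    using T(1) re by (simp add: radj_eqI)
next
  assume T: "T \<in> BH \<and> radj T = T \<and> (\<forall>x. 0 \<le> inner (T x) x)"
  have "inner (T x) (\<i> *\<^sub>C x) = 0" for x
  proof -
    have "inner (T x) (\<i> *\<^sub>C x) = inner x (T (\<i> *\<^sub>C x))" using T inner_radj by metis
    also have "\<dots> = inner x (\<i> *\<^sub>C T x)" using T by (simp add: BH_scaleC)
    also have "\<dots> = - inner (\<i> *\<^sub>C x) (T x)" by (simp add: inner_scaleC_left minus_ii_scaleC)
    also have "\<dots> = - inner (T x) (\<i> *\<^sub>C x)" by (simp only: inner_commute)
    finally show ?thesis by simp
  qed
  then show "positive_op T"
    using T by (simp add: positive_op_def complex_nonneg_Reals_iff cinner_eq_inner)
qed

section \<open>Commutants\<close>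

lemma commutant_iff: "T \<in> commutant S \<longleftrightarrow> T \<in> BH \<and> (\<forall>A\<in>S. T o\<^sub>L A = A o\<^sub>L T)"
  by (simp add: commutant_def)

lemma commutant_BH: "commutant S \<subseteq> BH"
  by (auto simp: commutant_def)

lemma commutant_antimono: "S \<subseteq> T \<Longrightarrow> commutant T \<subseteq> commutant S"
  by (auto simp: commutant_def)

lemma commute_compose:
  assumes "A o\<^sub>L C = C o\<^sub>L A" "B o\<^sub>L C = C o\<^sub>L B"
  shows "(A o\<^sub>L B) o\<^sub>L C = C o\<^sub>L (A o\<^sub>L B)"
proof -
  have "(A o\<^sub>L B) o\<^sub>L C = A o\<^sub>L (C o\<^sub>L B)" by (simp only: blinfun_compose_assoc assms)
  also have "\<dots> = (C o\<^sub>L A) o\<^sub>L B" by (simp only: blinfun_compose_assoc[symmetric] assms)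
  finally show ?thesis by (simp only: blinfun_compose_assoc)
qed

lemma BH_id [simp]: "id_blinfun \<in> BH"
  and BH_zero [simp]: "0 \<in> BH"
  and BH_add: "A \<in> BH \<Longrightarrow> B \<in> BH \<Longrightarrow> A + B \<in> BH"
  and BH_diff: "A \<in> BH \<Longrightarrow> B \<in> BH \<Longrightarrow> A - B \<in> BH"
  and BH_scaleR: "A \<in> BH \<Longrightarrow> r *\<^sub>R A \<in> BH"
  and BH_iop [simp]: "iop \<in> BH"
  by (simp_all add: BH_iff blinfun_compose_linear)

lemma BH_compose: "A \<in> BH \<Longrightarrow> B \<in> BH \<Longrightarrow> A o\<^sub>L B \<in> BH"
  unfolding BH_iff by (rule commute_compose)

lemma commutant_id: "id_blinfun \<in> commutant S"
  and commutant_zero: "0 \<in> commutant S"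
  and commutant_add: "A \<in> commutant S \<Longrightarrow> B \<in> commutant S \<Longrightarrow> A + B \<in> commutant S"
  and commutant_diff: "A \<in> commutant S \<Longrightarrow> B \<in> commutant S \<Longrightarrow> A - B \<in> commutant S"
  and commutant_scaleR: "A \<in> commutant S \<Longrightarrow> r *\<^sub>R A \<in> commutant S"
  by (simp_all add: commutant_iff BH_add BH_diff BH_scaleR blinfun_compose_linear)

lemma commutant_compose: "A \<in> commutant S \<Longrightarrow> B \<in> commutant S \<Longrightarrow> A o\<^sub>L B \<in> commutant S"
  by (simp add: commutant_iff BH_compose) (simp add: commute_compose)

lemma subspace_commutant: "subspace (commutant S)"
  by (simp add: subspace_def commutant_zero commutant_add commutant_scaleR)

lemma commutant_iop: "S \<subseteq> BH \<Longrightarrow> iop \<in> commutant S"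
  by (auto simp: commutant_iff BH_iff)

lemma commutant_radj:
  assumes "T \<in> commutant S" "\<And>A. A \<in> S \<Longrightarrow> radj A \<in> S"
  shows "radj T \<in> commutant S"
proof -
  have "radj T o\<^sub>L A = A o\<^sub>L radj T" if "A \<in> S" for A
  proof -
    have "radj (T o\<^sub>L radj A) = radj (radj A o\<^sub>L T)"
      using assms that by (simp add: commutant_iff)
    then show ?thesis by simp
  qed
  then show ?thesis using assms(1) by (simp add: commutant_iff)
qed

lemma subset_double_commutant: "S \<subseteq> BH \<Longrightarrow> S \<subseteq> commutant (commutant S)"
  by (auto simp: commutant_iff subset_iff)

lemma triple_commutant: "S \<subseteq> BH \<Longrightarrow> commutant (commutant (commutant S)) = commutant S"
  by (meson commutant_BH commutant_antimono subset_antisym subset_double_commutant)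

lemma commutant_strong_limit:
  assumes X: "\<And>n. X n \<in> commutant S" and lim: "\<And>\<xi>. (\<lambda>n. blinfun_apply (X n) \<xi>) \<longlonglongrightarrow> blinfun_apply Y \<xi>"
  shows "Y \<in> commutant S"
proof -
  have comm: "Y o\<^sub>L A = A o\<^sub>L Y" if A: "\<And>n. X n o\<^sub>L A = A o\<^sub>L X n" for A
  proof (rule blinfun_eqI)
    fix \<xi>
    have "(\<lambda>n. X n (A \<xi>)) \<longlonglongrightarrow> A (Y \<xi>)"
    proof -
      have "X n (A \<xi>) = A (X n \<xi>)" for n
        using A[of n] by (metis blinfun_apply_blinfun_compose)
      then show ?thesis by (simp add: blinfun.tendsto[OF tendsto_const lim])
    qed
    then show "(Y o\<^sub>L A) \<xi> = (A o\<^sub>L Y) \<xi>" using LIMSEQ_unique lim[of "A \<xi>"] by auto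
  qed
  have "Y \<in> BH" unfolding BH_iff by (rule comm) (use X in \<open>simp add: commutant_iff BH_iff\<close>)
  moreover have "Y o\<^sub>L A = A o\<^sub>L Y" if "A \<in> S" for A
    by (rule comm) (use X that in \<open>simp add: commutant_iff\<close>)
  ultimately show ?thesis by (simp add: commutant_iff)
qed

section \<open>Von Neumann algebras and their unitaries\<close>

locale vna =
  fixes A :: "('h::complex_hilbert_space \<Rightarrow>\<^sub>L 'h) set"
  assumes vna: "von_neumann_algebra A"
begin

lemma bicommutant: "commutant (commutant A) = A"
  using vna by (simp add: von_neumann_algebra_def)

lemma subset_BH: "A \<subseteq> BH"
  using bicommutant commutant_BH by blast

lemma in_BH: "x \<in> A \<Longrightarrow> x \<in> BH"
  using subset_BH by blast

lemma radj_closed: "x \<in> A \<Longrightarrow> radj x \<in> A"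
  using vna adj_eq_radj[OF in_BH] by (auto simp: von_neumann_algebra_def)

lemma adj_radj: "x \<in> A \<Longrightarrow> adj x = radj x"
  by (rule adj_eq_radj) (rule in_BH)

lemma id_closed: "id_blinfun \<in> A"
  and zero_closed: "0 \<in> A"
  and compose_closed: "x \<in> A \<Longrightarrow> y \<in> A \<Longrightarrow> x o\<^sub>L y \<in> A"
  and add_closed: "x \<in> A \<Longrightarrow> y \<in> A \<Longrightarrow> x + y \<in> A"
  and diff_closed: "x \<in> A \<Longrightarrow> y \<in> A \<Longrightarrow> x - y \<in> A"
  and scaleR_closed: "x \<in> A \<Longrightarrow> r *\<^sub>R x \<in> A"
  using commutant_id[of "commutant A"] commutant_zero[of "commutant A"]
    commutant_compose[of x "commutant A" y] commutant_add[of x "commutant A" y]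
    commutant_diff[of x "commutant A" y] commutant_scaleR[of x "commutant A" r]
  unfolding bicommutant by simp_all

lemma subspace: "subspace A"
  using subspace_commutant[of "commutant A"] by (simp only: bicommutant)

lemma iop_closed: "iop \<in> A"
  using commutant_iop[OF commutant_BH, of A] by (simp add: bicommutant)

lemma scalar_op_closed: "scalar_op c \<in> A"
  by (subst scalar_op_decompose) (simp add: add_closed scaleR_closed id_closed iop_closed)

lemma op_scale_closed: "x \<in> A \<Longrightarrow> op_scale c x \<in> A"
  by (simp add: op_scale_def compose_closed scalar_op_closed)

lemma commutant_commutes: "T \<in> commutant A \<Longrightarrow> x \<in> A \<Longrightarrow> T o\<^sub>L x = x o\<^sub>L T"
  by (simp add: commutant_iff)

lemma commutant_commutes_apply: "T \<in> commutant A \<Longrightarrow> x \<in> A \<Longrightarrow> T (x \<xi>) = x (T \<xi>)"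
  by (metis commutant_commutes blinfun_apply_blinfun_compose)

lemma in_algebraI:
  assumes "x \<in> BH" "\<And>T. T \<in> commutant A \<Longrightarrow> x o\<^sub>L T = T o\<^sub>L x"
  shows "x \<in> A"
proof -
  have "x \<in> commutant (commutant A)" using assms by (simp add: commutant_iff)
  then show ?thesis by (simp add: bicommutant)
qed

lemma strong_limit_closed:
  assumes "\<And>n. X n \<in> A" "\<And>\<xi>. (\<lambda>n. blinfun_apply (X n) \<xi>) \<longlonglongrightarrow> blinfun_apply Y \<xi>"
  shows "Y \<in> A"
  using commutant_strong_limit[of X "commutant A" Y] assms by (simp add: bicommutant)

lemma commutant_radj_closed: "T \<in> commutant A \<Longrightarrow> radj T \<in> commutant A"
  by (rule commutant_radj) (auto intro: radj_closed)

lemma commutant_vna: "von_neumann_algebra (commutant A)"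
proof -
  have "\<forall>T\<in>commutant A. adj T \<in> commutant A"
  proof
    fix T assume T: "T \<in> commutant A"
    then have "adj T = radj T" using commutant_BH by (intro adj_eq_radj) blast
    then show "adj T \<in> commutant A" using commutant_radj_closed[OF T] by simp
  qed
  then show ?thesis by (simp add: von_neumann_algebra_def triple_commutant subset_BH)
qed

lemma sqrt_closed:
  assumes "x \<in> A" "radj x = x" "\<And>\<xi>. 0 \<le> inner (blinfun_apply x \<xi>) \<xi>"
  obtains r where "r \<in> A" "r o\<^sub>L r = x" "radj r = r" "\<And>T. T o\<^sub>L x = x o\<^sub>L T \<Longrightarrow> T o\<^sub>L r = r o\<^sub>L T"
proof -
  obtain r where r: "r o\<^sub>L r = x" "radj r = r" "\<And>T. T o\<^sub>L x = x o\<^sub>L T \<Longrightarrow> T o\<^sub>L r = r o\<^sub>L T"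
    using sqrt_exists[OF assms(2,3)] by blast
  have "r \<in> BH" unfolding BH_iff
    by (rule r(3)[symmetric]) (use in_BH[OF assms(1)] in \<open>simp add: BH_iff\<close>)
  then have "r \<in> A"
    by (rule in_algebraI) (rule r(3)[OF commutant_commutes[OF _ assms(1)], symmetric])
  with r that show ?thesis by blast
qed

lemma unitaries_iff:
  "u \<in> unitaries A \<longleftrightarrow> u \<in> A \<and> radj u o\<^sub>L u = id_blinfun \<and> u o\<^sub>L radj u = id_blinfun"
  by (auto simp: unitaries_def adj_radj)

lemma unitaries_compose:
  assumes "u \<in> unitaries A" "v \<in> unitaries A"
  shows "u o\<^sub>L v \<in> unitaries A"
proof -
  have "radj (u o\<^sub>L v) o\<^sub>L (u o\<^sub>L v) = radj v o\<^sub>L (radj u o\<^sub>L u) o\<^sub>L v"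
    "(u o\<^sub>L v) o\<^sub>L radj (u o\<^sub>L v) = u o\<^sub>L (v o\<^sub>L radj v) o\<^sub>L radj u"
    by (simp_all only: radj_compose blinfun_compose_assoc)
  then show ?thesis using assms
    by (simp add: unitaries_iff compose_closed del: radj_compose)
qed

lemma unitaries_id: "id_blinfun \<in> unitaries A"
  by (simp add: unitaries_iff id_closed)

text \<open>A self-adjoint contraction \<open>x\<close> is the real part of the unitary \<open>x + \<i> (1 - x\<^sup>2)\<^sup>1\<^sup>/\<^sup>2\<close>.\<close>

lemma commutes_if_commutes_unitaries:
  assumes T: "T \<in> BH" and U: "\<And>u. u \<in> unitaries A \<Longrightarrow> T o\<^sub>L u = u o\<^sub>L T"
    and x: "x \<in> A"
  shows "T o\<^sub>L x = x o\<^sub>L T"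
proof -
  have contr: "T o\<^sub>L y = y o\<^sub>L T" if y: "y \<in> A" "radj y = y" "norm y \<le> 1" for y
  proof -
    have "0 \<le> inner ((id_blinfun - (y o\<^sub>L y)) \<xi>) \<xi>" for \<xi>
    proof -
      have "norm (y \<xi>) \<le> norm y * norm \<xi>" by (rule norm_blinfun)
      also have "\<dots> \<le> norm \<xi>" using y(3) by (simp add: mult_left_le_one_le)
      finally have "(norm (y \<xi>))\<^sup>2 \<le> (norm \<xi>)\<^sup>2" by simp
      moreover have "inner (y (y \<xi>)) \<xi> = inner (y \<xi>) (y \<xi>)" using inner_radj[of y "y \<xi>" \<xi>] y(2) by simp
      ultimately show ?thesis
        by (simp add: blinfun_apply_linear inner_diff_left power2_norm_eq_inner)
    qed
    moreover have "id_blinfun - (y o\<^sub>L y) \<in> A" using y(1) by (intro diff_closed id_closed compose_closed)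
    moreover have "radj (id_blinfun - (y o\<^sub>L y)) = id_blinfun - (y o\<^sub>L y)" by (simp add: y(2))
    ultimately obtain r where r: "r \<in> A" "r o\<^sub>L r = id_blinfun - (y o\<^sub>L y)" "radj r = r"
       "\<And>S. S o\<^sub>L (id_blinfun - (y o\<^sub>L y)) = (id_blinfun - (y o\<^sub>L y)) o\<^sub>L S \<Longrightarrow> S o\<^sub>L r = r o\<^sub>L S"
      using sqrt_closed by blast
    have yr: "y o\<^sub>L r = r o\<^sub>L y"
      by (rule r(4)) (simp add: blinfun_compose_linear blinfun_compose_assoc)
    define v where "v = y + (iop o\<^sub>L r)"
    have ii: "iop o\<^sub>L iop = - (id_blinfun :: 'h \<Rightarrow>\<^sub>L 'h)"
      by (rule blinfun_eqI) (simp add: blinfun.minus_left)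
    have ci: "y o\<^sub>L iop = iop o\<^sub>L y" "r o\<^sub>L iop = iop o\<^sub>L r"
      using in_BH y(1) r(1) by (simp_all add: BH_iff)
    have rv: "radj v = y - (iop o\<^sub>L r)" by (simp add: v_def y(2) r(3) ci blinfun_compose_linear)
    have iriR: "(iop o\<^sub>L r) o\<^sub>L (iop o\<^sub>L r) = (y o\<^sub>L y) - id_blinfun"
    proof -
      have "(iop o\<^sub>L r) o\<^sub>L (iop o\<^sub>L r) = (iop o\<^sub>L iop) o\<^sub>L (r o\<^sub>L r)"
        by (metis blinfun_compose_assoc ci(2))
      then show ?thesis by (simp add: ii r(2) blinfun_compose_linear)
    qed
    have yir: "y o\<^sub>L (iop o\<^sub>L r) = (iop o\<^sub>L r) o\<^sub>L y"
      by (metis blinfun_compose_assoc ci(1) yr)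
    have "radj v o\<^sub>L v = id_blinfun" "v o\<^sub>L radj v = id_blinfun"
      unfolding rv by (simp_all add: v_def blinfun_compose_linear iriR yir)
    then have "v \<in> unitaries A"
      by (simp add: unitaries_iff v_def add_closed compose_closed iop_closed r(1) y(1))
    then have Tv: "T o\<^sub>L v = v o\<^sub>L T" "T o\<^sub>L radj v = radj v o\<^sub>L T"
      using U radj_closed by (auto simp: unitaries_iff)
    have "y = (1/2) *\<^sub>R (v + radj v)" unfolding rv by (simp add: v_def scaleR_2[symmetric])
    then show ?thesis using Tv by (simp add: blinfun_compose_linear)
  qed
  have selfadj: "T o\<^sub>L y = y o\<^sub>L T" if y: "y \<in> A" "radj y = y" for y
  proof (cases "y = 0")
    case False
    have "T o\<^sub>L ((1 / norm y) *\<^sub>R y) = ((1 / norm y) *\<^sub>R y) o\<^sub>L T"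
      by (rule contr) (use False y in \<open>simp_all add: scaleR_closed\<close>)
    then show ?thesis using False by (simp add: blinfun_compose_linear)
  qed simp
  have ci: "x o\<^sub>L iop = iop o\<^sub>L x" "radj x o\<^sub>L iop = iop o\<^sub>L radj x"
    using in_BH[OF x] by (simp_all add: BH_iff[symmetric])
  \<comment> \<open>The Cartesian decomposition: both operators are self-adjoint and
    \<open>x\<close> is half of p - i q.\<close>
  define p q where "p = x + radj x" and "q = iop o\<^sub>L (x - radj x)"
  have x_eq: "x = (1/2) *\<^sub>R p - (1/2) *\<^sub>R (iop o\<^sub>L q)"
    by (rule blinfun_eqI)
      (simp add: p_def q_def blinfun_apply_linear scaleR_2[symmetric] scaleR_diff_right scaleR_add_right)
  have Tp: "p o\<^sub>L T = T o\<^sub>L p" unfolding p_def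
    by (rule selfadj[symmetric]) (simp_all add: x add_closed radj_closed add.commute)
  have Tq: "q o\<^sub>L T = T o\<^sub>L q" unfolding q_def
    by (rule selfadj[symmetric])
      (simp_all add: x diff_closed radj_closed compose_closed iop_closed blinfun_compose_linear ci)
  have "iop o\<^sub>L T = T o\<^sub>L iop" using T by (simp add: BH_iff)
  then have Tiq: "(iop o\<^sub>L q) o\<^sub>L T = T o\<^sub>L (iop o\<^sub>L q)" using Tq by (rule commute_compose)
  have "T o\<^sub>L ((1/2) *\<^sub>R p - (1/2) *\<^sub>R (iop o\<^sub>L q)) = ((1/2) *\<^sub>R p - (1/2) *\<^sub>R (iop o\<^sub>L q)) o\<^sub>L T"
    by (simp only: blinfun_compose_linear Tp Tiq)
  then show ?thesis by (simp only: x_eq[symmetric])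
qed

end

section \<open>Orthogonal projections onto closed real subspaces\<close>

text \<open>The real counterpart of \<open>orth_proj\<close>. It is also applied to subspaces whose
  invariance under multiplication by i has not been established; where that holds, the two agree by
  \<open>orth_proj_eq_proj\<close>.\<close>

definition proj :: "'a::{real_inner,banach} set \<Rightarrow> ('a \<Rightarrow>\<^sub>L 'a)" where
  "proj K = (SOME P. \<forall>x. blinfun_apply P x \<in> K \<and> (\<forall>y\<in>K. inner (x - blinfun_apply P x) y = 0))"

context
  fixes K :: "'a::{real_inner,banach} set"
  assumes K: "subspace K" "closed K"
begin

lemma proj_prop: "proj K x \<in> K \<and> (\<forall>y\<in>K. inner (x - proj K x) y = 0)"
proof -
  have "\<forall>x. \<exists>p. p \<in> K \<and> (\<forall>y\<in>K. inner (x - p) y = 0)"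
    using projection_point_exists[OF K] by blast
  then obtain p where p: "\<And>x. p x \<in> K" "\<And>x y. y \<in> K \<Longrightarrow> inner (x - p x) y = 0"
    by metis
  have uniq: "q = p x" if "q \<in> K" "\<And>y. y \<in> K \<Longrightarrow> inner (x - q) y = 0" for x q
  proof -
    have d: "p x - q \<in> K" using p(1) that(1) K(1) by (simp add: subspace_diff)
    have "inner (p x - q) (p x - q) = inner (x - q) (p x - q) - inner (x - p x) (p x - q)"
      by (simp add: inner_diff_left)
    also have "\<dots> = 0" using p(2)[OF d] that(2)[OF d] by simp
    finally show ?thesis by simp
  qed
  have "bounded_linear p"
  proof (rule bounded_linear_intro)
    show "p (x + y) = p x + p y" for x y
    proof (rule uniq[symmetric])
      show "p x + p y \<in> K" using p(1) K(1) by (simp add: subspace_add)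
      show "inner (x + y - (p x + p y)) z = 0" if "z \<in> K" for z
        using p(2)[OF that, of x] p(2)[OF that, of y] by (simp add: inner_diff_left inner_add_left)
    qed
    show "p (r *\<^sub>R x) = r *\<^sub>R p x" for r x
    proof (rule uniq[symmetric])
      show "r *\<^sub>R p x \<in> K" using p(1) K(1) by (simp add: subspace_scale)
      show "inner (r *\<^sub>R x - r *\<^sub>R p x) z = 0" if "z \<in> K" for z
        using p(2)[OF that, of x] by (simp flip: scaleR_diff_right)
    qed
    show "norm (p x) \<le> norm x * 1" for x
    proof -
      have "(norm x)\<^sup>2 = (norm (x - p x))\<^sup>2 + (norm (p x))\<^sup>2"
        using p(2)[OF p(1), of x x]
        by (simp add: power2_norm_eq_inner inner_diff_left inner_diff_right inner_commute)
      then have "(norm (p x))\<^sup>2 \<le> (norm x)\<^sup>2" by simp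
      then show ?thesis by simp
    qed
  qed
  then have "\<forall>x. Blinfun p x \<in> K \<and> (\<forall>y\<in>K. inner (x - Blinfun p x) y = 0)"
    using p by (simp add: bounded_linear_Blinfun_apply)
  then have "\<exists>P :: 'a \<Rightarrow>\<^sub>L 'a. \<forall>x. P x \<in> K \<and> (\<forall>y\<in>K. inner (x - P x) y = 0)" by blast
  then have "\<forall>x. proj K x \<in> K \<and> (\<forall>y\<in>K. inner (x - proj K x) y = 0)"
    unfolding proj_def by (rule someI_ex)
  then show ?thesis by blast
qed

lemma proj_in: "proj K x \<in> K"
  using proj_prop by blast

lemma proj_orth: "y \<in> K \<Longrightarrow> inner (x - proj K x) y = 0"
  using proj_prop by blast

lemma proj_eqI:
  assumes "q \<in> K" "\<And>y. y \<in> K \<Longrightarrow> inner (x - q) y = 0"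
  shows "proj K x = q"
proof -
  have d: "proj K x - q \<in> K" using proj_in assms(1) K(1) by (simp add: subspace_diff)
  have "inner (proj K x - q) (proj K x - q) = inner (x - q) (proj K x - q) - inner (x - proj K x) (proj K x - q)"
    by (simp add: inner_diff_left)
  also have "\<dots> = 0" using proj_orth[OF d] assms(2)[OF d] by simp
  finally show ?thesis by simp
qed

lemma proj_fix: "x \<in> K \<Longrightarrow> proj K x = x"
  by (rule proj_eqI) auto

lemma proj_fix_iff: "proj K x = x \<longleftrightarrow> x \<in> K"
  using proj_fix proj_in by metis

lemma proj_idem [simp]: "proj K o\<^sub>L proj K = proj K"
  by (rule blinfun_eqI) (simp add: proj_fix proj_in)

lemma radj_proj [simp]: "radj (proj K) = proj K"
proof (rule radj_eqI)
  fix x y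
  have "inner (proj K x) (y - proj K y) = 0" using proj_orth[OF proj_in] by (simp add: inner_commute)
  moreover have "inner (x - proj K x) (proj K y) = 0" by (rule proj_orth) (rule proj_in)
  ultimately show "inner (proj K x) y = inner x (proj K y)"
    by (simp add: inner_diff_left inner_diff_right)
qed

text \<open>Invariance of \<open>K\<close> under \<open>radj T\<close> means that \<open>T\<close>
  preserves the orthogonal complement of \<open>K\<close> as well.\<close>

lemma proj_commute:
  assumes "\<And>x. x \<in> K \<Longrightarrow> blinfun_apply T x \<in> K" "\<And>x. x \<in> K \<Longrightarrow> blinfun_apply (radj T) x \<in> K"
  shows "proj K o\<^sub>L T = T o\<^sub>L proj K"
proof (rule blinfun_eqI)
  fix x
  show "(proj K o\<^sub>L T) x = (T o\<^sub>L proj K) x"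
    unfolding blinfun_apply_blinfun_compose
  proof (rule proj_eqI)
    show "T (proj K x) \<in> K" by (simp add: assms proj_in)
    show "inner (T x - T (proj K x)) y = 0" if "y \<in> K" for y
      using proj_orth[OF assms(2)[OF that], of x] by (simp add: inner_radj flip: blinfun.diff_right)
  qed
qed

end

lemma orth_proj_eq_proj:
  fixes K :: "'h::complex_hilbert_space set"
  assumes K: "subspace K" "closed K" and i: "\<And>x. x \<in> K \<Longrightarrow> \<i> *\<^sub>C x \<in> K"
  shows "orth_proj K = proj K"
  unfolding orth_proj_def
proof (rule the_equality)
  show "\<forall>x. proj K x \<in> K \<and> (\<forall>y\<in>K. cinner (x - proj K x) y = 0)"
    using proj_in[OF K] proj_orth[OF K] i by (simp add: cinner_eq_inner zero_complex.code)
  fix P :: "'h \<Rightarrow>\<^sub>L 'h"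
  assume P: "\<forall>x. P x \<in> K \<and> (\<forall>y\<in>K. cinner (x - P x) y = 0)"
  show "P = proj K"
  proof (rule blinfun_eqI)
    fix x
    show "P x = proj K x"
      by (rule proj_eqI[OF K, symmetric]) (use P in \<open>auto simp: inner_eq_Re_cinner\<close>)
  qed
qed

section \<open>The standard representation and its subalgebras\<close>

notation blinfun_apply (infixr "\<cdot>" 85)

lemma closure_induct_closed:
  assumes "x \<in> closure S" "\<And>y. y \<in> S \<Longrightarrow> P y" "closed {y. P y}"
  shows "P x"
proof -
  have "closure S \<subseteq> {y. P y}" by (rule closure_minimal) (use assms(2,3) in auto)
  then show ?thesis using assms(1) by blast
qed

lemma blinfun_eq_on_dense:
  assumes "closure S = UNIV" "\<And>x. x \<in> S \<Longrightarrow> A \<cdot> x = B \<cdot> x"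
  shows "A = B"
proof (rule blinfun_eqI)
  fix x
  have "x \<in> closure S" using assms(1) by simp
  then show "A \<cdot> x = B \<cdot> x"
    by (rule closure_induct_closed) (rule assms(2), assumption, intro closed_Collect_eq continuous_intros)
qed

lemma dense_inner_eqI:
  fixes a b :: "'a::real_inner"
  assumes "closure S = UNIV" "\<And>x. x \<in> S \<Longrightarrow> inner a x = inner b x"
  shows "a = b"
proof (rule vector_inner_eqI)
  fix x
  have "x \<in> closure S" using assms(1) by simp
  then show "inner a x = inner b x"
    by (rule closure_induct_closed) (rule assms(2), assumption, intro closed_Collect_eq continuous_intros)
qed

lemma norm_proj_le:
  assumes K: "subspace K" "closed K"
  shows "norm (proj K x) \<le> norm x"
proof -
  have "(norm (proj K x))\<^sup>2 = inner (proj K (proj K x)) x"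
    by (simp add: inner_radj power2_norm_eq_inner radj_proj[OF K] proj_fix[OF K proj_in[OF K]])
  also have "\<dots> = inner (proj K x) x" by (simp add: proj_fix[OF K proj_in[OF K]])
  also have "\<dots> \<le> norm (proj K x) * norm x" by (rule norm_cauchy_schwarz)
  finally show ?thesis by (cases "proj K x = 0") (auto simp: power2_eq_square)
qed

section \<open>The standard representation and its conjugation\<close>

locale tracial_L2 = M: vna M
  for M :: "('h::complex_hilbert_space \<Rightarrow>\<^sub>L 'h) set" +
  fixes \<tau> :: "('h \<Rightarrow>\<^sub>L 'h) \<Rightarrow> complex" and \<Omega> :: 'h
  assumes trace: "normal_faithful_tracial_state M \<tau>"
    and L2: "acts_on_L2 M \<tau> \<Omega>"
begin

lemma trace_commute: "x \<in> M \<Longrightarrow> y \<in> M \<Longrightarrow> \<tau> (x o\<^sub>L y) = \<tau> (y o\<^sub>L x)"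
  and trace_id: "\<tau> id_blinfun = 1"
  and trace_add: "x \<in> M \<Longrightarrow> y \<in> M \<Longrightarrow> \<tau> (x + y) = \<tau> x + \<tau> y"
  using trace by (auto simp: normal_faithful_tracial_state_def linear_on_alg_def)

lemma cinner_vec: "x \<in> M \<Longrightarrow> y \<in> M \<Longrightarrow> cinner (x \<cdot> \<Omega>) (y \<cdot> \<Omega>) = \<tau> (radj y o\<^sub>L x)"
  using L2 by (simp add: acts_on_L2_def M.adj_radj)

lemma inner_vec: "x \<in> M \<Longrightarrow> y \<in> M \<Longrightarrow> inner (x \<cdot> \<Omega>) (y \<cdot> \<Omega>) = Re (\<tau> (radj y o\<^sub>L x))"
  by (simp add: inner_eq_Re_cinner cinner_vec)

lemma trace_eq_cinner: "x \<in> M \<Longrightarrow> \<tau> x = cinner (x \<cdot> \<Omega>) \<Omega>"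
  using cinner_vec[of x id_blinfun] by (simp add: M.id_closed)

lemma dense: "closure ((\<lambda>x. x \<cdot> \<Omega>) ` M) = UNIV"
  using L2 by (simp add: acts_on_L2_def)

lemma separating: "x \<in> M \<Longrightarrow> x \<cdot> \<Omega> = 0 \<Longrightarrow> x = 0"
  using trace cinner_vec[of x x]
  by (simp add: normal_faithful_tracial_state_def M.adj_radj cinner_self)

lemma separating_eq: "x \<in> M \<Longrightarrow> y \<in> M \<Longrightarrow> x \<cdot> \<Omega> = y \<cdot> \<Omega> \<Longrightarrow> x = y"
  using separating[of "x - y"] by (simp add: M.diff_closed blinfun.diff_left)

lemma norm_Omega [simp]: "norm \<Omega> = 1"
proof -
  have "complex_of_real ((norm \<Omega>)\<^sup>2) = 1"
    using trace_eq_cinner[OF M.id_closed] trace_id cinner_self[of \<Omega>] by simp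
  then have "(norm \<Omega>)\<^sup>2 = 1" by (metis of_real_eq_1_iff)
  then show ?thesis by (simp add: power2_eq_1_iff) (smt (verit) norm_ge_zero)
qed

lemma norm2_eq: "x \<in> M \<Longrightarrow> norm2 \<tau> x = norm (x \<cdot> \<Omega>)"
  by (simp add: norm2_def M.adj_radj flip: inner_vec) (simp add: norm_eq_sqrt_inner)

lemma norm_radj_vec: "x \<in> M \<Longrightarrow> norm (radj x \<cdot> \<Omega>) = norm (x \<cdot> \<Omega>)"
  by (simp add: norm_eq_sqrt_inner inner_vec M.radj_closed trace_commute)

text \<open>The trace property makes the passage from \<open>x\<close> to its adjoint isometric on
  the dense subspace of vectors \<open>x \<cdot> \<Omega>\<close>; its extension is the modular
  conjugation.\<close>

lemma J_exists: "\<exists>J :: 'h \<Rightarrow>\<^sub>L 'h. \<forall>x\<in>M. J (x \<cdot> \<Omega>) = radj x \<cdot> \<Omega>"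
proof -
  define G where "G = (\<lambda>x. (x \<cdot> \<Omega>, radj x \<cdot> \<Omega>)) ` M"
  have "subspace G" unfolding G_def
    by (intro linear_subspace_image linearI M.subspace) (simp_all add: blinfun.add_left blinfun.scaleR_left)
  moreover have "norm b \<le> 1 * norm a" if "(a, b) \<in> G" for a b
    using that by (auto simp: G_def norm_radj_vec)
  moreover have "fst ` G = (\<lambda>x. x \<cdot> \<Omega>) ` M" by (auto simp: G_def image_image)
  ultimately obtain T :: "'h \<Rightarrow>\<^sub>L 'h" where "\<forall>(a, b)\<in>G. T a = b"
    using graph_extension[of G 1] dense by auto
  then show ?thesis by (auto simp: G_def)
qed

definition J :: "'h \<Rightarrow>\<^sub>L 'h" where
  "J = (SOME J. \<forall>x\<in>M. blinfun_apply J (x \<cdot> \<Omega>) = radj x \<cdot> \<Omega>)"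

lemma J_vec: "x \<in> M \<Longrightarrow> J (x \<cdot> \<Omega>) = radj x \<cdot> \<Omega>"
  using someI_ex[OF J_exists] unfolding J_def by blast

lemma J_Omega [simp]: "J \<cdot> \<Omega> = \<Omega>"
  using J_vec[OF M.id_closed] by simp

lemma J_compose_J: "J o\<^sub>L J = id_blinfun"
  by (rule blinfun_eq_on_dense[OF dense]) (auto simp: J_vec M.radj_closed)

lemma J_J [simp]: "J (J \<cdot> \<xi>) = \<xi>"
  using J_compose_J by (metis blinfun_apply_blinfun_compose blinfun_apply_id_blinfun)

lemma inner_J_vec:
  assumes x: "x \<in> M" and y: "y \<in> M"
  shows "inner (J (x \<cdot> \<Omega>)) (y \<cdot> \<Omega>) = inner (x \<cdot> \<Omega>) (J (y \<cdot> \<Omega>))"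
proof -
  have "inner (J (x \<cdot> \<Omega>)) (y \<cdot> \<Omega>) = inner (y \<cdot> \<Omega>) (radj x \<cdot> \<Omega>)" by (simp only: J_vec[OF x] inner_commute)
  also have "\<dots> = Re (\<tau> (x o\<^sub>L y))" by (simp add: inner_vec x y M.radj_closed)
  also have "\<dots> = Re (\<tau> (y o\<^sub>L x))" by (simp only: trace_commute[OF x y])
  also have "\<dots> = inner (x \<cdot> \<Omega>) (radj y \<cdot> \<Omega>)" by (simp add: inner_vec x y M.radj_closed)
  finally show ?thesis by (simp add: J_vec[OF y])
qed

lemma radj_J [simp]: "radj J = J"
proof (rule blinfun_eq_on_dense[OF dense])
  fix v assume "v \<in> (\<lambda>x. x \<cdot> \<Omega>) ` M"
  then obtain x where x: "x \<in> M" and v: "v = x \<cdot> \<Omega>" by blast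
  show "radj J v = J v"
  proof (rule dense_inner_eqI[OF dense])
    fix w assume "w \<in> (\<lambda>x. x \<cdot> \<Omega>) ` M"
    then obtain y where y: "y \<in> M" "w = y \<cdot> \<Omega>" by blast
    have "inner (radj J v) w = inner v (J w)" by (rule inner_radj')
    then show "inner (radj J v) w = inner (J v) w" using inner_J_vec[OF x y(1)] by (simp add: v y(2))
  qed
qed

lemma inner_J: "inner (J \<cdot> \<xi>) \<eta> = inner \<xi> (J \<cdot> \<eta>)"
  using inner_radj[of J] by simp

lemma inner_J_J [simp]: "inner (J \<cdot> \<xi>) (J \<cdot> \<eta>) = inner \<xi> \<eta>"
  by (simp add: inner_J)

lemma norm_J [simp]: "norm (J \<cdot> \<xi>) = norm \<xi>"
  by (simp add: norm_eq_sqrt_inner)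

lemma J_iop: "J o\<^sub>L iop = - (iop o\<^sub>L J)"
proof (rule blinfun_eq_on_dense[OF dense])
  fix v assume "v \<in> (\<lambda>x. x \<cdot> \<Omega>) ` M"
  then obtain x where x: "x \<in> M" and v: "v = x \<cdot> \<Omega>" by blast
  have "J ((iop o\<^sub>L x) \<cdot> \<Omega>) = radj (iop o\<^sub>L x) \<cdot> \<Omega>"
    by (rule J_vec) (intro M.compose_closed M.iop_closed x)
  also have "\<dots> = - radj x (\<i> *\<^sub>C \<Omega>)" by (simp add: blinfun.minus_left blinfun.minus_right)
  also have "\<dots> = - (\<i> *\<^sub>C radj x \<cdot> \<Omega>)" using M.in_BH[OF x] by (simp add: BH_scaleC)
  finally show "(J o\<^sub>L iop) v = (- (iop o\<^sub>L J)) v"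
    by (simp add: v J_vec[OF x] blinfun.minus_left)
qed

text \<open>For \<open>x\<close> in \<open>M\<close> this is right multiplication:
  \<open>cj x\<close> sends \<open>y \<cdot> \<Omega>\<close> to
  \<open>y \<cdot> radj x \<cdot> \<Omega>\<close>. Hence it commutes with the left
  multiplications.\<close>

definition cj :: "('h \<Rightarrow>\<^sub>L 'h) \<Rightarrow> ('h \<Rightarrow>\<^sub>L 'h)" where
  "cj T = J o\<^sub>L T o\<^sub>L J"

lemma cj_apply [simp]: "cj T \<cdot> \<xi> = J (T (J \<cdot> \<xi>))"
  by (simp add: cj_def)

lemma cj_cj [simp]: "cj (cj T) = T"
  and cj_compose: "cj (S o\<^sub>L T) = cj S o\<^sub>L cj T"
  and cj_id [simp]: "cj id_blinfun = id_blinfun"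
  and cj_add: "cj (S + T) = cj S + cj T"
  and cj_diff: "cj (S - T) = cj S - cj T"
  and cj_scaleR: "cj (r *\<^sub>R T) = r *\<^sub>R cj T"
  by (rule blinfun_eqI, simp add: blinfun_apply_linear blinfun.bilinear_simps)+

lemma radj_cj: "radj (cj T) = cj (radj T)"
  by (simp add: cj_def blinfun_compose_assoc)

lemma cj_iop: "cj iop = - iop"
proof -
  have "cj iop = (J o\<^sub>L iop) o\<^sub>L J" by (simp add: cj_def)
  also have "\<dots> = - (iop o\<^sub>L (J o\<^sub>L J))" by (simp only: J_iop blinfun_compose_minus_left blinfun_compose_assoc)
  finally show ?thesis by (simp add: J_compose_J)
qed

lemma cj_BH: "T \<in> BH \<Longrightarrow> cj T \<in> BH"
proof -
  assume "T \<in> BH"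
  then have "cj (T o\<^sub>L iop) = cj (iop o\<^sub>L T)" by (simp only: BH_iff)
  then show "cj T \<in> BH" by (simp add: cj_compose cj_iop blinfun_compose_linear BH_iff)
qed

lemma cj_in_commutant:
  assumes x: "x \<in> M"
  shows "cj x \<in> commutant M"
proof -
  have "cj x o\<^sub>L y = y o\<^sub>L cj x" if y: "y \<in> M" for y
  proof (rule blinfun_eq_on_dense[OF dense])
    fix v assume "v \<in> (\<lambda>x. x \<cdot> \<Omega>) ` M"
    then obtain m where m: "m \<in> M" and v: "v = m \<cdot> \<Omega>" by blast
    have J1: "cj x (z \<cdot> \<Omega>) = z (radj x \<cdot> \<Omega>)" if z: "z \<in> M" for z
    proof -
      have "J ((x o\<^sub>L radj z) \<cdot> \<Omega>) = radj (x o\<^sub>L radj z) \<cdot> \<Omega>"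
        by (rule J_vec) (intro M.compose_closed M.radj_closed x z)
      then show ?thesis by (simp add: J_vec[OF z])
    qed
    show "(cj x o\<^sub>L y) v = (y o\<^sub>L cj x) v"
      using J1[OF m] J1[OF M.compose_closed[OF y m]] by (simp add: v)
  qed
  then show ?thesis using cj_BH[OF M.in_BH[OF x]] by (simp add: commutant_iff)
qed

lemma cj_Omega: "x \<in> M \<Longrightarrow> cj x \<cdot> \<Omega> = radj x \<cdot> \<Omega>"
  by (simp add: J_vec)

lemma cj_radj_Omega: "x \<in> M \<Longrightarrow> cj (radj x) \<cdot> \<Omega> = x \<cdot> \<Omega>"
  using J_vec[OF M.radj_closed, of x] by simp

text \<open>Such a set of pairs serves as the graph of an operator taking \<open>T \<cdot> v\<close>
  to \<open>T \<cdot> w\<close>. If the orbit of \<open>v\<close> is dense and the operator is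
  bounded, it commutes with all of \<open>commutant S\<close>.\<close>

lemma subspace_orbit_pairs: "subspace ((\<lambda>T. (T \<cdot> v, T \<cdot> w)) ` commutant S)"
  by (intro linear_subspace_image linearI subspace_commutant) (simp_all add: blinfun.add_left blinfun.scaleR_left)

text \<open>The commutant contains the right multiplications by \<open>M\<close>, whose values at
  \<open>\<Omega>\<close> already exhaust the vectors of \<open>M\<close>.\<close>

lemma commutant_dense: "B \<subseteq> M \<Longrightarrow> closure ((\<lambda>T. T \<cdot> \<Omega>) ` commutant B) = UNIV"
proof -
  assume "B \<subseteq> M"
  then have "cj x \<in> commutant B" if "x \<in> M" for x
    using cj_in_commutant[OF that] commutant_antimono by blast
  then have "(\<lambda>x. x \<cdot> \<Omega>) ` M \<subseteq> (\<lambda>T. T \<cdot> \<Omega>) ` commutant B"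
    using cj_radj_Omega M.radj_closed by (metis (no_types, lifting) image_iff subsetI)
  then show ?thesis using closure_mono dense by blast
qed

lemma commutant_dense_induct:
  assumes "B \<subseteq> M" "\<And>T. T \<in> commutant B \<Longrightarrow> P (T \<cdot> \<Omega>)" "closed {\<xi>. P \<xi>}"
  shows "P \<xi>"
  by (rule closure_induct_closed[of \<xi> "(\<lambda>T. T \<cdot> \<Omega>) ` commutant B"])
    (use commutant_dense[OF assms(1)] assms(2,3) in auto)

end

section \<open>Subalgebras and the projection onto their closure in the Hilbert space\<close>

locale tracial_sub = tracial_L2 M \<tau> \<Omega> + B: vna B
  for M :: "('h::complex_hilbert_space \<Rightarrow>\<^sub>L 'h) set" and \<tau> \<Omega> and B +
  assumes B_sub: "B \<subseteq> M"
begin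

lemma BM: "b \<in> B \<Longrightarrow> b \<in> M"
  using B_sub by blast

definition K :: "'h set" where "K = L2 \<Omega> B"

definition e :: "'h \<Rightarrow>\<^sub>L 'h" where "e = proj K"

lemma K_closure: "K = closure ((\<lambda>b. b \<cdot> \<Omega>) ` B)"
  by (simp add: K_def L2_def)

lemma subspace_K: "subspace K"
  unfolding K_closure
  by (intro subspace_closure linear_subspace_image linearI B.subspace)
    (simp_all add: blinfun.add_left blinfun.scaleR_left)

lemma closed_K: "closed K"
  by (simp add: K_closure)

lemma vec_in_K: "b \<in> B \<Longrightarrow> b \<cdot> \<Omega> \<in> K"
  unfolding K_closure by (rule closure_subset[THEN subsetD]) blast

lemma Omega_in_K: "\<Omega> \<in> K"
  using vec_in_K[OF B.id_closed] by simp

lemma K_induct: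
  assumes "\<xi> \<in> K" "\<And>b. b \<in> B \<Longrightarrow> P (b \<cdot> \<Omega>)" "closed {\<xi>. P \<xi>}"
  shows "P \<xi>"
  by (rule closure_induct_closed[OF assms(1)[unfolded K_closure]]) (use assms(2,3) in auto)

lemma eq_on_K:
  assumes "\<And>b. b \<in> B \<Longrightarrow> S \<cdot> b \<cdot> \<Omega> = T \<cdot> b \<cdot> \<Omega>" "\<xi> \<in> K"
  shows "S \<cdot> \<xi> = T \<cdot> \<xi>"
  using assms(2) by (rule K_induct) (rule assms(1), assumption, intro closed_Collect_eq continuous_intros)

lemma K_induct_closed_subset:
  assumes "closed E" "\<And>b. b \<in> B \<Longrightarrow> T \<cdot> b \<cdot> \<Omega> \<in> E" "\<xi> \<in> K"
  shows "T \<cdot> \<xi> \<in> E"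
proof -
  have "closed (blinfun_apply T -` E)"
    by (rule closed_vimage) (auto intro: assms(1) linear_continuous_on blinfun.bounded_linear_right)
  then show ?thesis using K_induct[OF assms(3), of "\<lambda>\<xi>. T \<cdot> \<xi> \<in> E"] assms(2) by (simp add: vimage_def)
qed

lemmas K_invariant = K_induct_closed_subset[OF closed_K]

lemma K_B: "b \<in> B \<Longrightarrow> \<xi> \<in> K \<Longrightarrow> b \<cdot> \<xi> \<in> K"
  by (rule K_invariant) (metis B.compose_closed blinfun_apply_blinfun_compose vec_in_K)

lemma K_J: "\<xi> \<in> K \<Longrightarrow> J \<cdot> \<xi> \<in> K"
  by (rule K_invariant) (simp_all add: J_vec BM vec_in_K B.radj_closed)

lemma jones_projection_eq: "jones_projection \<Omega> B = e"
proof -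
  have "\<i> *\<^sub>C x \<in> K" if "x \<in> K" for x
    using K_B[OF B.iop_closed that] by simp
  then have "orth_proj K = proj K"
    by (intro orth_proj_eq_proj subspace_K closed_K)
  then show ?thesis by (simp add: jones_projection_def e_def K_def)
qed

lemma e_in: "e \<cdot> \<xi> \<in> K"
  unfolding e_def by (rule proj_in) (rule subspace_K closed_K)+

lemma e_fix: "\<xi> \<in> K \<Longrightarrow> e \<cdot> \<xi> = \<xi>"
  unfolding e_def by (rule proj_fix) (rule subspace_K closed_K)+

lemma e_fix_iff: "e \<cdot> \<xi> = \<xi> \<longleftrightarrow> \<xi> \<in> K"
  unfolding e_def by (rule proj_fix_iff) (rule subspace_K closed_K)+

lemma e_orth: "\<eta> \<in> K \<Longrightarrow> inner (\<xi> - e \<cdot> \<xi>) \<eta> = 0"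
  unfolding e_def by (rule proj_orth[OF subspace_K closed_K])

lemma e_eqI: "q \<in> K \<Longrightarrow> (\<And>y. y \<in> K \<Longrightarrow> inner (x - q) y = 0) \<Longrightarrow> e x = q"
  unfolding e_def by (rule proj_eqI[OF subspace_K closed_K])

lemma e_e [simp]: "e (e \<cdot> \<xi>) = e \<cdot> \<xi>"
  by (simp add: e_fix e_in)

lemma e_idem [simp]: "e o\<^sub>L e = e"
  by (rule blinfun_eqI) simp

lemma radj_e [simp]: "radj e = e"
  unfolding e_def by (rule radj_proj) (rule subspace_K closed_K)+

lemma inner_e: "inner (e \<cdot> \<xi>) \<eta> = inner \<xi> (e \<cdot> \<eta>)"
  using inner_radj[of e] by simp

lemma norm_e_sq: "(norm (e \<cdot> \<xi>))\<^sup>2 = inner (e \<cdot> \<xi>) \<xi>"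
  by (simp add: power2_norm_eq_inner inner_e)

lemma norm_e_le: "norm (e \<cdot> \<xi>) \<le> norm \<xi>"
  unfolding e_def by (rule norm_proj_le) (rule subspace_K closed_K)+

lemma e_Omega [simp]: "e \<cdot> \<Omega> = \<Omega>"
  by (rule e_fix) (rule Omega_in_K)

lemma e_commute_B: "b \<in> B \<Longrightarrow> e o\<^sub>L b = b o\<^sub>L e"
  unfolding e_def by (rule proj_commute[OF subspace_K closed_K]) (auto intro: K_B B.radj_closed)

lemma e_J: "e o\<^sub>L J = J o\<^sub>L e"
  unfolding e_def by (rule proj_commute[OF subspace_K closed_K]) (auto intro: K_J)

lemma e_J_apply: "e (J \<cdot> \<xi>) = J (e \<cdot> \<xi>)"
  using e_J by (metis blinfun_apply_blinfun_compose)

lemma cj_e [simp]: "cj e = e"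
  by (rule blinfun_eqI) (simp add: e_J_apply)

lemma e_commutant: "e \<in> commutant B"
proof -
  have "e \<in> BH" unfolding BH_iff by (rule e_commute_B) (rule B.iop_closed)
  then show ?thesis by (simp add: commutant_iff e_commute_B)
qed

lemma e_BH: "e \<in> BH"
  using e_commutant commutant_BH by blast

lemma e_commute_cj: "b \<in> B \<Longrightarrow> e o\<^sub>L cj b = cj b o\<^sub>L e"
  using arg_cong[OF e_commute_B, of b cj] by (simp add: cj_compose)

lemma commutant_M_B: "T \<in> commutant M \<Longrightarrow> T \<in> commutant B"
  using commutant_antimono[OF B_sub] by blast

lemma K_eqI:
  assumes "a \<in> K" "b \<in> K" "\<And>z. z \<in> B \<Longrightarrow> inner a (z \<cdot> \<Omega>) = inner b (z \<cdot> \<Omega>)"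
  shows "a = b"
proof -
  have "a - b \<in> K" using assms subspace_K by (simp add: subspace_diff)
  then have "inner (a - b) (a - b) = 0"
  proof (rule K_induct[where P = "\<lambda>x. inner (a - b) x = 0"])
    show "closed {x. inner (a - b) x = 0}" by (intro closed_Collect_eq continuous_intros)
  qed (simp add: inner_diff_left assms(3))
  then show ?thesis by simp
qed

text \<open>This is the trace property of the right multiplications on \<open>L\<^sup>2(B)\<close>.\<close>

lemma radj_Omega_eq_J:
  assumes T: "T \<in> commutant B" "T \<cdot> \<Omega> \<in> K" "radj T \<cdot> \<Omega> \<in> K"
  shows "radj T \<cdot> \<Omega> = J (T \<cdot> \<Omega>)"
proof (rule K_eqI)
  fix z assume z: "z \<in> B"
  have "inner (radj T \<cdot> \<Omega>) (z \<cdot> \<Omega>) = inner \<Omega> (T (z \<cdot> \<Omega>))" by (rule inner_radj')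
  also have "\<dots> = inner \<Omega> (z (T \<cdot> \<Omega>))" by (simp only: B.commutant_commutes_apply[OF T(1) z])
  also have "\<dots> = inner (radj z \<cdot> \<Omega>) (T \<cdot> \<Omega>)" by (rule inner_radj'[symmetric])
  also have "\<dots> = inner (J (z \<cdot> \<Omega>)) (T \<cdot> \<Omega>)" by (simp only: J_vec[OF BM[OF z]])
  also have "\<dots> = inner (J (T \<cdot> \<Omega>)) (z \<cdot> \<Omega>)" 
    using inner_J[of "z \<cdot> \<Omega>" "T \<cdot> \<Omega>"] inner_commute[of "z \<cdot> \<Omega>" "J \<cdot> T \<cdot> \<Omega>"] by simp
  finally show "inner (radj T \<cdot> \<Omega>) (z \<cdot> \<Omega>) = inner (J (T \<cdot> \<Omega>)) (z \<cdot> \<Omega>)" .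
qed (use assms K_J in auto)

lemma norm_radj_Omega:
  assumes "T \<in> commutant B" "T \<cdot> \<Omega> \<in> K" "radj T \<cdot> \<Omega> \<in> K"
  shows "norm (radj T \<cdot> \<Omega>) = norm (T \<cdot> \<Omega>)"
  using radj_Omega_eq_J[OF assms] by simp

end

section \<open>Conditional expectations\<close>

context tracial_sub
begin

text \<open>For both compressions \<open>J\<close> sends the value at \<open>\<Omega>\<close> to the value of the adjoint at \<open>\<Omega>\<close>; they then
  commute because one commutes with the left and the other with the right multiplications by \<open>B\<close>.\<close>

lemma compressions_commute:
  assumes x: "x \<in> M" and S: "S \<in> commutant B"
  shows "(e o\<^sub>L x o\<^sub>L e) o\<^sub>L (e o\<^sub>L S o\<^sub>L e) = (e o\<^sub>L S o\<^sub>L e) o\<^sub>L (e o\<^sub>L x o\<^sub>L e)"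
proof -
  define p q where "p = e o\<^sub>L x o\<^sub>L e" and "q = e o\<^sub>L S o\<^sub>L e"
  have q: "q \<in> commutant B" unfolding q_def by (intro commutant_compose e_commutant S)
  then have q': "radj q \<in> commutant B" by (rule B.commutant_radj_closed)
  have rp: "radj p \<cdot> \<Omega> = J \<cdot> p \<cdot> \<Omega>"
    using e_J_apply[of "x \<cdot> \<Omega>"] by (simp add: p_def J_vec[OF x])
  have qJ: "radj q \<cdot> \<Omega> = J \<cdot> q \<cdot> \<Omega>"
    by (rule radj_Omega_eq_J[OF q]) (simp_all add: q_def e_in)
  then have Jq: "q \<cdot> \<Omega> = J \<cdot> radj q \<cdot> \<Omega>" by simp
  have comm_p: "p \<cdot> cj y \<cdot> \<xi> = cj y \<cdot> p \<cdot> \<xi>" if y: "y \<in> B" for y \<xi>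
  proof -
    have "cj y o\<^sub>L x = x o\<^sub>L cj y"
      using cj_in_commutant[OF BM[OF y]] x by (simp add: commutant_iff)
    then have "(e o\<^sub>L x o\<^sub>L e) o\<^sub>L cj y = cj y o\<^sub>L (e o\<^sub>L x o\<^sub>L e)"
      by (intro commute_compose e_commute_cj[OF y]) simp
    then show ?thesis unfolding p_def by (metis blinfun_apply_blinfun_compose)
  qed
  have radj_p: "radj p \<cdot> cj y \<cdot> \<xi> = cj y \<cdot> radj p \<cdot> \<xi>" if y: "y \<in> B" for y \<xi>
  proof -
    have "p o\<^sub>L cj (radj y) = cj (radj y) o\<^sub>L p"
      by (rule blinfun_eqI) (simp only: blinfun_apply_blinfun_compose comm_p[OF B.radj_closed[OF y]])
    from arg_cong[OF this, of radj] show ?thesis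
      by (simp add: radj_cj) (metis blinfun_apply_blinfun_compose cj_apply)
  qed
  have vec: "p \<cdot> q \<cdot> y \<cdot> \<Omega> = q \<cdot> p \<cdot> y \<cdot> \<Omega>" if y: "y \<in> B" for y
  proof (rule K_eqI)
    show "p \<cdot> q \<cdot> y \<cdot> \<Omega> \<in> K" "q \<cdot> p \<cdot> y \<cdot> \<Omega> \<in> K" by (simp_all add: p_def q_def e_in)
    fix z assume z: "z \<in> B"
    have cz: "cj y \<in> commutant M" "cj z \<in> commutant M" using cj_in_commutant BM y z by auto
    have yO: "cj (radj y) \<cdot> \<Omega> = y \<cdot> \<Omega>" and zO: "cj (radj z) \<cdot> \<Omega> = z \<cdot> \<Omega>"
      using cj_radj_Omega BM y z by blast+
    have "radj p \<cdot> z \<cdot> \<Omega> = cj (radj z) \<cdot> J \<cdot> p \<cdot> \<Omega>"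
      by (simp only: zO[symmetric] radj_p[OF B.radj_closed[OF z]] rp)
    then have 1: "radj p \<cdot> z \<cdot> \<Omega> = J \<cdot> radj z \<cdot> p \<cdot> \<Omega>" by simp
    have "q \<cdot> y \<cdot> \<Omega> = y \<cdot> q \<cdot> \<Omega>"
      by (rule B.commutant_commutes_apply[OF q y])
    then have 2: "q \<cdot> y \<cdot> \<Omega> = y \<cdot> J \<cdot> radj q \<cdot> \<Omega>" by (simp only: Jq[symmetric])
    \<comment> \<open>In these matrix coefficients \<open>q\<close> is moved past the left
      multiplications by \<open>y\<close> and \<open>z\<close>, and \<open>p\<close> past the right
      multiplications by them; \<open>J\<close> turns one kind into the other.\<close>
    have "inner (p \<cdot> q \<cdot> y \<cdot> \<Omega>) (z \<cdot> \<Omega>) = inner (q \<cdot> y \<cdot> \<Omega>) (radj p \<cdot> z \<cdot> \<Omega>)" by (rule inner_radj)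
    also have "\<dots> = inner (y \<cdot> J \<cdot> radj q \<cdot> \<Omega>) (J \<cdot> radj z \<cdot> p \<cdot> \<Omega>)" by (simp only: 1 2)
    also have "\<dots> = inner (cj y \<cdot> radj q \<cdot> \<Omega>) (radj z \<cdot> p \<cdot> \<Omega>)" by (simp add: inner_J)
    also have "\<dots> = inner (z \<cdot> cj y \<cdot> radj q \<cdot> \<Omega>) (p \<cdot> \<Omega>)" by (rule inner_radj[symmetric])
    also have "z \<cdot> cj y \<cdot> radj q \<cdot> \<Omega> = cj y \<cdot> z \<cdot> radj q \<cdot> \<Omega>"
      by (rule B.commutant_commutes_apply[OF commutant_M_B[OF cz(1)] z, symmetric])
    also have "z \<cdot> radj q \<cdot> \<Omega> = radj q \<cdot> z \<cdot> \<Omega>"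
      by (rule B.commutant_commutes_apply[OF q' z, symmetric])
    also have "inner (cj y \<cdot> radj q \<cdot> z \<cdot> \<Omega>) (p \<cdot> \<Omega>) = inner (radj q \<cdot> z \<cdot> \<Omega>) (cj (radj y) \<cdot> p \<cdot> \<Omega>)"
      by (simp only: inner_radj radj_cj)
    also have "cj (radj y) \<cdot> p \<cdot> \<Omega> = p \<cdot> y \<cdot> \<Omega>"
      by (simp only: comm_p[OF B.radj_closed[OF y], symmetric] yO)
    also have "inner (radj q \<cdot> z \<cdot> \<Omega>) (p \<cdot> y \<cdot> \<Omega>) = inner (q \<cdot> p \<cdot> y \<cdot> \<Omega>) (z \<cdot> \<Omega>)"
      using inner_radj'[of q "z \<cdot> \<Omega>" "p \<cdot> y \<cdot> \<Omega>"] inner_commute[of "z \<cdot> \<Omega>" "q \<cdot> p \<cdot> y \<cdot> \<Omega>"] by simp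
    finally show "inner (p \<cdot> q \<cdot> y \<cdot> \<Omega>) (z \<cdot> \<Omega>) = inner (q \<cdot> p \<cdot> y \<cdot> \<Omega>) (z \<cdot> \<Omega>)" .
  qed
  have onK: "(p o\<^sub>L q) \<cdot> \<xi> = (q o\<^sub>L p) \<cdot> \<xi>" if "\<xi> \<in> K" for \<xi>
    by (rule eq_on_K[OF _ that]) (simp add: vec)
  have "p o\<^sub>L q = q o\<^sub>L p"
  proof (rule blinfun_eqI)
    fix \<xi>
    have "(p o\<^sub>L q) \<cdot> \<xi> = (p o\<^sub>L q) \<cdot> e \<cdot> \<xi>" "(q o\<^sub>L p) \<cdot> \<xi> = (q o\<^sub>L p) \<cdot> e \<cdot> \<xi>"
      by (simp_all add: p_def q_def)
    then show "(p o\<^sub>L q) \<cdot> \<xi> = (q o\<^sub>L p) \<cdot> \<xi>" using onK[OF e_in] by simp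
  qed
  then show ?thesis by (simp add: p_def q_def)
qed

text \<open>The operator \<open>r\<close> is the absolute value of \<open>T o\<^sub>L e\<close>. By
  \<open>root_inner\<close> it has the same inner products as \<open>T\<close> on \<open>K\<close>,
  but unlike \<open>T\<close> it commutes with the compressions of elements of \<open>M\<close>.
  Estimates at the dense vectors \<open>T \<cdot> \<Omega>\<close> are thereby moved into
  \<open>K\<close>.\<close>

lemma compression_root:
  assumes T: "T \<in> commutant B"
  obtains r where "radj r = r" "r o\<^sub>L r = e o\<^sub>L (radj T o\<^sub>L T) o\<^sub>L e" "e o\<^sub>L r = r o\<^sub>L e"
    "\<And>x. x \<in> M \<Longrightarrow> (e o\<^sub>L x o\<^sub>L e) o\<^sub>L r = r o\<^sub>L (e o\<^sub>L x o\<^sub>L e)"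
proof -
  define a where "a = e o\<^sub>L (radj T o\<^sub>L T) o\<^sub>L e"
  have "radj a = a" by (simp add: a_def blinfun_compose_assoc)
  moreover have "0 \<le> inner (a \<cdot> \<xi>) \<xi>" for \<xi>
  proof -
    have "inner (a \<cdot> \<xi>) \<xi> = inner (T \<cdot> e \<cdot> \<xi>) (T \<cdot> e \<cdot> \<xi>)"
      by (simp add: a_def inner_e inner_radj')
    then show ?thesis by simp
  qed
  ultimately obtain r where r: "r o\<^sub>L r = a" "radj r = r" "\<And>S. S o\<^sub>L a = a o\<^sub>L S \<Longrightarrow> S o\<^sub>L r = r o\<^sub>L S"
    using sqrt_exists by blast
  have "e o\<^sub>L a = a o\<^sub>L e" by (rule blinfun_eqI) (simp add: a_def)
  moreover have "(e o\<^sub>L x o\<^sub>L e) o\<^sub>L a = a o\<^sub>L (e o\<^sub>L x o\<^sub>L e)" if "x \<in> M" for x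
    unfolding a_def
    by (rule compressions_commute[OF that]) (intro commutant_compose B.commutant_radj_closed T)
  ultimately show ?thesis using r that unfolding a_def by blast
qed

lemma root_inner:
  assumes "radj r = r" "r o\<^sub>L r = e o\<^sub>L (radj T o\<^sub>L T) o\<^sub>L e" "\<xi> \<in> K" "\<eta> \<in> K"
  shows "inner (r \<cdot> \<xi>) (r \<cdot> \<eta>) = inner (T \<cdot> \<xi>) (T \<cdot> \<eta>)"
proof -
  have "inner (r \<cdot> \<xi>) (r \<cdot> \<eta>) = inner \<xi> ((r o\<^sub>L r) \<cdot> \<eta>)" using inner_radj[of r] assms(1) by simp
  also have "\<dots> = inner (e \<cdot> \<xi>) (radj T \<cdot> T \<cdot> e \<cdot> \<eta>)" by (simp add: assms(2) inner_e)
  finally show ?thesis by (simp add: e_fix assms(3,4) inner_radj)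
qed

text \<open>The expectation is the operator taking \<open>T \<cdot> \<Omega>\<close> to
  \<open>T \<cdot> e \<cdot> x \<cdot> \<Omega>\<close> for \<open>T\<close> in the commutant of
  \<open>B\<close>. It is bounded by \<open>norm x\<close>: with \<open>T\<close> replaced by
  \<open>r\<close> from \<open>compression_root\<close>, the vector r e x \<Omega> equals e x e r
  \<Omega>.\<close>

lemma cexp_exists:
  assumes x: "x \<in> M"
  shows "\<exists>b\<in>B. b \<cdot> \<Omega> = e \<cdot> x \<cdot> \<Omega>"
proof -
  define G where "G = (\<lambda>T. (T \<cdot> \<Omega>, T \<cdot> e \<cdot> x \<cdot> \<Omega>)) ` commutant B"
  have sub: "subspace G" unfolding G_def by (rule subspace_orbit_pairs)
  have bound: "norm (T \<cdot> e \<cdot> x \<cdot> \<Omega>) \<le> norm x * norm (T \<cdot> \<Omega>)" if T: "T \<in> commutant B" for T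
  proof -
    obtain r where r: "radj r = r" "r o\<^sub>L r = e o\<^sub>L (radj T o\<^sub>L T) o\<^sub>L e" "e o\<^sub>L r = r o\<^sub>L e"
      "\<And>x. x \<in> M \<Longrightarrow> (e o\<^sub>L x o\<^sub>L e) o\<^sub>L r = r o\<^sub>L (e o\<^sub>L x o\<^sub>L e)"
      using compression_root[OF T] by metis
    have n: "norm (T \<cdot> \<xi>) = norm (r \<cdot> \<xi>)" if "\<xi> \<in> K" for \<xi>
      using root_inner[OF r(1,2) that that] by (simp add: norm_eq_sqrt_inner)
    have "r \<cdot> e \<cdot> x \<cdot> \<Omega> = (r o\<^sub>L (e o\<^sub>L x o\<^sub>L e)) \<cdot> \<Omega>" by simp
    also have "\<dots> = ((e o\<^sub>L x o\<^sub>L e) o\<^sub>L r) \<cdot> \<Omega>" by (simp only: r(4)[OF x])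
    finally have "norm (r \<cdot> e \<cdot> x \<cdot> \<Omega>) = norm (e \<cdot> x \<cdot> e \<cdot> r \<cdot> \<Omega>)" by simp
    also have "\<dots> \<le> norm (x \<cdot> e \<cdot> r \<cdot> \<Omega>)" by (rule norm_e_le)
    also have "\<dots> \<le> norm x * norm (e \<cdot> r \<cdot> \<Omega>)" by (rule norm_blinfun)
    also have "\<dots> \<le> norm x * norm (r \<cdot> \<Omega>)" by (intro mult_left_mono norm_e_le) simp
    finally show ?thesis by (simp add: n e_in Omega_in_K)
  qed
  have "fst ` G = (\<lambda>T. T \<cdot> \<Omega>) ` commutant B" by (auto simp: G_def image_image)
  then have d: "closure (fst ` G) = UNIV" using commutant_dense[OF B_sub] by simp
  have "norm b \<le> norm x * norm a" if "(a, b) \<in> G" for a b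
    using that bound by (auto simp: G_def)
  from graph_extension[OF sub this d] obtain b :: "'h \<Rightarrow>\<^sub>L 'h" where b0: "\<forall>(u, v)\<in>G. b \<cdot> u = v"
    by blast
  then have b: "b \<cdot> T \<cdot> \<Omega> = T \<cdot> e \<cdot> x \<cdot> \<Omega>" if "T \<in> commutant B" for T
    using that by (auto simp: G_def)
  have comm: "b o\<^sub>L S = S o\<^sub>L b" if S: "S \<in> commutant B" for S
  proof (rule blinfun_eq_on_dense[OF commutant_dense[OF B_sub]])
    fix v assume "v \<in> (\<lambda>T. T \<cdot> \<Omega>) ` commutant B"
    then obtain T where T: "T \<in> commutant B" "v = T \<cdot> \<Omega>" by blast
    have "b \<cdot> (S o\<^sub>L T) \<cdot> \<Omega> = (S o\<^sub>L T) \<cdot> e \<cdot> x \<cdot> \<Omega>"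
      by (rule b) (intro commutant_compose S T)
    then show "(b o\<^sub>L S) \<cdot> v = (S o\<^sub>L b) \<cdot> v" using b[OF T(1)] by (simp add: T(2))
  qed
  have "b \<in> BH" unfolding BH_iff by (rule comm) (rule commutant_iop[OF B.subset_BH])
  then have "b \<in> B" using comm by (rule B.in_algebraI)
  moreover have "b \<cdot> \<Omega> = e \<cdot> x \<cdot> \<Omega>" using b[OF commutant_id] by simp
  ultimately show ?thesis by blast
qed

definition cexp :: "('h \<Rightarrow>\<^sub>L 'h) \<Rightarrow> ('h \<Rightarrow>\<^sub>L 'h)" where
  "cexp x = (SOME b. b \<in> B \<and> b \<cdot> \<Omega> = e \<cdot> x \<cdot> \<Omega>)"

lemma cexp: "x \<in> M \<Longrightarrow> cexp x \<in> B \<and> cexp x \<cdot> \<Omega> = e \<cdot> x \<cdot> \<Omega>"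
  unfolding cexp_def by (rule someI_ex) (use cexp_exists in blast)

lemma cexp_in: "x \<in> M \<Longrightarrow> cexp x \<in> B"
  and cexp_Omega: "x \<in> M \<Longrightarrow> cexp x \<cdot> \<Omega> = e \<cdot> x \<cdot> \<Omega>"
  using cexp by blast+

lemma cexp_eqI: "x \<in> M \<Longrightarrow> b \<in> B \<Longrightarrow> b \<cdot> \<Omega> = e \<cdot> x \<cdot> \<Omega> \<Longrightarrow> cexp x = b"
  by (rule separating_eq) (simp_all add: cexp_in cexp_Omega BM)

lemma in_B_if_vec_in_K: "x \<in> M \<Longrightarrow> x \<cdot> \<Omega> \<in> K \<Longrightarrow> x \<in> B"
  using separating_eq[of "cexp x" x] cexp_in cexp_Omega e_fix BM by metis

text \<open>With \<open>r\<close> from \<open>compression_root\<close>, the form of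
  \<open>cexp x\<close> at the dense vectors \<open>T \<cdot> \<Omega>\<close> equals the form of
  \<open>x\<close> at \<open>e \<cdot> r \<cdot> \<Omega>\<close>.\<close>

lemma cexp_positive:
  assumes x: "x \<in> M" and pos: "positive_op x"
  shows "positive_op (cexp x)"
proof -
  have xp: "radj x = x" "\<And>\<xi>. 0 \<le> inner (x \<cdot> \<xi>) \<xi>" using pos by (auto simp: positive_op_iff)
  have b: "cexp x \<in> B" "cexp x \<in> M" using cexp_in[OF x] BM by auto
  have "radj (cexp x) \<cdot> \<Omega> = J \<cdot> e \<cdot> x \<cdot> \<Omega>"
    using J_vec[OF b(2)] cexp_Omega[OF x] by simp
  also have "\<dots> = cexp x \<cdot> \<Omega>"
    by (simp add: e_J_apply[symmetric] J_vec[OF x] xp(1) cexp_Omega[OF x])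
  finally have sa: "radj (cexp x) = cexp x"
    by (intro separating_eq b M.radj_closed)
  have TO: "0 \<le> inner (cexp x \<cdot> T \<cdot> \<Omega>) (T \<cdot> \<Omega>)" if T: "T \<in> commutant B" for T
  proof -
    obtain r where r: "radj r = r" "r o\<^sub>L r = e o\<^sub>L (radj T o\<^sub>L T) o\<^sub>L e" "e o\<^sub>L r = r o\<^sub>L e"
      "\<And>x. x \<in> M \<Longrightarrow> (e o\<^sub>L x o\<^sub>L e) o\<^sub>L r = r o\<^sub>L (e o\<^sub>L x o\<^sub>L e)"
      using compression_root[OF T] by metis
    have "cexp x \<cdot> T \<cdot> \<Omega> = T \<cdot> e \<cdot> x \<cdot> \<Omega>"
      by (simp only: B.commutant_commutes_apply[OF T b(1), symmetric] cexp_Omega[OF x])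
    then have "inner (cexp x \<cdot> T \<cdot> \<Omega>) (T \<cdot> \<Omega>) = inner (r \<cdot> e \<cdot> x \<cdot> \<Omega>) (r \<cdot> \<Omega>)"
      using root_inner[OF r(1,2) e_in Omega_in_K] by simp
    also have "r \<cdot> e \<cdot> x \<cdot> \<Omega> = (r o\<^sub>L (e o\<^sub>L x o\<^sub>L e)) \<cdot> \<Omega>" by simp
    also have "\<dots> = e \<cdot> x \<cdot> e \<cdot> r \<cdot> \<Omega>" by (simp only: r(4)[OF x, symmetric] blinfun_apply_blinfun_compose)
    also have "inner \<dots> (r \<cdot> \<Omega>) = inner (x \<cdot> e \<cdot> r \<cdot> \<Omega>) (e \<cdot> r \<cdot> \<Omega>)" by (rule inner_e)
    finally show ?thesis using xp(2) by simp
  qed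
  have "0 \<le> inner (cexp x \<cdot> \<xi>) \<xi>" for \<xi>
    by (rule commutant_dense_induct[OF B_sub, where P = "\<lambda>\<xi>. 0 \<le> inner (cexp x \<cdot> \<xi>) \<xi>"])
      (rule TO, assumption, intro closed_Collect_le continuous_intros)
  then show ?thesis using sa B.in_BH[OF b(1)] by (simp add: positive_op_iff)
qed

lemma cexp_add: "x \<in> M \<Longrightarrow> y \<in> M \<Longrightarrow> cexp (x + y) = cexp x + cexp y"
  by (rule cexp_eqI)
    (simp_all add: M.add_closed B.add_closed cexp_in cexp_Omega blinfun.add_left blinfun.add_right)

lemma cexp_diff: "x \<in> M \<Longrightarrow> y \<in> M \<Longrightarrow> cexp (x - y) = cexp x - cexp y"
  by (rule cexp_eqI)
    (simp_all add: M.diff_closed B.diff_closed cexp_in cexp_Omega blinfun.diff_left blinfun.diff_right)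

lemma cexp_op_scale: "x \<in> M \<Longrightarrow> cexp (op_scale c x) = op_scale c (cexp x)"
  by (rule cexp_eqI) (simp_all add: M.op_scale_closed B.op_scale_closed cexp_in cexp_Omega e_BH BH_scaleC)

lemma cexp_fix: "b \<in> B \<Longrightarrow> cexp b = b"
  by (rule cexp_eqI) (simp_all add: BM e_fix vec_in_K)

text \<open>The projection \<open>e\<close> commutes with left multiplications by \<open>B\<close>.
  The right factor is moved past \<open>x\<close> and \<open>e\<close> by writing
  \<open>b \<cdot> \<Omega>\<close> as a right multiplication applied to
  \<open>\<Omega>\<close>.\<close>

lemma cexp_bimodule:
  assumes a: "a \<in> B" and b: "b \<in> B" and x: "x \<in> M"
  shows "cexp (a o\<^sub>L x o\<^sub>L b) = a o\<^sub>L cexp x o\<^sub>L b"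
proof (rule cexp_eqI)
  show "a o\<^sub>L x o\<^sub>L b \<in> M" by (intro M.compose_closed BM a b x)
  show "a o\<^sub>L cexp x o\<^sub>L b \<in> B" by (intro B.compose_closed a b cexp_in x)
  have c: "cj (radj b) \<in> commutant M" by (intro cj_in_commutant M.radj_closed BM b)
  have bO: "b \<cdot> \<Omega> = cj (radj b) \<cdot> \<Omega>" using cj_radj_Omega[OF BM[OF b]] by simp
  have "(a o\<^sub>L cexp x o\<^sub>L b) \<cdot> \<Omega> = a \<cdot> cexp x \<cdot> cj (radj b) \<cdot> \<Omega>" by (simp only: blinfun_apply_blinfun_compose bO)
  also have "\<dots> = a \<cdot> cj (radj b) \<cdot> cexp x \<cdot> \<Omega>"
    by (simp only: M.commutant_commutes_apply[OF c BM[OF cexp_in[OF x]]])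
  also have "\<dots> = a \<cdot> cj (radj b) \<cdot> e \<cdot> x \<cdot> \<Omega>" by (simp only: cexp_Omega[OF x])
  also have "cj (radj b) \<cdot> e \<cdot> x \<cdot> \<Omega> = e \<cdot> cj (radj b) \<cdot> x \<cdot> \<Omega>"
    using e_commute_cj[OF B.radj_closed[OF b]] by (metis blinfun_apply_blinfun_compose)
  also have "cj (radj b) \<cdot> x \<cdot> \<Omega> = x \<cdot> cj (radj b) \<cdot> \<Omega>" by (rule M.commutant_commutes_apply[OF c x])
  also have "\<dots> = x \<cdot> b \<cdot> \<Omega>" by (simp only: bO)
  also have "a \<cdot> e \<cdot> x \<cdot> b \<cdot> \<Omega> = e \<cdot> a \<cdot> x \<cdot> b \<cdot> \<Omega>"
    using e_commute_B[OF a] by (metis blinfun_apply_blinfun_compose)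
  finally show "(a o\<^sub>L cexp x o\<^sub>L b) \<cdot> \<Omega> = e \<cdot> (a o\<^sub>L x o\<^sub>L b) \<cdot> \<Omega>" by simp
qed

lemma cexp_trace: "x \<in> M \<Longrightarrow> \<tau> (cexp x) = \<tau> x"
  by (simp add: trace_eq_cinner BM cexp_in cexp_Omega cinner_radj[OF e_BH])

lemma cexp_faithful:
  assumes x: "x \<in> M" and z: "cexp (radj x o\<^sub>L x) = 0"
  shows "x = 0"
proof -
  have m: "radj x o\<^sub>L x \<in> M" by (intro M.compose_closed M.radj_closed x)
  have "inner (x \<cdot> \<Omega>) (x \<cdot> \<Omega>) = inner (e \<cdot> (radj x o\<^sub>L x) \<cdot> \<Omega>) \<Omega>" by (simp add: inner_e inner_radj')
  also have "\<dots> = 0" by (simp only: cexp_Omega[OF m, symmetric] z blinfun.zero_left inner_zero_left)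
  finally show ?thesis using separating[OF x] by simp
qed

section \<open>Normality and uniqueness of the conditional expectation\<close>

text \<open>The square root of \<open>y\<close> commutes with \<open>T\<close>. The bound lets the
  trace, which is the form at \<open>\<Omega>\<close>, control the form at a dense set of
  vectors.\<close>

lemma positive_vector_bound:
  assumes y: "y \<in> M" "positive_op y" and T: "T \<in> commutant M"
  shows "inner (y \<cdot> T \<cdot> \<Omega>) (T \<cdot> \<Omega>) \<le> (norm T)\<^sup>2 * inner (y \<cdot> \<Omega>) \<Omega>"
proof -
  obtain r where r: "r \<in> M" "r o\<^sub>L r = y" "radj r = r"
    using M.sqrt_closed[of y] y by (metis positive_op_iff)
  have rr: "inner (y \<cdot> \<xi>) \<xi> = (norm (r \<cdot> \<xi>))\<^sup>2" for \<xi>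
  proof -
    have "inner (r \<cdot> r \<cdot> \<xi>) \<xi> = inner (r \<cdot> \<xi>) (r \<cdot> \<xi>)"
      using inner_radj[of r "r \<cdot> \<xi>" \<xi>] by (simp only: r(3))
    then show ?thesis by (simp add: power2_norm_eq_inner flip: r(2))
  qed
  have "r \<cdot> T \<cdot> \<Omega> = T \<cdot> r \<cdot> \<Omega>" by (rule M.commutant_commutes_apply[OF T r(1), symmetric])
  then have "norm (r \<cdot> T \<cdot> \<Omega>) \<le> norm T * norm (r \<cdot> \<Omega>)" by (simp add: norm_blinfun)
  then have "(norm (r \<cdot> T \<cdot> \<Omega>))\<^sup>2 \<le> (norm T * norm (r \<cdot> \<Omega>))\<^sup>2" by (intro power_mono) auto
  then show ?thesis by (simp add: rr power_mult_distrib)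
qed

lemma trace_normal:
  assumes D: "bounded_directed_sup M D s" and eps: "0 < \<epsilon>"
  obtains x where "x \<in> D" "Re (\<tau> (s - x)) < \<epsilon>"
proof -
  have D': "D \<noteq> {}" "D \<subseteq> M" "s \<in> M" using D by (auto simp: bounded_directed_sup_def)
  have R: "Re (\<tau> s) = (SUP x\<in>D. Re (\<tau> x))"
    using trace D by (auto simp: normal_faithful_tracial_state_def)
  have dif: "Re (\<tau> (s - x)) = Re (\<tau> s) - Re (\<tau> x)" if "x \<in> D" for x
    using trace_add[of "s - x" x] D' that by (auto simp: M.diff_closed subset_iff)
  have "\<exists>x\<in>D. Re (\<tau> s) - \<epsilon> < Re (\<tau> x)"
  proof (rule ccontr)
    assume "\<not> (\<exists>x\<in>D. Re (\<tau> s) - \<epsilon> < Re (\<tau> x))"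
    then have "(SUP x\<in>D. Re (\<tau> x)) \<le> Re (\<tau> s) - \<epsilon>" using D'(1) by (intro cSUP_least) auto
    then show False using R eps by simp
  qed
  then show ?thesis using that dif by force
qed

text \<open>Normality of the trace makes the trace of \<open>s - x\<close> small for some
  \<open>x\<close> in \<open>D\<close>, and \<open>positive_vector_bound\<close> carries this over
  to the form of \<open>cexp (s - x)\<close> at each \<open>T \<cdot> \<Omega>\<close>. So an upper
  bound \<open>t\<close> of the image cannot fail to dominate \<open>cexp s\<close> there.\<close>

lemma cexp_normal:
  assumes D: "bounded_directed_sup M D s"
  shows "bounded_directed_sup B (cexp ` D) (cexp s)"
proof -
  have D': "D \<noteq> {}" "D \<subseteq> M" "s \<in> M" and pos: "\<And>x. x \<in> D \<Longrightarrow> positive_op x"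
    and dir: "\<And>x y. x \<in> D \<Longrightarrow> y \<in> D \<Longrightarrow> \<exists>z\<in>D. op_le x z \<and> op_le y z"
    and up: "\<And>x. x \<in> D \<Longrightarrow> op_le x s"
    using D by (auto simp: bounded_directed_sup_def)
  have mono: "op_le (cexp x) (cexp y)" if "x \<in> M" "y \<in> M" "op_le x y" for x y
    using cexp_positive[of "y - x"] that by (simp add: op_le_def M.diff_closed cexp_diff)
  have least: "op_le (cexp s) t" if t: "t \<in> B" "\<And>x. x \<in> D \<Longrightarrow> op_le (cexp x) t" for t
  proof -
    have "0 \<le> inner ((t - cexp s) \<cdot> T \<cdot> \<Omega>) (T \<cdot> \<Omega>)" if T: "T \<in> commutant M" for T
    proof (rule ccontr)
      define c where "c = - inner ((t - cexp s) \<cdot> T \<cdot> \<Omega>) (T \<cdot> \<Omega>)"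
      assume "\<not> ?thesis"
      then have c: "c > 0" by (simp add: c_def)
      then have n: "(norm T)\<^sup>2 + 1 > 0" "c / ((norm T)\<^sup>2 + 1) > 0"
        by (simp_all add: add_nonneg_pos)
      obtain x where x: "x \<in> D" "Re (\<tau> (s - x)) < c / ((norm T)\<^sup>2 + 1)"
        using trace_normal[OF D n(2)] by blast
      have xM: "x \<in> M" "s - x \<in> M" using x(1) D' by (auto intro: M.diff_closed)
      have sx: "positive_op (s - x)" using up[OF x(1)] by (simp add: op_le_def)
      have "inner (cexp (s - x) \<cdot> T \<cdot> \<Omega>) (T \<cdot> \<Omega>) \<le> (norm T)\<^sup>2 * inner (cexp (s - x) \<cdot> \<Omega>) \<Omega>"
        by (rule positive_vector_bound) (intro BM cexp_in cexp_positive xM sx T)+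
      also have "inner (cexp (s - x) \<cdot> \<Omega>) \<Omega> = Re (\<tau> (s - x))"
        by (simp add: cexp_Omega[OF xM(2)] inner_e trace_eq_cinner[OF xM(2)] inner_eq_Re_cinner[symmetric])
      also have "(norm T)\<^sup>2 * Re (\<tau> (s - x)) \<le> (norm T)\<^sup>2 * (c / ((norm T)\<^sup>2 + 1))"
        using x(2) by (intro mult_left_mono) auto
      also have "\<dots> < c" using n c by (simp add: field_simps)
      finally have 1: "inner (cexp (s - x) \<cdot> T \<cdot> \<Omega>) (T \<cdot> \<Omega>) < c" .
      have "0 \<le> inner ((t - cexp x) \<cdot> T \<cdot> \<Omega>) (T \<cdot> \<Omega>)"
        using t(2)[OF x(1)] by (simp add: op_le_def positive_op_iff)
      moreover have "t - cexp x = (t - cexp s) + cexp (s - x)"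
        by (simp add: cexp_diff D'(3) xM(1))
      ultimately show False using 1 by (simp add: c_def blinfun.add_left inner_add_left)
    qed
    then have "0 \<le> inner ((t - cexp s) \<cdot> \<xi>) \<xi>" for \<xi>
      by (rule commutant_dense_induct[OF subset_refl]) (assumption, intro closed_Collect_le continuous_intros)
    \<comment> \<open>A nonnegative real form does not imply self-adjointness, so the latter is read
      off from one member of \<open>D\<close> below both \<open>s\<close> and \<open>t\<close>, in
      the sense of its expectation for \<open>t\<close>.\<close>
    moreover have "radj (t - cexp s) = t - cexp s"
    proof -
      obtain x where x: "x \<in> D" using D'(1) by blast
      have xM: "x \<in> M" "s - x \<in> M" using x D' by (auto intro: M.diff_closed)
      have "positive_op (t - cexp x)" using t(2)[OF x] by (simp only: op_le_def)
      then have "radj (t - cexp x) = t - cexp x" by (simp only: positive_op_iff)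
      moreover have "positive_op (cexp (s - x))"
        by (rule cexp_positive[OF xM(2)]) (use up[OF x] in \<open>simp add: op_le_def\<close>)
      then have "radj (cexp (s - x)) = cexp (s - x)" by (simp only: positive_op_iff)
      moreover have "t - cexp s = (t - cexp x) - cexp (s - x)"
        by (simp add: cexp_diff D'(3) xM(1))
      ultimately show ?thesis by (simp only: radj_diff)
    qed
    moreover have "t - cexp s \<in> BH" by (intro B.in_BH B.diff_closed t cexp_in D')
    ultimately show ?thesis by (simp add: op_le_def positive_op_iff)
  qed
  show ?thesis unfolding bounded_directed_sup_def
  proof (intro conjI ballI impI)
    show "cexp ` D \<noteq> {}" "cexp ` D \<subseteq> B" "cexp s \<in> B" using D' cexp_in by auto
    fix x assume x: "x \<in> cexp ` D"
    then obtain x' where x': "x' \<in> D" "x' \<in> M" "x = cexp x'" using D'(2) by blast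
    show "positive_op x" using cexp_positive[OF x'(2) pos[OF x'(1)]] x'(3) by simp
    show "op_le x (cexp s)" using mono[OF x'(2) D'(3) up[OF x'(1)]] x'(3) by simp
    fix y assume y: "y \<in> cexp ` D"
    then obtain y' where y': "y' \<in> D" "y' \<in> M" "y = cexp y'" using D'(2) by blast
    obtain z where z: "z \<in> D" "op_le x' z" "op_le y' z" using dir[OF x'(1) y'(1)] by blast
    then show "\<exists>z\<in>cexp ` D. op_le x z \<and> op_le y z"
      using mono[of x' z] mono[of y' z] x' y' D'(2) by blast
  next
    fix t assume "t \<in> B" "\<forall>x\<in>cexp ` D. op_le x t"
    then show "op_le (cexp s) t" using least by blast
  qed
qed

lemma is_cond_exp_cexp: "is_cond_exp M \<tau> B (restrict cexp M)"
  unfolding is_cond_exp_def linear_on_alg_def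
proof (intro conjI ballI allI impI)
  let ?E = "restrict cexp M"
  have E: "?E x = cexp x" if "x \<in> M" for x using that by simp
  fix x assume x: "x \<in> M"
  show "?E x \<in> B" "\<tau> (?E x) = \<tau> x" by (simp_all add: x cexp_in cexp_trace)
  show "?E (op_scale c x) = op_scale c (?E x)" for c
    by (simp only: E x M.op_scale_closed cexp_op_scale)
  show "positive_op (?E x)" if "positive_op x" using that by (simp add: x cexp_positive)
  show "x = 0" if "?E (adj x o\<^sub>L x) = 0"
  proof (rule cexp_faithful[OF x])
    have "radj x o\<^sub>L x \<in> M" by (intro M.compose_closed M.radj_closed x)
    then show "cexp (radj x o\<^sub>L x) = 0" using that by (simp only: M.adj_radj[OF x] E)
  qed
  show "?E (x + y) = ?E x + ?E y" if "y \<in> M" for y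
    using that by (simp only: E x M.add_closed cexp_add)
next
  fix b assume b: "b \<in> B"
  then show "restrict cexp M b = b" using cexp_fix BM by simp
next
  fix a b x assume "a \<in> B" "b \<in> B" "x \<in> M"
  then show "restrict cexp M (a o\<^sub>L x o\<^sub>L b) = a o\<^sub>L restrict cexp M x o\<^sub>L b"
    by (simp add: M.compose_closed BM cexp_bimodule)
next
  fix D s assume s: "bounded_directed_sup M D s"
  then have D: "D \<subseteq> M" "s \<in> M" by (auto simp: bounded_directed_sup_def)
  have "restrict cexp M ` D = cexp ` D" using D(1) by (intro image_cong) auto
  moreover have "restrict cexp M s = cexp s" using D(2) by simp
  ultimately show "bounded_directed_sup B (restrict cexp M ` D) (restrict cexp M s)"
    using cexp_normal[OF s] by (simp only:)
qed

text \<open>Uniqueness: the module property and preservation of the trace determine the inner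
  products of \<open>E y \<cdot> \<Omega>\<close> with all \<open>z \<cdot> \<Omega>\<close> for
  \<open>z\<close> in \<open>B\<close>, and these are the inner products of
  \<open>e \<cdot> y \<cdot> \<Omega>\<close>.\<close>

lemma cond_exp_eq: "x \<in> M \<Longrightarrow> cond_exp M \<tau> B x = cexp x"
proof -
  assume x: "x \<in> M"
  have "cond_exp M \<tau> B = restrict cexp M"
    unfolding cond_exp_def
  proof (rule the_equality)
    show "is_cond_exp M \<tau> B (restrict cexp M) \<and> restrict cexp M \<in> extensional M"
      using is_cond_exp_cexp by simp
    fix E assume E: "is_cond_exp M \<tau> B E \<and> E \<in> extensional M"
    have eq: "E y = cexp y" if y: "y \<in> M" for y
    proof (rule cexp_eqI[OF y, symmetric])
      show EB: "E y \<in> B" using E y by (auto simp: is_cond_exp_def)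
      show "E y \<cdot> \<Omega> = e \<cdot> y \<cdot> \<Omega>"
      proof (rule K_eqI)
        fix z assume z: "z \<in> B"
        have rz: "radj z \<in> B" "radj z \<in> M" using B.radj_closed z BM by auto
        have "inner (E y \<cdot> \<Omega>) (z \<cdot> \<Omega>) = Re (\<tau> (radj z o\<^sub>L E y))"
          by (rule inner_vec) (intro BM EB z)+
        also have "radj z o\<^sub>L E y = E (radj z o\<^sub>L y)"
        proof -
          have "E (radj z o\<^sub>L y o\<^sub>L id_blinfun) = radj z o\<^sub>L E y o\<^sub>L id_blinfun"
            using E rz(1) B.id_closed y unfolding is_cond_exp_def by blast
          then show ?thesis by simp
        qed
        also have "\<tau> \<dots> = \<tau> (radj z o\<^sub>L y)"
          using E M.compose_closed[OF rz(2) y] unfolding is_cond_exp_def by blast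
        also have "Re \<dots> = inner (y \<cdot> \<Omega>) (z \<cdot> \<Omega>)"
          by (rule inner_vec[symmetric]) (intro BM y z)+
        also have "\<dots> = inner (e \<cdot> y \<cdot> \<Omega>) (z \<cdot> \<Omega>)" by (simp add: inner_e e_fix vec_in_K z)
        finally show "inner (E y \<cdot> \<Omega>) (z \<cdot> \<Omega>) = inner (e \<cdot> y \<cdot> \<Omega>) (z \<cdot> \<Omega>)" .
      qed (use EB vec_in_K e_in in auto)
    qed
    show "E = restrict cexp M"
      by (rule extensionalityI[of _ M]) (use E eq in auto)
  qed
  then show ?thesis using x by simp
qed

lemma cond_exp_Omega: "x \<in> M \<Longrightarrow> cond_exp M \<tau> B x \<cdot> \<Omega> = e \<cdot> x \<cdot> \<Omega>"
  by (simp add: cond_exp_eq cexp_Omega)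

end

section \<open>Module embeddings and the trace on the commutant\<close>

lemma infsum_ennreal_SUP:
  fixes f :: "'a \<Rightarrow> ennreal"
  shows "infsum f A = (SUP F\<in>{F. finite F \<and> F \<subseteq> A}. sum f F)"
  by (rule nonneg_infsum_complete) simp

lemma finite_sum_le_infsum_ennreal:
  fixes f :: "'a \<Rightarrow> ennreal"
  assumes "finite F" "F \<subseteq> A"
  shows "sum f F \<le> infsum f A"
  unfolding infsum_ennreal_SUP by (rule SUP_upper) (use assms in auto)

lemma infsum_ennreal_leI:
  fixes f :: "'a \<Rightarrow> ennreal"
  assumes "\<And>F. finite F \<Longrightarrow> F \<subseteq> A \<Longrightarrow> sum f F \<le> c"
  shows "infsum f A \<le> c"
  unfolding infsum_ennreal_SUP by (rule SUP_least) (use assms in auto)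

text \<open>It is enough to exchange finite partial sums of the outer sum with the inner one; the
  reverse inequality is the same statement with the roles exchanged.\<close>

lemma infsum_swap_ennreal_le:
  fixes f :: "'a \<Rightarrow> 'b \<Rightarrow> ennreal"
  shows "(\<Sum>\<^sub>\<infinity>x\<in>A. \<Sum>\<^sub>\<infinity>y\<in>B. f x y) \<le> (\<Sum>\<^sub>\<infinity>y\<in>B. \<Sum>\<^sub>\<infinity>x\<in>A. f x y)"
proof (rule infsum_ennreal_leI)
  fix F assume F: "finite F" "F \<subseteq> A"
  have "(\<Sum>x\<in>F. \<Sum>\<^sub>\<infinity>y\<in>B. f x y) = (\<Sum>\<^sub>\<infinity>y\<in>B. \<Sum>x\<in>F. f x y)"
    using F(1)
  proof (induction F)
    case (insert x F)
    then show ?case by (simp add: infsum_add nonneg_summable_on_complete)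
  qed simp
  also have "\<dots> \<le> (\<Sum>\<^sub>\<infinity>y\<in>B. \<Sum>\<^sub>\<infinity>x\<in>A. f x y)"
    by (rule infsum_mono) (simp_all add: nonneg_summable_on_complete finite_sum_le_infsum_ennreal F)
  finally show "(\<Sum>x\<in>F. \<Sum>\<^sub>\<infinity>y\<in>B. f x y) \<le> (\<Sum>\<^sub>\<infinity>y\<in>B. \<Sum>\<^sub>\<infinity>x\<in>A. f x y)" .
qed

lemma infsum_swap_ennreal:
  fixes f :: "'a \<Rightarrow> 'b \<Rightarrow> ennreal"
  shows "(\<Sum>\<^sub>\<infinity>x\<in>A. \<Sum>\<^sub>\<infinity>y\<in>B. f x y) = (\<Sum>\<^sub>\<infinity>y\<in>B. \<Sum>\<^sub>\<infinity>x\<in>A. f x y)"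
  by (rule antisym) (rule infsum_swap_ennreal_le)+

lemma has_sum_ennreal:
  assumes "(f has_sum s) A" "\<And>x. x \<in> A \<Longrightarrow> 0 \<le> f x"
  shows "(\<Sum>\<^sub>\<infinity>x\<in>A. ennreal (f x)) = ennreal s"
proof -
  have "ennreal s = (SUP F\<in>{F. finite F \<and> F \<subseteq> A}. ennreal (sum f F))"
    using infsum_nonneg_is_SUPREMUM_ennreal[of f A] assms infsumI[OF assms(1)]
    by (simp add: has_sum_imp_summable)
  also have "\<dots> = (SUP F\<in>{F. finite F \<and> F \<subseteq> A}. (\<Sum>x\<in>F. ennreal (f x)))"
    using assms(2) by (intro SUP_cong) (auto simp: subset_iff)
  finally show ?thesis by (simp add: infsum_ennreal_SUP)
qed

text \<open>Zorn's lemma in the form used for maximal families of partial isometries with orthogonal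
  initial or final spaces. The maximality clause asks for \<open>R\<close> in both directions, since
  \<open>R\<close> may be asymmetric.\<close>

lemma ex_maximal_pairwise:
  "\<exists>V\<subseteq>P. (\<forall>x\<in>V. \<forall>y\<in>V. x \<noteq> y \<longrightarrow> R x y) \<and>
     (\<forall>x\<in>P. (\<forall>y\<in>V. R x y \<and> R y x) \<longrightarrow> x \<in> V)"
proof -
  define \<A> where "\<A> = {V. V \<subseteq> P \<and> (\<forall>x\<in>V. \<forall>y\<in>V. x \<noteq> y \<longrightarrow> R x y)}"
  have "\<Union>C \<in> \<A>" if C: "subset.chain \<A> C" for C
  proof -
    have sub: "C \<subseteq> \<A>" using C by (rule subset_chain_def[THEN iffD1, THEN conjunct1])
    have "R x y" if xy: "x \<in> \<Union>C" "y \<in> \<Union>C" "x \<noteq> y" for x y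
    proof -
      obtain X Y where XY: "X \<in> C" "Y \<in> C" "x \<in> X" "y \<in> Y" using xy by blast
      then have "X \<subseteq> Y \<or> Y \<subseteq> X" using C by (auto simp: subset_chain_def)
      then show ?thesis using XY sub xy(3) unfolding \<A>_def by blast
    qed
    then show ?thesis using sub by (auto simp: \<A>_def)
  qed
  from subset_Zorn'[OF this] obtain V where V: "V \<in> \<A>" "\<And>X. X \<in> \<A> \<Longrightarrow> V \<subseteq> X \<Longrightarrow> X = V" by blast
  have "x \<in> V" if x: "x \<in> P" "\<forall>y\<in>V. R x y \<and> R y x" for x
  proof -
    have "insert x V \<in> \<A>" using V(1) x by (auto simp: \<A>_def)
    then show ?thesis using V(2)[of "insert x V"] by blast
  qed
  then show ?thesis using V(1) by (auto simp: \<A>_def)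
qed

section \<open>Partial isometries and polar decomposition\<close>

text \<open>The domain of \<open>S\<close> is not dense in general, so the map is set to 0 on the
  orthogonal complement of the domain before it is extended. The result is a partial isometry; the
  last clauses describe what annihilates it and what commutes with it in terms of \<open>S\<close>
  alone.\<close>

lemma isometric_graph_extension:
  fixes S :: "('a::{real_inner,banach} \<times> 'a) set"
  assumes S: "subspace S" and iso: "\<And>a b. (a, b) \<in> S \<Longrightarrow> norm b = norm a"
  obtains W :: "'a \<Rightarrow>\<^sub>L 'a"
  where "\<And>a b. (a, b) \<in> S \<Longrightarrow> W \<cdot> a = b" "\<And>a b. (a, b) \<in> S \<Longrightarrow> radj W \<cdot> b = a"
    "\<And>\<nu>. (\<And>a b. (a, b) \<in> S \<Longrightarrow> inner a \<nu> = 0) \<Longrightarrow> W \<cdot> \<nu> = 0" "W o\<^sub>L radj W o\<^sub>L W = W"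
    "\<And>P :: 'a \<Rightarrow>\<^sub>L 'a. (\<And>a b. (a, b) \<in> S \<Longrightarrow> P \<cdot> b = 0) \<Longrightarrow> P o\<^sub>L W = 0"
    "\<And>T. (\<And>a b. (a, b) \<in> S \<Longrightarrow> (T \<cdot> a, T \<cdot> b) \<in> S \<and> (radj T \<cdot> a, radj T \<cdot> b) \<in> S) \<Longrightarrow>
      W o\<^sub>L T = T o\<^sub>L W"
proof -
  define N where "N = {\<nu>. \<forall>a b. (a, b) \<in> S \<longrightarrow> inner a \<nu> = 0}"
  have N: "inner a \<nu> = 0" if "(a, b) \<in> S" "\<nu> \<in> N" for a b \<nu> using that by (auto simp: N_def)
  have subN: "subspace N" by (auto simp: N_def subspace_def inner_add_right)
  define G where "G = (\<lambda>((a, b), \<nu>). (a + \<nu>, b)) ` (S \<times> N)"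
  have inner_eq: "inner b b' = inner a a'" if "(a, b) \<in> S" "(a', b') \<in> S" for a b a' b'
  proof -
    have "(norm (b + b'))\<^sup>2 = (norm (a + a'))\<^sup>2"
      using iso[of "a + a'" "b + b'"] subspace_add[OF S that] by simp
    moreover have "inner b b = inner a a" "inner b' b' = inner a' a'"
      using iso[OF that(1)] iso[OF that(2)] by (simp_all add: dot_square_norm)
    ultimately show ?thesis
      by (simp add: power2_norm_eq_inner inner_add_left inner_add_right inner_commute)
  qed
  have subG: "subspace G" unfolding G_def
    by (intro linear_subspace_image linearI subspace_Times S subN) (auto simp: scaleR_add_right)
  have boundG: "norm b \<le> 1 * norm x" if xb: "(x, b) \<in> G" for x b
  proof -
    obtain a \<nu> where x: "x = a + \<nu>" "(a, b) \<in> S" "\<nu> \<in> N" using xb by (auto simp: G_def)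
    have "inner x x = inner a a + inner \<nu> \<nu>"
      using N[OF x(2,3)] by (simp add: x(1) inner_add_left inner_add_right inner_commute)
    then have "inner b b \<le> inner x x" by (simp add: inner_eq[OF x(2) x(2)])
    then show ?thesis by (simp add: norm_eq_sqrt_inner)
  qed
  \<comment> \<open>Every \<open>x\<close> is its projection to the closed domain plus a vector of
    \<open>N\<close>, and the first summand is a limit of vectors of the domain.\<close>
  have denseG: "closure (fst ` G) = UNIV"
  proof -
    define L where "L = closure (fst ` S)"
    have "subspace (fst ` S)"
      by (intro linear_subspace_image S bounded_linear.linear bounded_linear_fst)
    then have L: "subspace L" "closed L" by (auto simp: L_def subspace_closure)
    have "x \<in> closure (fst ` G)" for x
    proof -
      define p where "p = proj L \<cdot> x"
      have "inner a (x - p) = 0" if "(a, b) \<in> S" for a b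
      proof -
        have "a \<in> L" unfolding L_def by (rule closure_subset[THEN subsetD]) (use that in force)
        then show ?thesis using proj_orth[OF L] by (simp add: p_def inner_commute)
      qed
      then have n: "x - p \<in> N" by (auto simp: N_def)
      have "p \<in> closure (fst ` S)" using proj_in[OF L] by (simp add: p_def L_def)
      then have "p + (x - p) \<in> closure (fst ` G)"
      proof (rule closure_induct_closed[where P = "\<lambda>a. a + (x - p) \<in> closure (fst ` G)"])
        fix a assume "a \<in> fst ` S"
        then obtain b where "(a, b) \<in> S" by auto
        then have "(a + (x - p), b) \<in> G" unfolding G_def using n by force
        then show "a + (x - p) \<in> closure (fst ` G)" using closure_subset by force
      next
        have "{a. a + (x - p) \<in> closure (fst ` G)} = (\<lambda>a. a + (x - p)) -` closure (fst ` G)" by auto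
        then show "closed {a. a + (x - p) \<in> closure (fst ` G)}"
          by (simp only:) (intro closed_vimage closed_closure continuous_intros)
      qed
      then show ?thesis by simp
    qed
    then show ?thesis by blast
  qed
  obtain W :: "'a \<Rightarrow>\<^sub>L 'a" where W0: "\<forall>(a, b)\<in>G. W \<cdot> a = b"
    using graph_extension[OF subG boundG denseG] by blast
  have W: "W \<cdot> (a + \<nu>) = b" if "(a, b) \<in> S" "\<nu> \<in> N" for a b \<nu>
    using W0 that by (force simp: G_def)
  have Wa: "W \<cdot> a = b" if "(a, b) \<in> S" for a b using W[OF that subspace_0[OF subN]] by simp
  have eqI: "T = T'" if "\<And>a b \<nu>. (a, b) \<in> S \<Longrightarrow> \<nu> \<in> N \<Longrightarrow> T \<cdot> (a + \<nu>) = T' \<cdot> (a + \<nu>)" for T T' :: "'a \<Rightarrow>\<^sub>L 'a"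
    by (rule blinfun_eq_on_dense[OF denseG]) (use that in \<open>auto simp: G_def\<close>)
  have Wstar: "radj W \<cdot> b = a" if ab: "(a, b) \<in> S" for a b
  proof (rule dense_inner_eqI[OF denseG])
    fix x assume "x \<in> fst ` G"
    then obtain a' b' \<nu> where x: "x = a' + \<nu>" "(a', b') \<in> S" "\<nu> \<in> N" by (auto simp: G_def)
    have "inner (radj W \<cdot> b) x = inner b b'" by (simp only: inner_radj' x(1) W[OF x(2,3)])
    also have "\<dots> = inner a x" using inner_eq[OF ab x(2)] N[OF ab x(3)] by (simp add: x(1) inner_add_right)
    finally show "inner (radj W \<cdot> b) x = inner a x" .
  qed
  show ?thesis
  proof (rule that[OF Wa Wstar])
    show "W \<cdot> \<nu> = 0" if "\<And>a b. (a, b) \<in> S \<Longrightarrow> inner a \<nu> = 0" for \<nu>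
    proof -
      have "(0, 0) \<in> S" using subspace_0[OF S] by (simp add: zero_prod_def)
      moreover have "\<nu> \<in> N" using that by (auto simp: N_def)
      ultimately show ?thesis using W[of 0 0 \<nu>] by simp
    qed
    show "W o\<^sub>L radj W o\<^sub>L W = W"
      by (rule eqI) (simp only: blinfun_apply_blinfun_compose W Wstar Wa)
    show "P o\<^sub>L W = 0" if "\<And>a b. (a, b) \<in> S \<Longrightarrow> P \<cdot> b = 0" for P :: "'a \<Rightarrow>\<^sub>L 'a"
      by (rule eqI) (simp only: blinfun_apply_blinfun_compose W that blinfun.zero_left)
    show "W o\<^sub>L T = T o\<^sub>L W"
      if T: "\<And>a b. (a, b) \<in> S \<Longrightarrow> (T \<cdot> a, T \<cdot> b) \<in> S \<and> (radj T \<cdot> a, radj T \<cdot> b) \<in> S" for T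
    proof (rule eqI)
      fix a b \<nu> assume ab: "(a, b) \<in> S" and n: "\<nu> \<in> N"
      have "inner a' (T \<cdot> \<nu>) = 0" if "(a', b') \<in> S" for a' b'
        using N[OF conjunct2[OF T[OF that]] n] by (simp add: inner_radj')
      then have Tn: "T \<cdot> \<nu> \<in> N" by (auto simp: N_def)
      have "W \<cdot> T \<cdot> (a + \<nu>) = W \<cdot> (T \<cdot> a + T \<cdot> \<nu>)" by (simp only: blinfun.add_right)
      also have "\<dots> = T \<cdot> b" using T[OF ab] Tn by (intro W) auto
      also have "\<dots> = T \<cdot> W \<cdot> (a + \<nu>)" by (simp only: W[OF ab n])
      finally show "(W o\<^sub>L T) \<cdot> (a + \<nu>) = (T o\<^sub>L W) \<cdot> (a + \<nu>)" by simp
    qed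
  qed
qed

lemma blinfun_compose_eqD: "A o\<^sub>L B = C o\<^sub>L D \<Longrightarrow> A \<cdot> B \<cdot> x = C \<cdot> D \<cdot> x"
  by (metis blinfun_apply_blinfun_compose)

context vna
begin

text \<open>An operator constructed canonically from \<open>\<X>\<close> commutes with whatever
  commutes with \<open>\<X>\<close> together with its adjoint. The commutant of \<open>A\<close>
  consists of such operators, and \<open>iop\<close> is another one, which gives complex
  linearity.\<close>

lemma commuting_closed:
  assumes X: "\<X> \<subseteq> A"
    and W: "\<And>T. (\<And>x. x \<in> \<X> \<Longrightarrow> T o\<^sub>L x = x o\<^sub>L T) \<Longrightarrow> (\<And>x. x \<in> \<X> \<Longrightarrow> radj T o\<^sub>L x = x o\<^sub>L radj T) \<Longrightarrow>
      W o\<^sub>L T = T o\<^sub>L W"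
  shows "W \<in> A"
proof (rule in_algebraI)
  have i: "iop o\<^sub>L x = x o\<^sub>L iop" if "x \<in> \<X>" for x using X that in_BH by (auto simp: BH_iff)
  then show "W \<in> BH" unfolding BH_iff by (intro W) (simp_all add: blinfun_compose_linear)
  fix T assume T: "T \<in> commutant A"
  show "W o\<^sub>L T = T o\<^sub>L W"
    by (rule W) (use X commutant_commutes[OF T] commutant_commutes[OF commutant_radj_closed[OF T]] in auto)
qed

text \<open>With \<open>r\<close> the absolute value of \<open>Y\<close>, the partial isometry sends
  \<open>r \<cdot> \<xi>\<close> to \<open>Y \<cdot> \<xi>\<close>. The clauses record its supports,
  since it serves to replace a nonzero operator between two projections by a partial isometry
  between them.\<close>

lemma polar_decomposition:
  assumes Y: "Y \<in> A"
  shows "\<exists>W\<in>A. W o\<^sub>L radj W o\<^sub>L W = W \<and> (\<forall>P :: 'h \<Rightarrow>\<^sub>L 'h. P o\<^sub>L Y = 0 \<longrightarrow> P o\<^sub>L W = 0) \<and>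
     (\<forall>Q :: 'h \<Rightarrow>\<^sub>L 'h. Y o\<^sub>L Q = 0 \<longrightarrow> W o\<^sub>L Q = 0) \<and> (W = 0 \<longrightarrow> Y = 0)"
proof -
  have "radj Y o\<^sub>L Y \<in> A" by (intro compose_closed radj_closed Y)
  moreover have "radj (radj Y o\<^sub>L Y) = radj Y o\<^sub>L Y" by simp
  moreover have "0 \<le> inner ((radj Y o\<^sub>L Y) \<cdot> \<xi>) \<xi>" for \<xi> by (simp add: inner_radj')
  ultimately obtain r where r: "r \<in> A" "r o\<^sub>L r = radj Y o\<^sub>L Y" "radj r = r"
    using sqrt_closed by blast
  have rs: "inner (r \<cdot> \<xi>) \<eta> = inner \<xi> (r \<cdot> \<eta>)" for \<xi> \<eta> using inner_radj[of r] r(3) by simp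
  have nr: "norm (Y \<cdot> \<xi>) = norm (r \<cdot> \<xi>)" for \<xi>
  proof -
    have "inner (r \<cdot> \<xi>) (r \<cdot> \<xi>) = inner \<xi> ((r o\<^sub>L r) \<cdot> \<xi>)" by (simp add: rs)
    then show ?thesis by (simp add: r(2) inner_radj[symmetric] norm_eq_sqrt_inner)
  qed
  define S where "S = range (\<lambda>\<xi>. (r \<cdot> \<xi>, Y \<cdot> \<xi>))"
  have "subspace S" unfolding S_def
    by (intro linear_subspace_image linearI subspace_UNIV) (simp_all add: blinfun.add_right blinfun.scaleR_right)
  moreover have "norm b = norm a" if "(a, b) \<in> S" for a b using that by (auto simp: S_def nr)
  ultimately obtain W :: "'h \<Rightarrow>\<^sub>L 'h" where W: "\<And>a b. (a, b) \<in> S \<Longrightarrow> W \<cdot> a = b"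
    "\<And>\<nu>. (\<And>a b. (a, b) \<in> S \<Longrightarrow> inner a \<nu> = 0) \<Longrightarrow> W \<cdot> \<nu> = 0" "W o\<^sub>L radj W o\<^sub>L W = W"
    and WP: "\<And>P :: 'h \<Rightarrow>\<^sub>L 'h. (\<And>a b. (a, b) \<in> S \<Longrightarrow> P \<cdot> b = 0) \<Longrightarrow> P o\<^sub>L W = 0"
    and WT: "\<And>T. (\<And>a b. (a, b) \<in> S \<Longrightarrow> (T \<cdot> a, T \<cdot> b) \<in> S \<and> (radj T \<cdot> a, radj T \<cdot> b) \<in> S) \<Longrightarrow>
      W o\<^sub>L T = T o\<^sub>L W"
    by (rule isometric_graph_extension[of S]) (assumption+, (rule that; blast))
  have SI: "(r \<cdot> \<xi>, Y \<cdot> \<xi>) \<in> S" for \<xi> by (simp add: S_def)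
  have "W \<in> A"
  proof (rule commuting_closed[of "{r, Y}"])
    fix T assume T: "\<And>x. x \<in> {r, Y} \<Longrightarrow> T o\<^sub>L x = x o\<^sub>L T" "\<And>x. x \<in> {r, Y} \<Longrightarrow> radj T o\<^sub>L x = x o\<^sub>L radj T"
    have TS: "(V \<cdot> a, V \<cdot> b) \<in> S" if "\<And>x. x \<in> {r, Y} \<Longrightarrow> V o\<^sub>L x = x o\<^sub>L V" "(a, b) \<in> S" for V a b
      using that(2) SI blinfun_compose_eqD[OF that(1)[of r]] blinfun_compose_eqD[OF that(1)[of Y]]
      by (auto simp: S_def)
    show "W o\<^sub>L T = T o\<^sub>L W" by (rule WT) (use TS[OF T(1)] TS[OF T(2)] in blast)
  qed (use r Y in auto)
  moreover have "P o\<^sub>L W = 0" if "P o\<^sub>L Y = 0" for P :: "'h \<Rightarrow>\<^sub>L 'h"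
    by (rule WP) (use arg_cong[OF that, of blinfun_apply] in \<open>auto simp: S_def fun_eq_iff\<close>)
  moreover have "W o\<^sub>L Q = 0" if "Y o\<^sub>L Q = 0" for Q :: "'h \<Rightarrow>\<^sub>L 'h"
  proof (rule blinfun_eqI)
    fix \<xi>
    have "Y \<cdot> Q \<cdot> \<xi> = 0" using arg_cong[OF that, of "\<lambda>T. T \<cdot> \<xi>"] by simp
    then have "r \<cdot> Q \<cdot> \<xi> = 0" using nr[of "Q \<cdot> \<xi>"] by simp
    then have "W \<cdot> Q \<cdot> \<xi> = 0" by (intro W(2)) (auto simp: S_def rs)
    then show "(W o\<^sub>L Q) \<cdot> \<xi> = 0 \<cdot> \<xi>" by simp
  qed
  moreover have "Y = 0" if "W = 0"
    by (rule blinfun_eqI) (use W(1)[OF SI] that in simp)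
  ultimately show ?thesis using W(3) by blast
qed

end

section \<open>Module embeddings and the trace that they define\<close>

context tracial_sub
begin

lemma module_embedding_iff:
  "module_embedding \<Omega> B I V \<longleftrightarrow>
     (\<forall>i\<in>I. V i \<in> commutant B \<and> e o\<^sub>L V i = V i) \<and>
     (\<forall>\<xi>. ((\<lambda>i. (norm (V i \<cdot> \<xi>))\<^sup>2) has_sum (norm \<xi>)\<^sup>2) I)"
proof -
  have "range (blinfun_apply T) \<subseteq> L2 \<Omega> B \<longleftrightarrow> e o\<^sub>L T = T" for T :: "'h \<Rightarrow>\<^sub>L 'h"
  proof
    assume "range (blinfun_apply T) \<subseteq> L2 \<Omega> B"
    then show "e o\<^sub>L T = T" by (intro blinfun_eqI) (auto simp: e_fix_iff K_def)
  next
    assume "e o\<^sub>L T = T"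
    then have "e \<cdot> T \<cdot> \<xi> = T \<cdot> \<xi>" for \<xi> by (metis blinfun_apply_blinfun_compose)
    then show "range (blinfun_apply T) \<subseteq> L2 \<Omega> B" by (auto simp: e_fix_iff K_def[symmetric])
  qed
  then show ?thesis by (auto simp: module_embedding_def)
qed

text \<open>The operators \<open>radj V o\<^sub>L V\<close> are pairwise orthogonal projections, and
  \<open>y F\<close> is the projection of \<open>\<xi>\<close> to finitely many of the initial
  spaces. Pythagoras bounds the partial sums, and totality of the initial spaces gives the
  limit.\<close>

lemma partial_isometries_has_sum:
  fixes \<V> :: "('h \<Rightarrow>\<^sub>L 'h) set"
  assumes VV: "\<And>V. V \<in> \<V> \<Longrightarrow> V o\<^sub>L radj V o\<^sub>L V = V"
    and orth: "\<And>U V. U \<in> \<V> \<Longrightarrow> V \<in> \<V> \<Longrightarrow> U \<noteq> V \<Longrightarrow> U o\<^sub>L radj V = 0"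
    and total: "closure (span (\<Union>V\<in>\<V>. range (blinfun_apply (radj V)))) = (UNIV :: 'h set)"
  shows "((\<lambda>V. (norm (blinfun_apply V \<xi>))\<^sup>2) has_sum (norm \<xi>)\<^sup>2) \<V>"
proof -
  define y where "y F = (\<Sum>V\<in>F. radj V \<cdot> V \<cdot> \<xi>)" for F
  have Vy: "U \<cdot> y F = U \<cdot> \<xi>" if "finite F" "F \<subseteq> \<V>" "U \<in> F" for U F
  proof -
    have "U \<cdot> radj V \<cdot> V \<cdot> \<xi> = (if V = U then U \<cdot> \<xi> else 0)" if "V \<in> F" for V
      using VV[of U] orth[of U V] that \<open>F \<subseteq> \<V>\<close> \<open>U \<in> F\<close>
      by (metis blinfun.zero_left blinfun_apply_blinfun_compose subsetD)
    then show ?thesis using that by (simp add: y_def blinfun.sum_right)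
  qed
  have iy: "inner (\<xi> - y F) (radj V \<cdot> \<eta>) = 0" if "finite F" "F \<subseteq> \<V>" "V \<in> F" for V \<eta> F
    using Vy[OF that] by (simp add: inner_radj[symmetric] blinfun.diff_right)
  have ny: "(norm \<xi>)\<^sup>2 = (norm (\<xi> - y F))\<^sup>2 + (\<Sum>V\<in>F. (norm (V \<cdot> \<xi>))\<^sup>2)" if F: "finite F" "F \<subseteq> \<V>" for F
  proof -
    have 0: "inner (\<xi> - y F) (y F) = 0"
      unfolding y_def[of F] inner_sum_right by (intro sum.neutral ballI) (fold y_def, rule iy[OF F])
    then have "(norm \<xi>)\<^sup>2 = (norm (\<xi> - y F))\<^sup>2 + inner \<xi> (y F)"
      by (simp add: power2_norm_eq_inner inner_diff_left inner_diff_right inner_commute)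
    also have "inner \<xi> (y F) = (\<Sum>V\<in>F. (norm (V \<cdot> \<xi>))\<^sup>2)"
      by (simp add: y_def inner_sum_right inner_radj[symmetric] power2_norm_eq_inner)
    finally show ?thesis .
  qed
  define S where "S F = (\<Sum>V\<in>F. (norm (blinfun_apply V \<xi>))\<^sup>2)" for F :: "('h \<Rightarrow>\<^sub>L 'h) set"
  have le: "S F \<le> (norm \<xi>)\<^sup>2" if "finite F" "F \<subseteq> \<V>" for F
    using ny[OF that] zero_le_power2[of "norm (\<xi> - y F)"] unfolding S_def by linarith
  have "\<exists>F. finite F \<and> F \<subseteq> \<V> \<and> (norm \<xi>)\<^sup>2 - \<epsilon> < S F" if eps: "\<epsilon> > 0" for \<epsilon>
  proof -
    have "\<xi> \<in> closure (span (\<Union>V\<in>\<V>. range (blinfun_apply (radj V))))" using total by simp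
    then obtain u where u: "u \<in> span (\<Union>V\<in>\<V>. range (blinfun_apply (radj V)))" "dist u \<xi> < sqrt \<epsilon>"
      unfolding closure_approachable using eps by (meson real_sqrt_gt_zero)
    \<comment> \<open>The vector \<open>u\<close> involves only finitely many members of the family,
      so \<open>y F\<close> approximates \<open>\<xi>\<close> at least as well as \<open>u\<close>
      does.\<close>
    have "\<exists>F. finite F \<and> F \<subseteq> \<V> \<and> (\<forall>z. (\<forall>V\<in>F. \<forall>\<eta>. inner z (radj V \<cdot> \<eta>) = 0) \<longrightarrow> inner z u = 0)"
      using u(1)
    proof (induction rule: span_induct_alt)
      case base
      show ?case by (rule exI[of _ "{}"]) simp
    next
      case (step c x v)
      obtain F where F: "finite F" "F \<subseteq> \<V>" "\<forall>z. (\<forall>V\<in>F. \<forall>\<eta>. inner z (radj V \<cdot> \<eta>) = 0) \<longrightarrow> inner z v = 0"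
        using step.IH by blast
      obtain V \<eta> where V: "V \<in> \<V>" "x = radj V \<cdot> \<eta>" using step.hyps by auto
      show ?case
        by (rule exI[of _ "insert V F"]) (use F V in \<open>auto simp: inner_add_right\<close>)
    qed
    then obtain F where F: "finite F" "F \<subseteq> \<V>"
      "\<And>z. (\<And>V \<eta>. V \<in> F \<Longrightarrow> inner z (radj V \<cdot> \<eta>) = 0) \<Longrightarrow> inner z u = 0" by metis
    have o1: "inner (\<xi> - y F) u = 0" by (rule F(3)) (rule iy[OF F(1,2)])
    have o2: "inner (\<xi> - y F) (y F) = 0"
      unfolding y_def[of F] inner_sum_right by (intro sum.neutral ballI) (fold y_def, rule iy[OF F(1,2)])
    have "(norm (\<xi> - y F))\<^sup>2 = inner (\<xi> - y F) (\<xi> - u)"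
      using o1 o2 by (simp add: power2_norm_eq_inner inner_diff_right)
    also have "\<dots> \<le> norm (\<xi> - y F) * norm (\<xi> - u)" by (rule norm_cauchy_schwarz)
    finally have "norm (\<xi> - y F) \<le> norm (\<xi> - u)"
      by (cases "\<xi> - y F = 0") (auto simp: power2_eq_square)
    also have "\<dots> < sqrt \<epsilon>" using u(2) by (simp add: dist_norm norm_minus_commute)
    finally have "(norm (\<xi> - y F))\<^sup>2 < (sqrt \<epsilon>)\<^sup>2" by (intro power_strict_mono) auto
    then have "(norm (\<xi> - y F))\<^sup>2 < \<epsilon>" using eps by simp
    then have "(norm \<xi>)\<^sup>2 - \<epsilon> < S F" using ny[OF F(1,2)] unfolding S_def by linarith
    then show ?thesis using F(1,2) by blast
  qed
  note close = this
  have "(S \<longlongrightarrow> (norm \<xi>)\<^sup>2) (finite_subsets_at_top \<V>)"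
  proof (rule increasing_tendsto)
    show "\<forall>\<^sub>F F in finite_subsets_at_top \<V>. S F \<le> (norm \<xi>)\<^sup>2"
      by (intro eventually_finite_subsets_at_top_weakI le)
    fix a assume "a < (norm \<xi>)\<^sup>2"
    then obtain F where F: "finite F" "F \<subseteq> \<V>" "a < S F" using close[of "(norm \<xi>)\<^sup>2 - a"] by auto
    show "\<forall>\<^sub>F F in finite_subsets_at_top \<V>. a < S F"
      unfolding eventually_finite_subsets_at_top
    proof (intro exI[of _ F] conjI allI impI F)
      fix F' assume "finite F' \<and> F \<subseteq> F' \<and> F' \<subseteq> \<V>"
      then have "S F \<le> S F'" unfolding S_def by (intro sum_mono2) auto
      then show "a < S F'" using F(3) by simp
    qed
  qed
  then show ?thesis unfolding has_sum_def S_def .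
qed

text \<open>Take a maximal family of nonzero partial isometries in the commutant with final spaces
  in \<open>K\<close> and pairwise orthogonal initial spaces. If the initial spaces did not fill the
  space, the polar part of a nonzero operator from their complement into \<open>K\<close> could be
  added.\<close>

lemma module_embedding_exists: "\<exists>I V. module_embedding \<Omega> B I V"
proof -
  define P where "P = {V \<in> commutant B. e o\<^sub>L V = V \<and> V o\<^sub>L radj V o\<^sub>L V = V \<and> V \<noteq> 0}"
  obtain \<V> where \<V>: "\<V> \<subseteq> P" "\<And>U V. U \<in> \<V> \<Longrightarrow> V \<in> \<V> \<Longrightarrow> U \<noteq> V \<Longrightarrow> U o\<^sub>L radj V = 0"
     "\<And>U. U \<in> P \<Longrightarrow> (\<And>V. V \<in> \<V> \<Longrightarrow> U o\<^sub>L radj V = 0 \<and> V o\<^sub>L radj U = 0) \<Longrightarrow> U \<in> \<V>"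
    using ex_maximal_pairwise[of P "\<lambda>U V. U o\<^sub>L radj V = 0"] by metis
  have P: "V \<in> commutant B" "e o\<^sub>L V = V" "V o\<^sub>L radj V o\<^sub>L V = V" "V \<noteq> 0" if "V \<in> \<V>" for V
    using that \<V>(1) by (auto simp: P_def)
  define L where "L = closure (span (\<Union>V\<in>\<V>. range (blinfun_apply (radj V))))"
  have L: "subspace L" "closed L" by (auto simp: L_def subspace_closure)
  have VL: "radj V \<cdot> \<eta> \<in> L" if "V \<in> \<V>" for V \<eta>
    unfolding L_def by (rule closure_subset[THEN subsetD], rule span_base) (use that in blast)
  interpret B': vna "commutant B" by standard (rule B.commutant_vna)
  have "L = UNIV"
  proof (rule ccontr)
    assume "L \<noteq> UNIV"
    define s where "s = id_blinfun - proj L"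
    have inv: "b \<cdot> \<xi> \<in> L" if b: "b \<in> B" and \<xi>: "\<xi> \<in> L" for b \<xi>
    proof -
      define X where "X = span (\<Union>V\<in>\<V>. range (blinfun_apply (radj V)))"
      have "b \<cdot> x \<in> X" if "x \<in> X" for x
        using that unfolding X_def
      proof (induction rule: span_induct_alt)
        case (step c x y)
        obtain V \<eta> where V: "V \<in> \<V>" "x = radj V \<cdot> \<eta>" using step.hyps by auto
        have "b \<cdot> x = radj V \<cdot> b \<cdot> \<eta>" unfolding V(2)
          by (rule B.commutant_commutes_apply[OF B.commutant_radj_closed[OF P(1)[OF V(1)]] b, symmetric])
        then have "b \<cdot> x \<in> span (\<Union>V\<in>\<V>. range (blinfun_apply (radj V)))"
          using V(1) by (intro span_base) auto
        then show ?case using step.IH by (simp add: blinfun.add_right blinfun.scaleR_right span_add span_scale)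
      qed (simp add: span_zero)
      then have "X \<subseteq> blinfun_apply b -` L" using closure_subset by (auto simp: L_def X_def[symmetric])
      moreover have "closed (blinfun_apply b -` L)"
        by (rule closed_vimage) (auto intro: L linear_continuous_on blinfun.bounded_linear_right)
      ultimately have "closure X \<subseteq> blinfun_apply b -` L" by (rule closure_minimal)
      then show ?thesis using \<xi> by (auto simp: L_def X_def)
    qed
    have pc: "proj L o\<^sub>L b = b o\<^sub>L proj L" if "b \<in> B" for b
      by (rule proj_commute[OF L]) (auto intro: inv that B.radj_closed)
    have "proj L \<in> BH" unfolding BH_iff by (rule pc) (rule B.iop_closed)
    then have "proj L \<in> commutant B" using pc by (simp add: commutant_iff)
    then have s: "s \<in> commutant B" unfolding s_def by (intro commutant_diff commutant_id)
    obtain \<xi> where \<xi>: "\<xi> \<notin> L" using \<open>L \<noteq> UNIV\<close> by blast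
    then have "s \<cdot> \<xi> \<noteq> 0" using proj_in[OF L, of \<xi>] by (auto simp: s_def blinfun.diff_left)
    \<comment> \<open>Otherwise \<open>s \<cdot> \<xi>\<close> would be orthogonal to all right
      translates of \<open>\<Omega>\<close>, which are dense.\<close>
    have "\<exists>m\<in>M. e o\<^sub>L cj m o\<^sub>L s \<noteq> 0"
    proof (rule ccontr)
      assume "\<not> (\<exists>m\<in>M. e o\<^sub>L cj m o\<^sub>L s \<noteq> 0)"
      then have z: "e o\<^sub>L cj m o\<^sub>L s = 0" if "m \<in> M" for m using that by blast
      have "s \<cdot> \<xi> = 0"
      proof (rule dense_inner_eqI[OF dense])
        fix v assume "v \<in> (\<lambda>x. x \<cdot> \<Omega>) ` M"
        then obtain m where m: "m \<in> M" "v = m \<cdot> \<Omega>" by blast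
        have "inner (s \<cdot> \<xi>) v = inner (s \<cdot> \<xi>) (cj (radj m) \<cdot> e \<cdot> \<Omega>)"
          using cj_radj_Omega[OF m(1)] m(2) by simp
        also have "\<dots> = inner (e \<cdot> cj m \<cdot> s \<cdot> \<xi>) \<Omega>" by (simp only: inner_radj radj_cj radj_e)
        also have "e \<cdot> cj m \<cdot> s \<cdot> \<xi> = (e o\<^sub>L cj m o\<^sub>L s) \<cdot> \<xi>" by (simp only: blinfun_apply_blinfun_compose)
        finally show "inner (s \<cdot> \<xi>) v = inner 0 v" by (simp only: z[OF m(1)] blinfun.zero_left inner_zero_left)
      qed
      then show False using \<open>s \<cdot> \<xi> \<noteq> 0\<close> by simp
    qed
    then obtain m where m: "m \<in> M" "e o\<^sub>L cj m o\<^sub>L s \<noteq> 0" by blast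
    define Y where "Y = e o\<^sub>L cj m o\<^sub>L s"
    have "Y \<in> commutant B" unfolding Y_def
      by (intro commutant_compose e_commutant s commutant_M_B cj_in_commutant m)
    from B'.polar_decomposition[OF this] obtain W where W: "W \<in> commutant B" "W o\<^sub>L radj W o\<^sub>L W = W"
      and W0: "\<forall>P :: 'h \<Rightarrow>\<^sub>L 'h. P o\<^sub>L Y = 0 \<longrightarrow> P o\<^sub>L W = 0"
        "\<forall>Q :: 'h \<Rightarrow>\<^sub>L 'h. Y o\<^sub>L Q = 0 \<longrightarrow> W o\<^sub>L Q = 0" "W = 0 \<longrightarrow> Y = 0"
      by blast
    have Wne: "W \<noteq> 0" using W0(3) m(2) by (auto simp: Y_def)
    have "(id_blinfun - e) o\<^sub>L W = 0"
      by (rule W0(1)[rule_format]) (simp add: Y_def blinfun_compose_linear blinfun_compose_assoc[symmetric])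
    then have eW: "e o\<^sub>L W = W" by (simp add: blinfun_compose_linear)
    have orth: "W o\<^sub>L radj V = 0" if "V \<in> \<V>" for V
    proof (rule W0(2)[rule_format])
      have "s o\<^sub>L radj V = 0"
        by (rule blinfun_eqI) (simp add: s_def blinfun.diff_left proj_fix[OF L VL[OF that]])
      then show "Y o\<^sub>L radj V = 0" by (simp add: Y_def blinfun_compose_assoc)
    qed
    have "V o\<^sub>L radj W = 0" if "V \<in> \<V>" for V
      using arg_cong[OF orth[OF that], of radj] by simp
    \<comment> \<open>Maximality puts \<open>W\<close> into the family, although it is orthogonal to
      every member, so it would be orthogonal to itself.\<close>
    then have "W \<in> \<V>" using orth W Wne eW by (intro \<V>(3)) (auto simp: P_def)
    then have "W o\<^sub>L radj W = 0" by (rule orth)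
    then show False using W(2) Wne by simp
  qed
  then have sum: "((\<lambda>V. (norm (V \<cdot> \<xi>))\<^sup>2) has_sum (norm \<xi>)\<^sup>2) \<V>" for \<xi>
    by (intro partial_isometries_has_sum P \<V>(2)) (simp_all add: L_def)
  text \<open>A module embedding is indexed by vectors; an operator \<open>V\<close> of the family is determined by \<open>V\<^sup>* \<Omega>\<close>.\<close>
  define f where "f V = radj V \<cdot> \<Omega>" for V :: "'h \<Rightarrow>\<^sub>L 'h"
  have inj: "inj_on f \<V>"
  proof (rule inj_onI)
    fix U V assume UV: "U \<in> \<V>" "V \<in> \<V>" "f U = f V"
    have eqB: "radj U \<cdot> b \<cdot> \<Omega> = radj V \<cdot> b \<cdot> \<Omega>" if "b \<in> B" for b
      using UV B.commutant_commutes_apply[OF B.commutant_radj_closed[OF P(1)] that] by (simp add: f_def)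
    have "radj U \<cdot> \<xi> = radj V \<cdot> \<xi>" if "\<xi> \<in> K" for \<xi>
      by (rule eq_on_K[OF eqB that])
    then have "(radj U - radj V) o\<^sub>L e = 0" by (intro blinfun_eqI) (simp add: e_in blinfun.diff_left)
    then have "radj ((radj U - radj V) o\<^sub>L e) = radj 0" by simp
    then show "U = V" using UV P(2) by (simp add: blinfun_compose_linear)
  qed
  have "module_embedding \<Omega> B (f ` \<V>) (inv_into \<V> f)"
    unfolding module_embedding_iff
  proof (intro conjI ballI allI)
    fix i assume "i \<in> f ` \<V>"
    then have "inv_into \<V> f i \<in> \<V>" by (rule inv_into_into)
    then show "inv_into \<V> f i \<in> commutant B" "e o\<^sub>L inv_into \<V> f i = inv_into \<V> f i" using P by auto
  next
    fix \<xi>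
    have "((\<lambda>V. (norm (inv_into \<V> f (f V) \<cdot> \<xi>))\<^sup>2) has_sum (norm \<xi>)\<^sup>2) \<V>"
      using sum by (rule has_sum_cong[THEN iffD1, rotated]) (simp add: inj)
    then show "((\<lambda>i. (norm (inv_into \<V> f i \<cdot> \<xi>))\<^sup>2) has_sum (norm \<xi>)\<^sup>2) (f ` \<V>)"
      by (subst has_sum_reindex[OF inj]) (simp add: o_def)
  qed
  then show ?thesis by blast
qed

text \<open>The squared Hilbert-Schmidt norm, i.e. the trace of \<open>X\<^sup>*X\<close>, for the trace on the commutant of \<open>B\<close>
  that takes the value 1 at the projection onto \<open>L\<^sup>2(B)\<close>.\<close>

definition hs :: "'h set \<Rightarrow> ('h \<Rightarrow> ('h \<Rightarrow>\<^sub>L 'h)) \<Rightarrow> ('h \<Rightarrow>\<^sub>L 'h) \<Rightarrow> ennreal" where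
  "hs I V X = (\<Sum>\<^sub>\<infinity>i\<in>I. ennreal ((norm (X \<cdot> radj (V i) \<cdot> \<Omega>))\<^sup>2))"

context
  fixes I V
  assumes emb: "module_embedding \<Omega> B I V"
begin

lemma emb_commutant: "i \<in> I \<Longrightarrow> V i \<in> commutant B"
  and emb_radj_commutant: "i \<in> I \<Longrightarrow> radj (V i) \<in> commutant B"
  using emb B.commutant_radj_closed by (auto simp: module_embedding_iff)

lemma emb_e: "i \<in> I \<Longrightarrow> e o\<^sub>L V i = V i"
  using emb by (auto simp: module_embedding_iff)

lemma emb_in_K: "i \<in> I \<Longrightarrow> V i \<cdot> \<xi> \<in> K"
  using emb_e e_in by (metis blinfun_apply_blinfun_compose)

lemma emb_radj_e: "i \<in> I \<Longrightarrow> radj (V i) o\<^sub>L e = radj (V i)"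
  using arg_cong[OF emb_e, of i radj] by simp

lemma emb_radj_e_apply: "i \<in> I \<Longrightarrow> radj (V i) \<cdot> e \<cdot> \<xi> = radj (V i) \<cdot> \<xi>"
  using emb_radj_e by (metis blinfun_apply_blinfun_compose)

lemma emb_parseval: "(\<Sum>\<^sub>\<infinity>i\<in>I. ennreal ((norm (V i \<cdot> \<xi>))\<^sup>2)) = ennreal ((norm \<xi>)\<^sup>2)"
  using emb by (intro has_sum_ennreal) (auto simp: module_embedding_iff)

lemma emb_zeroI:
  assumes "\<And>i. i \<in> I \<Longrightarrow> V i \<cdot> \<xi> = 0"
  shows "\<xi> = 0"
proof -
  have "(\<Sum>\<^sub>\<infinity>i\<in>I. ennreal ((norm (V i \<cdot> \<xi>))\<^sup>2)) = 0"
    by (rule infsum_0) (simp add: assms)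
  then show ?thesis by (simp add: emb_parseval)
qed

text \<open>The trace property \<open>norm_radj_Omega\<close> turns each term into the squared norm
  of \<open>V i \<cdot> radj X \<cdot> \<Omega>\<close>, and Parseval adds these up. With the
  identity for \<open>X\<close> it says that \<open>e\<close> has trace 1.\<close>

lemma hs_proj:
  assumes X: "X \<in> commutant B"
  shows "hs I V (e o\<^sub>L X) = ennreal ((norm (radj X \<cdot> \<Omega>))\<^sup>2)"
proof -
  have "norm ((e o\<^sub>L X) \<cdot> radj (V i) \<cdot> \<Omega>) = norm (V i \<cdot> radj X \<cdot> \<Omega>)" if i: "i \<in> I" for i
  proof -
    define T where "T = e o\<^sub>L X o\<^sub>L radj (V i)"
    have "norm (radj T \<cdot> \<Omega>) = norm (T \<cdot> \<Omega>)"
    proof (rule norm_radj_Omega)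
      show "T \<in> commutant B" unfolding T_def
        by (intro commutant_compose e_commutant X emb_radj_commutant i)
    qed (simp_all add: T_def e_in emb_in_K[OF i])
    then show ?thesis by (simp add: T_def)
  qed
  then have "hs I V (e o\<^sub>L X) = (\<Sum>\<^sub>\<infinity>i\<in>I. ennreal ((norm (V i \<cdot> radj X \<cdot> \<Omega>))\<^sup>2))"
    unfolding hs_def by (intro infsum_cong) simp
  then show ?thesis by (simp add: emb_parseval)
qed

text \<open>Faithfulness of the trace: \<open>X o\<^sub>L radj (V i)\<close> vanishes at
  \<open>\<Omega>\<close>, hence on \<open>K\<close> because it commutes with \<open>B\<close>,
  hence everywhere because \<open>radj (V i)\<close> factors through \<open>e\<close>. The operators
  \<open>V i\<close> together separate vectors.\<close>

lemma hs_eq_0D: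
  assumes X: "X \<in> commutant B" and z: "hs I V X = 0"
  shows "X = 0"
proof -
  have XV: "X o\<^sub>L radj (V i) = 0" if i: "i \<in> I" for i
  proof -
    have "ennreal ((norm (X \<cdot> radj (V i) \<cdot> \<Omega>))\<^sup>2) \<le> hs I V X"
      unfolding hs_def using finite_sum_le_infsum_ennreal[of "{i}" I] i by simp
    then have 0: "X \<cdot> radj (V i) \<cdot> \<Omega> = 0" using z by (simp add: ennreal_eq_0_iff)
    have c: "X o\<^sub>L radj (V i) \<in> commutant B" by (intro commutant_compose X emb_radj_commutant i)
    have b: "(X o\<^sub>L radj (V i)) \<cdot> b \<cdot> \<Omega> = 0" if "b \<in> B" for b
      using B.commutant_commutes_apply[OF c that, of \<Omega>] 0 by simp
    have "(X o\<^sub>L radj (V i)) \<cdot> e \<cdot> \<xi> = 0 \<cdot> e \<cdot> \<xi>" for \<xi>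
      by (rule eq_on_K[OF _ e_in]) (simp only: b blinfun.zero_left)
    then show ?thesis by (intro blinfun_eqI) (simp add: emb_radj_e_apply[OF i])
  qed
  have VX: "V i o\<^sub>L radj X = 0" if "i \<in> I" for i
    using arg_cong[OF XV[OF that], of radj] by simp
  have "radj X \<cdot> \<xi> = 0" for \<xi>
  proof (rule emb_zeroI)
    show "V i \<cdot> radj X \<cdot> \<xi> = 0" if "i \<in> I" for i
      using arg_cong[OF VX[OF that], of "\<lambda>T. T \<cdot> \<xi>"] by simp
  qed
  then have "radj X = 0" by (intro blinfun_eqI) simp
  then show ?thesis using radj_radj[of X] by simp
qed

end

text \<open>Parseval for \<open>W\<close> expands the sum into entries
  \<open>W j o\<^sub>L X o\<^sub>L radj (V i)\<close>; each is replaced by its adjoint through the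
  trace property on \<open>K\<close>, and Parseval for \<open>V\<close> collects them again. This
  gives both the trace property and, with two embeddings, independence of the embedding.\<close>

lemma hs_radj:
  assumes V: "module_embedding \<Omega> B I V" and W: "module_embedding \<Omega> B I' W" and X: "X \<in> commutant B"
  shows "hs I V X = hs I' W (radj X)"
proof -
  have "hs I V X = (\<Sum>\<^sub>\<infinity>i\<in>I. \<Sum>\<^sub>\<infinity>j\<in>I'. ennreal ((norm (W j \<cdot> X \<cdot> radj (V i) \<cdot> \<Omega>))\<^sup>2))"
    unfolding hs_def by (simp only: emb_parseval[OF W])
  also have "\<dots> = (\<Sum>\<^sub>\<infinity>i\<in>I. \<Sum>\<^sub>\<infinity>j\<in>I'. ennreal ((norm (V i \<cdot> radj X \<cdot> radj (W j) \<cdot> \<Omega>))\<^sup>2))"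
  proof (intro infsum_cong)
    fix i j assume i: "i \<in> I" and j: "j \<in> I'"
    define T where "T = W j o\<^sub>L X o\<^sub>L radj (V i)"
    have "norm (radj T \<cdot> \<Omega>) = norm (T \<cdot> \<Omega>)"
    proof (rule norm_radj_Omega)
      show "T \<in> commutant B" unfolding T_def
        by (intro commutant_compose X emb_radj_commutant[OF V i] emb_commutant[OF W j])
    qed (simp_all add: T_def emb_in_K[OF V i] emb_in_K[OF W j])
    then show "ennreal ((norm (W j \<cdot> X \<cdot> radj (V i) \<cdot> \<Omega>))\<^sup>2) =
        ennreal ((norm (V i \<cdot> radj X \<cdot> radj (W j) \<cdot> \<Omega>))\<^sup>2)" by (simp add: T_def)
  qed
  also have "\<dots> = (\<Sum>\<^sub>\<infinity>j\<in>I'. \<Sum>\<^sub>\<infinity>i\<in>I. ennreal ((norm (V i \<cdot> radj X \<cdot> radj (W j) \<cdot> \<Omega>))\<^sup>2))"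
    by (rule infsum_swap_ennreal)
  also have "\<dots> = hs I' W (radj X)" unfolding hs_def by (simp only: emb_parseval[OF V])
  finally show ?thesis .
qed

text \<open>The definite description in \<open>jones_index\<close> denotes because
  \<open>hs_radj\<close>, applied to the identity, shows that all embeddings give the same
  sum.\<close>

lemma jones_index_eq:
  assumes V: "module_embedding \<Omega> B I V"
  shows "jones_index \<Omega> B = hs I V id_blinfun"
proof -
  have eq: "(\<Sum>\<^sub>\<infinity>i\<in>I. ennreal ((norm (adj (V i) \<cdot> \<Omega>))\<^sup>2)) = hs I V id_blinfun"
    if "module_embedding \<Omega> B I V" for I V
    unfolding hs_def
    by (intro infsum_cong) (simp add: adj_eq_radj[OF subsetD[OF commutant_BH emb_commutant[OF that]]])
  show ?thesis unfolding jones_index_def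
  proof (rule the_equality)
    show "\<exists>I' V'. module_embedding \<Omega> B I' V' \<and> hs I V id_blinfun =
        (\<Sum>\<^sub>\<infinity>i\<in>I'. ennreal ((norm (adj (V' i) \<cdot> \<Omega>))\<^sup>2))"
      using V eq[OF V] by metis
    fix d assume "\<exists>I V. module_embedding \<Omega> B I V \<and> d = (\<Sum>\<^sub>\<infinity>i\<in>I. ennreal ((norm (adj (V i) \<cdot> \<Omega>))\<^sup>2))"
    then obtain I' V' where V': "module_embedding \<Omega> B I' V'" "d = hs I' V' id_blinfun" using eq by metis
    then show "d = hs I V id_blinfun" using hs_radj[OF V'(1) V commutant_id] by simp
  qed
qed

end

section \<open>Averaging\<close>

text \<open>Convergence of contractions then has to be tested only at generating vectors. Closedness
  is the usual three-epsilon argument.\<close>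

lemma Cauchy_set_closed_subspace:
  fixes x :: "nat \<Rightarrow> 'a::banach \<Rightarrow>\<^sub>L 'a"
  assumes bound: "\<And>n. norm (x n) \<le> 1"
  shows "subspace {\<xi>. Cauchy (\<lambda>n. x n \<cdot> \<xi>)}" "closed {\<xi>. Cauchy (\<lambda>n. x n \<cdot> \<xi>)}"
proof -
  let ?E = "{\<xi>. Cauchy (\<lambda>n. x n \<cdot> \<xi>)}"
  show "subspace ?E"
  proof (unfold subspace_def, intro conjI ballI allI)
    show "0 \<in> ?E" using convergent_Cauchy[OF convergent_const] by simp
    show "\<xi> + \<eta> \<in> ?E" if "\<xi> \<in> ?E" "\<eta> \<in> ?E" for \<xi> \<eta>
      using that by (simp add: Cauchy_convergent_iff blinfun.add_right convergent_add)
    show "c *\<^sub>R \<xi> \<in> ?E" if "\<xi> \<in> ?E" for c \<xi>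
      using that bounded_linear.Cauchy[OF bounded_linear_scaleR_right] by (simp add: blinfun.scaleR_right)
  qed
  show "closed ?E"
  proof (rule closed_approachable[THEN iffD1, rotated] | unfold closed_sequential_limits)+
    show "\<forall>y l. (\<forall>n. y n \<in> ?E) \<and> y \<longlonglongrightarrow> l \<longrightarrow> l \<in> ?E"
    proof (intro allI impI, elim conjE)
      fix y l assume y: "\<forall>n. y n \<in> ?E" "y \<longlonglongrightarrow> l"
      have "Cauchy (\<lambda>n. x n \<cdot> l)"
      proof (rule metric_CauchyI)
        fix \<epsilon> :: real assume eps: "\<epsilon> > 0"
        obtain k where k: "dist (y k) l < \<epsilon> / 3"
          using metric_LIMSEQ_D[OF y(2), of "\<epsilon> / 3"] eps by auto
        obtain N where N: "\<And>m n. m \<ge> N \<Longrightarrow> n \<ge> N \<Longrightarrow> dist (x m \<cdot> y k) (x n \<cdot> y k) < \<epsilon> / 3"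
          using metric_CauchyD[of "\<lambda>n. x n \<cdot> y k" "\<epsilon> / 3"] y(1) eps by auto
        have near: "dist (x n \<cdot> l) (x n \<cdot> y k) < \<epsilon> / 3" for n
        proof -
          have "norm (x n \<cdot> (l - y k)) \<le> norm (x n) * norm (l - y k)" by (rule norm_blinfun)
          also have "\<dots> \<le> norm (l - y k)" using bound[of n] by (simp add: mult_left_le_one_le)
          finally show ?thesis using k by (simp add: dist_norm blinfun.diff_right norm_minus_commute)
        qed
        have "dist (x m \<cdot> l) (x n \<cdot> l) < \<epsilon>" if "m \<ge> N" "n \<ge> N" for m n
          using near[of m] near[of n] N[OF that] dist_triangle[of "x m \<cdot> l" "x n \<cdot> l" "x m \<cdot> y k"]
            dist_triangle[of "x m \<cdot> y k" "x n \<cdot> l" "x n \<cdot> y k"] dist_commute[of "x n \<cdot> l" "x n \<cdot> y k"]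
          by linarith
        then show "\<exists>M. \<forall>m\<ge>M. \<forall>n\<ge>M. dist (x m \<cdot> l) (x n \<cdot> l) < \<epsilon>" by blast
      qed
      then show "l \<in> ?E" by simp
    qed
  qed
qed

context tracial_sub
begin

context
  fixes I V
  assumes emb: "module_embedding \<Omega> B I V"
begin

lemma hs_parallelogram:
  "hs I V (X + Y) + hs I V (X - Y) = (hs I V X + hs I V X) + (hs I V Y + hs I V Y)"
proof -
  have par: "ennreal ((norm (a + b))\<^sup>2) + ennreal ((norm (a - b))\<^sup>2) =
      (ennreal ((norm a)\<^sup>2) + ennreal ((norm a)\<^sup>2)) + (ennreal ((norm b)\<^sup>2) + ennreal ((norm b)\<^sup>2))"
    for a b :: 'h
    by (simp add: ennreal_plus[symmetric] del: ennreal_plus)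
      (simp add: power2_norm_eq_inner inner_add_left inner_add_right inner_diff_left inner_diff_right inner_commute)
  show ?thesis unfolding hs_def
    by (simp add: infsum_add[symmetric] nonneg_summable_on_complete blinfun.add_left blinfun.diff_left par)
qed

lemma hs_mono: "(\<And>\<xi>. norm (X \<cdot> \<xi>) \<le> norm (Y \<cdot> \<xi>)) \<Longrightarrow> hs I V X \<le> hs I V Y"
  unfolding hs_def by (rule infsum_mono) (simp_all add: nonneg_summable_on_complete ennreal_leI power_mono)

lemma hs_term_le: "i \<in> I \<Longrightarrow> ennreal ((norm (X \<cdot> radj (V i) \<cdot> \<Omega>))\<^sup>2) \<le> hs I V X"
  unfolding hs_def using finite_sum_le_infsum_ennreal[of "{i}" I] by simp

lemma hs_half: "hs I V X = 4 * hs I V ((1/2) *\<^sub>R X)"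
proof -
  have "hs I V 0 = 0" unfolding hs_def by (rule infsum_0) simp
  moreover have "(1/2) *\<^sub>R X + (1/2) *\<^sub>R X = X" by (simp flip: scaleR_add_left)
  ultimately show ?thesis using hs_parallelogram[of "(1/2) *\<^sub>R X" "(1/2) *\<^sub>R X"]
    by (simp add: algebra_simps flip: mult_2)
qed

lemma hs_add_le: "hs I V (X + Y) \<le> (hs I V X + hs I V X) + (hs I V Y + hs I V Y)"
  unfolding hs_parallelogram[symmetric] by simp

lemma hs_isometry:
  assumes "radj g o\<^sub>L g = id_blinfun"
  shows "hs I V (g o\<^sub>L X) = hs I V X"
  by (simp add: hs_def norm_isometry[OF assms])

text \<open>An isometry on the left leaves every term unchanged; the factor on the right is brought
  to the left by passing to adjoints with \<open>hs_radj\<close>.\<close>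

lemma hs_conjugate:
  assumes g: "g \<in> commutant B" "radj g o\<^sub>L g = id_blinfun" and X: "X \<in> commutant B"
  shows "hs I V (g o\<^sub>L X o\<^sub>L radj g) = hs I V X"
proof -
  note c = commutant_compose B.commutant_radj_closed
  have "hs I V (g o\<^sub>L X o\<^sub>L radj g) = hs I V (X o\<^sub>L radj g)"
    by (simp only: blinfun_compose_assoc hs_isometry[OF g(2)])
  also have "\<dots> = hs I V (g o\<^sub>L radj X)"
    using hs_radj[OF emb emb, of "X o\<^sub>L radj g"] g X by (simp add: c)
  also have "\<dots> = hs I V (radj X)" by (rule hs_isometry[OF g(2)])
  also have "\<dots> = hs I V X" using hs_radj[OF emb emb X] by simp
  finally show ?thesis .
qed

text \<open>The point of the convex hull of \<open>{g p g\<^sup>* | g \<in> G}\<close> closest to 0 for the Hilbert-Schmidt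
  norm of the trace is invariant under \<open>G\<close>.\<close>

lemma averaging:
  assumes G: "\<And>g. g \<in> G \<Longrightarrow> g \<in> commutant B" "\<And>g. g \<in> G \<Longrightarrow> radj g o\<^sub>L g = id_blinfun"
      "\<And>g h. g \<in> G \<Longrightarrow> h \<in> G \<Longrightarrow> g o\<^sub>L h \<in> G" "id_blinfun \<in> G"
    and p: "p \<in> commutant B" "norm p \<le> 1" "hs I V p < \<infinity>"
  obtains x h where "\<And>n :: nat. x n \<in> convex hull ((\<lambda>g. g o\<^sub>L p o\<^sub>L radj g) ` G)"
    "\<And>\<xi>. (\<lambda>n. x n \<cdot> \<xi>) \<longlonglongrightarrow> h \<cdot> \<xi>" "h \<in> commutant B" "\<And>g. g \<in> G \<Longrightarrow> h o\<^sub>L g = g o\<^sub>L h"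
proof -
  define C where "C = convex hull ((\<lambda>g. g o\<^sub>L p o\<^sub>L radj g) ` G)"
  \<comment> \<open>Finiteness of \<open>hs\<close> lets it be treated as a real quantity on the
    convex hull, and the bound on the operator norm is needed for strong convergence.\<close>
  define D where "D = {X \<in> commutant B. norm X \<le> 1 \<and> hs I V X < \<infinity>}"
  note c = commutant_compose B.commutant_radj_closed
  have ng: "norm g \<le> 1" "norm (radj g) \<le> 1" if "g \<in> G" for g
  proof -
    show "norm g \<le> 1" by (rule norm_blinfun_bound) (simp_all add: norm_isometry[OF G(2)[OF that]])
    then show "norm (radj g) \<le> 1" using norm_radj_le order_trans by blast
  qed
  have ncomp: "norm (S o\<^sub>L T) \<le> 1" if "norm S \<le> 1" "norm T \<le> 1" for S T :: "'h \<Rightarrow>\<^sub>L 'h"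
    using norm_blinfun_compose[of S T] mult_le_one[OF that(1) _ that(2)] by simp
  have "convex D"
  proof (rule convexI)
    fix X Y and u v :: real assume XY: "X \<in> D" "Y \<in> D" and uv: "0 \<le> u" "0 \<le> v" "u + v = 1"
    have "norm (u *\<^sub>R X + v *\<^sub>R Y) \<le> 1"
    proof -
      have "norm (u *\<^sub>R X) \<le> u" "norm (v *\<^sub>R Y) \<le> v"
        using XY uv by (simp_all add: D_def mult_left_le)
      then show ?thesis using norm_triangle_ineq[of "u *\<^sub>R X" "v *\<^sub>R Y"] uv(3) by linarith
    qed
    moreover have "hs I V (u *\<^sub>R X) \<le> hs I V X" "hs I V (v *\<^sub>R Y) \<le> hs I V Y"
      using uv by (auto intro!: hs_mono simp: blinfun.scaleR_left mult_left_le_one_le)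
    then have "hs I V (u *\<^sub>R X + v *\<^sub>R Y) < \<infinity>"
      using hs_add_le[of "u *\<^sub>R X" "v *\<^sub>R Y"] XY
      by (auto simp: D_def less_top[symmetric] top_unique)
    ultimately show "u *\<^sub>R X + v *\<^sub>R Y \<in> D"
      using XY by (simp add: D_def commutant_add commutant_scaleR)
  qed
  moreover have "(\<lambda>g. g o\<^sub>L p o\<^sub>L radj g) ` G \<subseteq> D"
    using G p ng by (auto simp: D_def c hs_conjugate intro!: ncomp)
  ultimately have CD: "C \<subseteq> D" unfolding C_def by (rule hull_minimal[rotated])
  have Cne: "C \<noteq> {}" using G(4) by (auto simp: C_def)
  have Cconv: "convex C" by (simp add: C_def convex_convex_hull)
  have Cg: "g o\<^sub>L X o\<^sub>L radj g \<in> C" if g: "g \<in> G" and X: "X \<in> C" for g X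
  proof -
    define F where "F = (\<lambda>X. g o\<^sub>L X o\<^sub>L radj g)"
    have lin: "linear F" by (rule linearI) (simp_all add: F_def blinfun_compose_linear)
    have "F ` C = convex hull (F ` (\<lambda>g. g o\<^sub>L p o\<^sub>L radj g) ` G)"
      unfolding C_def by (rule convex_hull_linear_image[OF lin])
    also have "\<dots> \<subseteq> C" unfolding C_def
    proof (rule hull_mono, rule subsetI)
      fix y assume "y \<in> F ` (\<lambda>g. g o\<^sub>L p o\<^sub>L radj g) ` G"
      then obtain k where k: "k \<in> G" "y = F (k o\<^sub>L p o\<^sub>L radj k)" by blast
      then have "y = (g o\<^sub>L k) o\<^sub>L p o\<^sub>L radj (g o\<^sub>L k)" by (simp add: F_def blinfun_compose_assoc)
      then show "y \<in> (\<lambda>g. g o\<^sub>L p o\<^sub>L radj g) ` G" using G(3)[OF g k(1)] by blast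
    qed
    finally show ?thesis using X by (auto simp: F_def)
  qed
  define Q where "Q X = enn2real (hs I V X)" for X
  have Qe: "hs I V X = ennreal (Q X)" if "X \<in> D" for X
    using that by (simp add: Q_def D_def)
  have Q0: "0 \<le> Q X" for X by (simp add: Q_def)
  define m where "m = Inf (Q ` C)"
  have bdd: "bdd_below (Q ` C)" by (rule bdd_belowI[of _ 0]) (auto simp: Q0)
  have m_le: "m \<le> Q X" if "X \<in> C" for X
    unfolding m_def by (rule cInf_lower[OF _ bdd]) (use that in blast)
  \<comment> \<open>The midpoint of \<open>X\<close> and \<open>Y\<close> lies in \<open>C\<close>,
    so the parallelogram identity bounds their distance by the excesses of \<open>Q X\<close> and
    \<open>Q Y\<close> over the infimum.\<close>
  have diff: "hs I V (X - Y) \<le> ennreal (2 * (Q X - m) + 2 * (Q Y - m))" if XY: "X \<in> C" "Y \<in> C" for X Y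
  proof -
    have D: "X \<in> D" "Y \<in> D" using XY CD by auto
    have "(1/2) *\<^sub>R X + (1/2) *\<^sub>R Y \<in> C" using convexD[OF Cconv XY, of "1/2" "1/2"] by simp
    then have h: "(1/2) *\<^sub>R (X + Y) \<in> C" by (simp add: scaleR_add_right)
    have "ennreal (4 * m) + hs I V (X - Y) \<le> hs I V (X + Y) + hs I V (X - Y)"
    proof (rule add_right_mono)
      have "ennreal (4 * m) \<le> ennreal (4 * Q ((1/2) *\<^sub>R (X + Y)))"
        using m_le[OF h] by (intro ennreal_leI) simp
      also have "\<dots> = 4 * hs I V ((1/2) *\<^sub>R (X + Y))"
        using Qe[of "(1/2) *\<^sub>R (X + Y)"] h CD Q0 by (auto simp: ennreal_mult)
      also have "\<dots> = hs I V (X + Y)" by (rule hs_half[symmetric])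
      finally show "ennreal (4 * m) \<le> hs I V (X + Y)" .
    qed
    also have "\<dots> = ennreal (2 * Q X + 2 * Q Y)"
      unfolding hs_parallelogram by (simp add: Qe D Q0 ennreal_plus[symmetric] del: ennreal_plus)
    finally have le: "ennreal (4 * m) + hs I V (X - Y) \<le> ennreal (2 * Q X + 2 * Q Y)" .
    then have "hs I V (X - Y) < \<infinity>" by (auto simp: less_top[symmetric] top_unique)
    then have e: "hs I V (X - Y) = ennreal (Q (X - Y))" by (simp add: Q_def)
    have "0 \<le> m" unfolding m_def using Cne Q0 by (intro cInf_greatest) auto
    then have "4 * m + Q (X - Y) \<le> 2 * Q X + 2 * Q Y"
      using le Q0 by (simp add: e ennreal_plus[symmetric] del: ennreal_plus)
    then show ?thesis unfolding e by (intro ennreal_leI) simp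
  qed
  have "\<exists>X\<in>C. Q X < m + 1 / real (Suc n)" for n
  proof -
    have "Inf (Q ` C) < m + 1 / real (Suc n)" unfolding m_def by simp
    then show ?thesis using cInf_lessD[of "Q ` C"] Cne by auto
  qed
  then obtain x where xC: "\<And>n. x n \<in> C" and xm: "\<And>n. Q (x n) < m + 1 / real (Suc n)" by metis
  have xD: "x n \<in> commutant B" "norm (x n) \<le> 1" for n using xC[of n] CD by (auto simp: D_def)
  have dist_le: "(norm ((X - Y) \<cdot> radj (V i) \<cdot> \<Omega>))\<^sup>2 \<le> 2 * (Q X - m) + 2 * (Q Y - m)"
    if "X \<in> C" "Y \<in> C" "i \<in> I" for X Y i
  proof -
    have "ennreal ((norm ((X - Y) \<cdot> radj (V i) \<cdot> \<Omega>))\<^sup>2) \<le> ennreal (2 * (Q X - m) + 2 * (Q Y - m))"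
      using hs_term_le[OF that(3)] diff[OF that(1,2)] by (rule order_trans)
    then show ?thesis using m_le[OF that(1)] m_le[OF that(2)] by (subst (asm) ennreal_le_iff) auto
  qed
  \<comment> \<open>Convergence for the trace norm gives convergence at the vectors
    \<open>radj (V i) \<cdot> \<Omega>\<close>; commutation with \<open>B\<close> and closedness of
    \<open>E\<close> extend it to the ranges of all \<open>radj (V i)\<close>.\<close>
  define E where "E = {\<xi>. Cauchy (\<lambda>n. x n \<cdot> \<xi>)}"
  have E: "subspace E" "closed E"
    unfolding E_def by (rule Cauchy_set_closed_subspace, rule xD)+
  have "radj (V i) \<cdot> \<Omega> \<in> E" if i: "i \<in> I" for i
    unfolding E_def
  proof (rule CollectI, rule metric_CauchyI)
    fix \<epsilon> :: real assume eps: "\<epsilon> > 0"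
    obtain N where N: "4 / \<epsilon>\<^sup>2 < real N" using reals_Archimedean2 by blast
    have N0: "0 < real N" using N eps by (smt (verit) divide_nonneg_pos zero_less_power)
    have "dist (x k \<cdot> radj (V i) \<cdot> \<Omega>) (x l \<cdot> radj (V i) \<cdot> \<Omega>) < \<epsilon>" if kl: "k \<ge> Suc N" "l \<ge> Suc N" for k l
    proof -
      have inv: "1 / real (Suc k) < 1 / real N" if "k \<ge> Suc N" for k
        using that N0 by (simp add: field_simps)
      have "(norm ((x k - x l) \<cdot> radj (V i) \<cdot> \<Omega>))\<^sup>2 \<le> 2 * (Q (x k) - m) + 2 * (Q (x l) - m)"
        by (rule dist_le[OF xC xC i])
      also have "\<dots> < 4 / real N" using xm[of k] xm[of l] inv[OF kl(1)] inv[OF kl(2)] by simp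
      also have "\<dots> < \<epsilon>\<^sup>2" using N N0 eps by (simp add: field_simps)
      finally show ?thesis using eps
        by (simp add: dist_norm blinfun.diff_left power2_less_imp_less)
    qed
    then show "\<exists>M. \<forall>k\<ge>M. \<forall>l\<ge>M. dist (x k \<cdot> radj (V i) \<cdot> \<Omega>) (x l \<cdot> radj (V i) \<cdot> \<Omega>) < \<epsilon>" by blast
  qed
  then have bE: "radj (V i) \<cdot> b \<cdot> \<Omega> \<in> E" if i: "i \<in> I" and b: "b \<in> B" for i b
  proof -
    have "x n \<cdot> radj (V i) \<cdot> b \<cdot> \<Omega> = b \<cdot> x n \<cdot> radj (V i) \<cdot> \<Omega>" for n
      using B.commutant_commutes_apply[OF emb_radj_commutant[OF emb i] b]
        B.commutant_commutes_apply[OF xD(1) b] by simp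
    moreover have "Cauchy (\<lambda>n. x n \<cdot> radj (V i) \<cdot> \<Omega>)"
      using \<open>\<And>i. i \<in> I \<Longrightarrow> radj (V i) \<cdot> \<Omega> \<in> E\<close>[OF i] by (simp add: E_def)
    then have "Cauchy (\<lambda>n. b \<cdot> x n \<cdot> radj (V i) \<cdot> \<Omega>)"
      by (rule bounded_linear.Cauchy[OF blinfun.bounded_linear_right])
    ultimately show ?thesis by (simp add: E_def)
  qed
  have VE: "radj (V i) \<cdot> \<eta> \<in> E" if i: "i \<in> I" for i \<eta>
  proof -
    have "radj (V i) \<cdot> e \<cdot> \<eta> \<in> E"
      by (rule K_induct_closed_subset[OF E(2) bE[OF i] e_in])
    then show ?thesis by (simp add: emb_radj_e_apply[OF emb i])
  qed
  \<comment> \<open>A vector orthogonal to \<open>E\<close> is orthogonal to the ranges of all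
    \<open>radj (V i)\<close>, so all \<open>V i\<close> kill it and it is zero.\<close>
  have "\<xi> \<in> E" for \<xi>
  proof -
    have "\<xi> - proj E \<cdot> \<xi> = 0"
    proof (rule emb_zeroI[OF emb])
      fix i assume i: "i \<in> I"
      have "inner (V i \<cdot> (\<xi> - proj E \<cdot> \<xi>)) \<eta> = 0" for \<eta>
        using proj_orth[OF E VE[OF i]] by (simp add: inner_radj)
      then show "V i \<cdot> (\<xi> - proj E \<cdot> \<xi>) = 0" using inner_eq_zero_iff by blast
    qed
    then show ?thesis using proj_in[OF E, of \<xi>] by simp
  qed
  then have "\<exists>l. (\<lambda>n. x n \<cdot> \<xi>) \<longlonglongrightarrow> l" for \<xi>
    using Cauchy_convergent_iff by (auto simp: E_def convergent_def)
  then obtain f where f: "\<And>\<xi>. (\<lambda>n. x n \<cdot> \<xi>) \<longlonglongrightarrow> f \<xi>" by metis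
  have "bounded_linear f"
  proof (rule bounded_linear_intro)
    show "f (\<xi> + \<eta>) = f \<xi> + f \<eta>" for \<xi> \<eta>
      by (rule LIMSEQ_unique[OF f]) (simp add: blinfun.add_right tendsto_add f)
    show "f (r *\<^sub>R \<xi>) = r *\<^sub>R f \<xi>" for r \<xi>
      by (rule LIMSEQ_unique[OF f]) (simp add: blinfun.scaleR_right tendsto_scaleR f)
    show "norm (f \<xi>) \<le> norm \<xi> * 1" for \<xi>
    proof (rule LIMSEQ_le_const2[OF tendsto_norm[OF f]], intro exI allI impI)
      fix n
      have "norm (x n \<cdot> \<xi>) \<le> norm (x n) * norm \<xi>" by (rule norm_blinfun)
      also have "\<dots> \<le> norm \<xi>" using xD(2)[of n] by (simp add: mult_left_le_one_le)
      finally show "norm (x n \<cdot> \<xi>) \<le> norm \<xi> * 1" by simp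
    qed
  qed
  define h where "h = Blinfun f"
  have h: "(\<lambda>n. x n \<cdot> \<xi>) \<longlonglongrightarrow> h \<cdot> \<xi>" for \<xi>
    using f \<open>bounded_linear f\<close> by (simp add: h_def bounded_linear_Blinfun_apply)
  have hB: "h \<in> commutant B" by (rule commutant_strong_limit[OF xD(1) h])
  have inv: "h o\<^sub>L g = g o\<^sub>L h" if g: "g \<in> G" for g
  proof -
    \<comment> \<open>Conjugation by \<open>g\<close> preserves \<open>C\<close> and
      \<open>Q\<close>, so \<open>y\<close> is minimizing as well and \<open>x n - y n\<close> tends
      to 0 at the vectors of the embedding.\<close>
    define y where "y n = g o\<^sub>L x n o\<^sub>L radj g" for n
    have yC: "y n \<in> C" and Qy: "Q (y n) = Q (x n)" for n
      using Cg[OF g xC] hs_conjugate[OF G(1)[OF g] G(2)[OF g] xD(1)] by (simp_all add: y_def Q_def)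
    have z: "(h - (g o\<^sub>L h o\<^sub>L radj g)) \<cdot> radj (V i) \<cdot> \<Omega> = 0" if i: "i \<in> I" for i
    proof -
      let ?v = "radj (V i) \<cdot> \<Omega>"
      have "(\<lambda>n. (norm ((x n - y n) \<cdot> ?v))\<^sup>2) \<longlonglongrightarrow> (norm (h \<cdot> ?v - g \<cdot> h \<cdot> radj g \<cdot> ?v))\<^sup>2"
        unfolding y_def blinfun.diff_left blinfun_apply_blinfun_compose
        by (intro tendsto_power tendsto_norm tendsto_diff h blinfun.tendsto tendsto_const)
      moreover have "(\<lambda>n. (norm ((x n - y n) \<cdot> ?v))\<^sup>2) \<longlonglongrightarrow> 0"
      proof (rule tendsto_sandwich[of "\<lambda>_. 0" _ _ "\<lambda>n. 4 * (1 / real (Suc n))"])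
        show "(\<lambda>n. 4 * (1 / real (Suc n))) \<longlonglongrightarrow> 0"
          using tendsto_mult_left[OF LIMSEQ_Suc[OF lim_1_over_n], of 4] by simp
        show "\<forall>\<^sub>F n in sequentially. (norm ((x n - y n) \<cdot> ?v))\<^sup>2 \<le> 4 * (1 / real (Suc n))"
        proof (rule always_eventually, rule allI)
          fix n
          have "(norm ((x n - y n) \<cdot> ?v))\<^sup>2 \<le> 2 * (Q (x n) - m) + 2 * (Q (y n) - m)"
            by (rule dist_le[OF xC yC i])
          also have "\<dots> \<le> 4 * (1 / real (Suc n))" using xm[of n] by (simp add: Qy)
          finally show "(norm ((x n - y n) \<cdot> ?v))\<^sup>2 \<le> 4 * (1 / real (Suc n))" .
        qed
      qed auto
      ultimately have "(norm (h \<cdot> ?v - g \<cdot> h \<cdot> radj g \<cdot> ?v))\<^sup>2 = 0" by (rule LIMSEQ_unique)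
      then show ?thesis by (simp add: blinfun.diff_left)
    qed
    have "hs I V (h - (g o\<^sub>L h o\<^sub>L radj g)) = 0" unfolding hs_def
      by (rule infsum_0) (simp only: z norm_zero zero_power2 ennreal_0)
    moreover have "h - (g o\<^sub>L h o\<^sub>L radj g) \<in> commutant B"
      by (intro commutant_diff c hB G(1) g)
    ultimately have "h - (g o\<^sub>L h o\<^sub>L radj g) = 0" using hs_eq_0D[OF emb] by blast
    then have "h o\<^sub>L g = (g o\<^sub>L h o\<^sub>L radj g) o\<^sub>L g" by simp
    then show ?thesis by (simp add: blinfun_compose_assoc G(2)[OF g])
  qed
  show ?thesis by (rule that[of x h]) (use xC h hB inv in \<open>simp_all add: C_def\<close>)
qed

end

end

section \<open>Comparison of projections and small index\<close>

lemma selfadjoint_form_zero: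
  assumes "radj A = A" "\<And>\<xi>. inner (A \<cdot> \<xi>) \<xi> = 0"
  shows "A = 0"
proof (rule blinfun_eqI, rule vector_inner_eqI)
  fix \<xi> \<eta>
  have "inner (A \<cdot> \<eta>) \<xi> = inner (A \<cdot> \<xi>) \<eta>"
    using inner_radj[of A \<eta> \<xi>] assms(1) by (simp add: inner_commute)
  then show "inner (A \<cdot> \<xi>) \<eta> = inner (0 \<cdot> \<xi>) \<eta>"
    using assms(2)[of "\<xi> + \<eta>"] assms(2)[of \<xi>] assms(2)[of \<eta>]
    by (simp add: blinfun.add_right inner_add_left inner_add_right)
qed

context vna
begin

text \<open>The strong sum of the family, constructed as the isometry that sends
  \<open>radj U \<cdot> U \<cdot> \<xi>\<close> to \<open>U \<cdot> \<xi>\<close> on the span of the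
  initial spaces. The clauses say that its supports contain those of the members and nothing beyond
  what they generate.\<close>

lemma sum_partial_isometries:
  assumes sub: "\<W> \<subseteq> A" and pi: "\<And>U. U \<in> \<W> \<Longrightarrow> U o\<^sub>L radj U o\<^sub>L U = U"
    and orth: "\<And>U V. U \<in> \<W> \<Longrightarrow> V \<in> \<W> \<Longrightarrow> U \<noteq> V \<Longrightarrow> radj U o\<^sub>L V = 0 \<and> U o\<^sub>L radj V = 0"
  shows "\<exists>W\<in>A. W o\<^sub>L radj W o\<^sub>L W = W \<and> (\<forall>U\<in>\<W>. W o\<^sub>L radj U o\<^sub>L U = U) \<and>
    (\<forall>U\<in>\<W>. radj W o\<^sub>L W o\<^sub>L radj U = radj U) \<and>
    (\<forall>P :: 'h \<Rightarrow>\<^sub>L 'h. (\<forall>U\<in>\<W>. P o\<^sub>L U = 0) \<longrightarrow> P o\<^sub>L W = 0) \<and>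
    (\<forall>Q :: 'h \<Rightarrow>\<^sub>L 'h. (\<forall>U\<in>\<W>. U o\<^sub>L Q = 0) \<longrightarrow> W o\<^sub>L Q = 0)"
proof -
  define S where "S = (\<Union>U\<in>\<W>. range (\<lambda>\<xi>. (radj U \<cdot> U \<cdot> \<xi>, U \<cdot> \<xi>)))"
  have S_in: "(radj U \<cdot> U \<cdot> \<xi>, U \<cdot> \<xi>) \<in> span S" if "U \<in> \<W>" for U \<xi>
    by (rule span_base) (use that in \<open>auto simp: S_def\<close>)
  have S_ind: "P x" if "x \<in> span S" "subspace {x. P x}"
      "\<And>U \<xi>. U \<in> \<W> \<Longrightarrow> P (radj U \<cdot> U \<cdot> \<xi>, U \<cdot> \<xi>)" for P x
  proof -
    have "span S \<subseteq> {x. P x}" by (rule span_minimal) (use that(2,3) in \<open>auto simp: S_def\<close>)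
    then show ?thesis using that(1) by blast
  qed
  have pi': "U \<cdot> radj U \<cdot> U \<cdot> \<xi> = U \<cdot> \<xi>" if "U \<in> \<W>" for U \<xi>
    using arg_cong[OF pi[OF that], of "\<lambda>T. T \<cdot> \<xi>"] by simp
  have gen: "inner (U \<cdot> \<xi>) (V \<cdot> \<eta>) = inner (radj U \<cdot> U \<cdot> \<xi>) (radj V \<cdot> V \<cdot> \<eta>)" if UV: "U \<in> \<W>" "V \<in> \<W>" for U V \<xi> \<eta>
  proof (cases "U = V")
    case True
    have "inner (radj U \<cdot> U \<cdot> \<xi>) (radj U \<cdot> U \<cdot> \<eta>) = inner (U \<cdot> radj U \<cdot> U \<cdot> \<xi>) (U \<cdot> \<eta>)"
      by (rule inner_radj[symmetric])
    then show ?thesis using True pi'[OF UV(1)] by simp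
  next
    case False
    have z: "(radj U o\<^sub>L V) \<cdot> \<eta> = 0" "(U o\<^sub>L radj V) \<cdot> V \<cdot> \<eta> = 0" using orth[OF UV False] by simp_all
    have "inner (U \<cdot> \<xi>) (V \<cdot> \<eta>) = inner \<xi> ((radj U o\<^sub>L V) \<cdot> \<eta>)" by (simp add: inner_radj)
    moreover have "inner (radj U \<cdot> U \<cdot> \<xi>) (radj V \<cdot> V \<cdot> \<eta>) = inner (U \<cdot> \<xi>) ((U o\<^sub>L radj V) \<cdot> V \<cdot> \<eta>)"
      by (simp add: inner_radj')
    ultimately show ?thesis by (simp only: z inner_zero_right)
  qed
  have sp: "subspace {x. inner (snd x) b = inner (fst x) a}" for a b :: 'h
    by (auto simp: subspace_def inner_add_left)
  have spn: "subspace {x :: 'h \<times> 'h. inner (fst x) \<nu> = 0}" for \<nu>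
    by (auto simp: subspace_def inner_add_left)
  have iso1: "inner b (U \<cdot> \<eta>) = inner a (radj U \<cdot> U \<cdot> \<eta>)" if "(a, b) \<in> span S" "U \<in> \<W>" for a b U \<eta>
  proof -
    have "inner (snd (a, b)) (U \<cdot> \<eta>) = inner (fst (a, b)) (radj U \<cdot> U \<cdot> \<eta>)"
      by (rule S_ind[OF that(1) sp]) (simp add: gen[OF _ that(2)])
    then show ?thesis by simp
  qed
  have iso: "inner b b' = inner a a'" if "(a, b) \<in> span S" "(a', b') \<in> span S" for a b a' b'
  proof -
    have "inner (snd (a', b')) b = inner (fst (a', b')) a"
    proof (rule S_ind[OF that(2) sp])
      show "inner (snd (radj U \<cdot> U \<cdot> \<xi>, U \<cdot> \<xi>)) b = inner (fst (radj U \<cdot> U \<cdot> \<xi>, U \<cdot> \<xi>)) a"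
        if "U \<in> \<W>" for U \<xi>
        using iso1[OF \<open>(a, b) \<in> span S\<close> that, of \<xi>] by (simp add: inner_commute)
    qed
    then show ?thesis by (simp add: inner_commute)
  qed
  have ao: "inner a \<nu> = 0" if "(a, b) \<in> span S" "\<And>U. U \<in> \<W> \<Longrightarrow> U \<cdot> \<nu> = 0" for a b \<nu>
  proof -
    have "inner (fst (a, b)) \<nu> = 0"
      by (rule S_ind[OF that(1) spn]) (simp add: inner_radj' that(2))
    then show ?thesis by simp
  qed
  have normS: "norm b = norm a" if "(a, b) \<in> span S" for a b
    using iso[OF that that] by (simp add: norm_eq_sqrt_inner)
  obtain W :: "'h \<Rightarrow>\<^sub>L 'h" where Wa: "\<And>a b. (a, b) \<in> span S \<Longrightarrow> W \<cdot> a = b"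
    and Wstar: "\<And>a b. (a, b) \<in> span S \<Longrightarrow> radj W \<cdot> b = a"
    and Wn: "\<And>\<nu>. (\<And>a b. (a, b) \<in> span S \<Longrightarrow> inner a \<nu> = 0) \<Longrightarrow> W \<cdot> \<nu> = 0" and W: "W o\<^sub>L radj W o\<^sub>L W = W"
    and WP: "\<And>P :: 'h \<Rightarrow>\<^sub>L 'h. (\<And>a b. (a, b) \<in> span S \<Longrightarrow> P \<cdot> b = 0) \<Longrightarrow> P o\<^sub>L W = 0"
    and WT: "\<And>T. (\<And>a b. (a, b) \<in> span S \<Longrightarrow> (T \<cdot> a, T \<cdot> b) \<in> span S \<and> (radj T \<cdot> a, radj T \<cdot> b) \<in> span S) \<Longrightarrow>
      W o\<^sub>L T = T o\<^sub>L W"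
    by (rule isometric_graph_extension[of "span S", OF subspace_span normS]) (assumption, (rule that; blast))
  have "W \<in> A"
  proof (rule commuting_closed[of "\<W> \<union> radj ` \<W>"])
    show "\<W> \<union> radj ` \<W> \<subseteq> A" using sub radj_closed by auto
    fix T assume T: "\<And>x. x \<in> \<W> \<union> radj ` \<W> \<Longrightarrow> T o\<^sub>L x = x o\<^sub>L T"
      "\<And>x. x \<in> \<W> \<union> radj ` \<W> \<Longrightarrow> radj T o\<^sub>L x = x o\<^sub>L radj T"
    have TS: "(V \<cdot> a, V \<cdot> b) \<in> span S"
      if V: "\<And>x. x \<in> \<W> \<union> radj ` \<W> \<Longrightarrow> V o\<^sub>L x = x o\<^sub>L V" and ab: "(a, b) \<in> span S" for V a b
    proof -
      have VU: "V \<cdot> U \<cdot> v = U \<cdot> V \<cdot> v" "V \<cdot> radj U \<cdot> v = radj U \<cdot> V \<cdot> v" if "U \<in> \<W>" for U v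
        using blinfun_compose_eqD[OF V[of U]] blinfun_compose_eqD[OF V[of "radj U"]] that by auto
      have "linear (\<lambda>x. (V \<cdot> fst x, V \<cdot> snd x))"
        by (rule linearI) (simp_all add: blinfun.add_right blinfun.scaleR_right)
      then have "subspace {x. (V \<cdot> fst x, V \<cdot> snd x) \<in> span S}"
        using linear_subspace_vimage[OF _ subspace_span] by (simp add: vimage_def)
      from S_ind[OF ab this] have "(V \<cdot> fst (a, b), V \<cdot> snd (a, b)) \<in> span S"
        using S_in by (simp add: VU)
      then show ?thesis by simp
    qed
    show "W o\<^sub>L T = T o\<^sub>L W" by (rule WT) (use TS[OF T(1)] TS[OF T(2)] in blast)
  qed
  moreover have "W o\<^sub>L radj U o\<^sub>L U = U" if "U \<in> \<W>" for U
    by (rule blinfun_eqI) (simp add: Wa[OF S_in[OF that]])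
  moreover have "radj W o\<^sub>L W o\<^sub>L radj U = radj U" if U: "U \<in> \<W>" for U
  proof (rule blinfun_eqI)
    fix \<xi>
    have "radj U \<cdot> U \<cdot> radj U \<cdot> \<xi> = radj U \<cdot> \<xi>"
      using arg_cong[OF arg_cong[OF pi[OF U], of radj], of "\<lambda>T. T \<cdot> \<xi>"] by simp
    then have "(radj U \<cdot> \<xi>, U \<cdot> radj U \<cdot> \<xi>) \<in> span S" using S_in[OF U, of "radj U \<cdot> \<xi>"] by simp
    then show "(radj W o\<^sub>L W o\<^sub>L radj U) \<cdot> \<xi> = radj U \<cdot> \<xi>" using Wa Wstar by simp
  qed
  moreover have "P o\<^sub>L W = 0" if P: "\<forall>U\<in>\<W>. P o\<^sub>L U = 0" for P :: "'h \<Rightarrow>\<^sub>L 'h"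
  proof (rule WP)
    fix a b assume ab: "(a, b) \<in> span S"
    have sub: "subspace {x :: 'h \<times> 'h. P \<cdot> snd x = 0}"
      by (auto simp: subspace_def blinfun.add_right blinfun.scaleR_right)
    have PU: "P \<cdot> U \<cdot> \<xi> = 0" if "U \<in> \<W>" for U \<xi>
      using arg_cong[OF bspec[OF P that], of "\<lambda>T. T \<cdot> \<xi>"] by simp
    have "P \<cdot> snd (a, b) = 0" by (rule S_ind[OF ab sub]) (simp add: PU)
    then show "P \<cdot> b = 0" by simp
  qed
  moreover have "W o\<^sub>L Q = 0" if Q: "\<forall>U\<in>\<W>. U o\<^sub>L Q = 0" for Q :: "'h \<Rightarrow>\<^sub>L 'h"
  proof (rule blinfun_eqI)
    fix \<xi>
    have "U \<cdot> Q \<cdot> \<xi> = 0" if "U \<in> \<W>" for U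
      using arg_cong[OF bspec[OF Q that], of "\<lambda>T. T \<cdot> \<xi>"] by simp
    then have "W \<cdot> Q \<cdot> \<xi> = 0" by (intro Wn) (rule ao)
    then show "(W o\<^sub>L Q) \<cdot> \<xi> = 0 \<cdot> \<xi>" by simp
  qed
  ultimately show ?thesis using W by blast
qed

text \<open>The closed span \<open>L\<close> of the vectors \<open>a \<cdot> Q \<cdot> \<xi>\<close>
  is invariant under the algebra and under its commutant, so its projection is central, hence
  scalar, hence 1 because \<open>Q\<close> is nonzero. If all products vanished, \<open>Y\<close>
  would vanish on \<open>L\<close>.\<close>

lemma factor_cut_nonzero:
  assumes fac: "A \<inter> commutant A = range scalar_op"
    and Y: "Y \<in> A" "Y \<noteq> 0" and Q: "Q \<in> A" "Q \<noteq> 0"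
  shows "\<exists>a\<in>A. Y o\<^sub>L a o\<^sub>L Q \<noteq> 0"
proof (rule ccontr)
  assume "\<not> ?thesis"
  then have z: "Y o\<^sub>L a o\<^sub>L Q = 0" if "a \<in> A" for a using that by blast
  define X where "X = span (\<Union>a\<in>A. range (\<lambda>\<xi>. a \<cdot> Q \<cdot> \<xi>))"
  define L where "L = closure X"
  have L: "subspace L" "closed L" by (simp_all add: L_def X_def subspace_closure)
  have XI: "a \<cdot> Q \<cdot> \<xi> \<in> X" if "a \<in> A" for a \<xi> unfolding X_def by (rule span_base) (use that in blast)
  have inv: "T \<cdot> \<xi> \<in> L" if T: "\<And>a \<xi>. a \<in> A \<Longrightarrow> T \<cdot> a \<cdot> Q \<cdot> \<xi> \<in> X" and \<xi>: "\<xi> \<in> L" for T \<xi>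
  proof -
    have "T \<cdot> x \<in> X" if "x \<in> X" for x
      using that unfolding X_def
    proof (induction rule: span_induct_alt)
      case (step c x y)
      then have "T \<cdot> x \<in> X" using T by auto
      then show ?case using step.IH by (simp add: blinfun.add_right blinfun.scaleR_right span_add span_scale X_def)
    qed (simp add: span_zero)
    then have "X \<subseteq> blinfun_apply T -` L" using closure_subset by (auto simp: L_def)
    moreover have "closed (blinfun_apply T -` L)"
      by (rule closed_vimage) (auto intro: L linear_continuous_on blinfun.bounded_linear_right)
    ultimately have "L \<subseteq> blinfun_apply T -` L" unfolding L_def by (intro closure_minimal)
    then show ?thesis using \<xi> by blast
  qed
  have invA: "b \<cdot> \<xi> \<in> L" if b: "b \<in> A" and \<xi>: "\<xi> \<in> L" for b \<xi>
    by (rule inv[OF _ \<xi>]) (metis XI b compose_closed blinfun_apply_blinfun_compose)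
  have inv': "T \<cdot> \<xi> \<in> L" if T: "T \<in> commutant A" and \<xi>: "\<xi> \<in> L" for T \<xi>
    by (rule inv[OF _ \<xi>]) (simp add: commutant_commutes_apply[OF T] Q(1) XI)
  have cA: "proj L o\<^sub>L b = b o\<^sub>L proj L" if "b \<in> A" for b
    by (rule proj_commute[OF L]) (auto intro: invA that radj_closed)
  have c': "proj L o\<^sub>L T = T o\<^sub>L proj L" if "T \<in> commutant A" for T
    by (rule proj_commute[OF L]) (auto intro: inv' that commutant_radj_closed)
  have pB: "proj L \<in> BH" unfolding BH_iff by (rule cA) (rule iop_closed)
  then have "proj L \<in> A" by (rule in_algebraI) (rule c')
  moreover have "proj L \<in> commutant A" by (simp add: commutant_iff pB cA)
  ultimately have "proj L \<in> A \<inter> commutant A" by blast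
  then obtain c where c: "proj L = scalar_op c" using fac by blast
  obtain \<xi> where \<xi>: "Q \<cdot> \<xi> \<noteq> 0" using Q(2) by (metis blinfun_eqI blinfun.zero_left)
  have "Q \<cdot> \<xi> \<in> X" using XI[OF id_closed, of \<xi>] by simp
  then have "Q \<cdot> \<xi> \<in> L" unfolding L_def by (rule closure_subset[THEN subsetD])
  then have cQ: "c *\<^sub>C Q \<cdot> \<xi> = Q \<cdot> \<xi>" using proj_fix[OF L, of "Q \<cdot> \<xi>"] c by simp
  have "(c - 1) *\<^sub>C Q \<cdot> \<xi> = c *\<^sub>C Q \<cdot> \<xi> + (- 1) *\<^sub>C Q \<cdot> \<xi>" by (simp add: scaleC_add_left[symmetric])
  also have "\<dots> = 0" by (simp add: cQ scaleC_minus_one)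
  finally have "cmod (c - 1) * norm (Q \<cdot> \<xi>) = 0" by (simp add: norm_scaleC[symmetric])
  then have "c = 1" using \<xi> by simp
  then have "x \<in> L" for x using proj_in[OF L, of x] c by (simp add: scaleC_one)
  moreover have "L \<subseteq> {x. Y \<cdot> x = 0}" unfolding L_def
  proof (rule closure_minimal)
    show "closed {x. Y \<cdot> x = 0}" by (intro closed_Collect_eq continuous_intros)
    show "X \<subseteq> {x. Y \<cdot> x = 0}" unfolding X_def
    proof (rule span_minimal)
      show "subspace {x. Y \<cdot> x = 0}" by (auto simp: subspace_def blinfun.add_right blinfun.scaleR_right)
      have "Y \<cdot> a \<cdot> Q \<cdot> \<xi> = 0" if "a \<in> A" for a \<xi>
        using arg_cong[OF z[OF that], of "\<lambda>T. T \<cdot> \<xi>"] by simp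
      then show "(\<Union>a\<in>A. range (\<lambda>\<xi>. a \<cdot> Q \<cdot> \<xi>)) \<subseteq> {x. Y \<cdot> x = 0}" by auto
    qed
  qed
  ultimately have "Y = 0" by (intro blinfun_eqI) auto
  then show False using Y(2) by simp
qed

end

section \<open>Vectors that induce the trace on the commutant\<close>

context tracial_L2
begin

text \<open>This is uniqueness of the trace on the commutant of a factor. A positive operator
  averaged over the unitaries of the commutant becomes a scalar, and neither of the two tracial
  vector functionals changes under the averaging.\<close>

lemma tracial_vector_proportional:
  assumes fac: "M \<inter> commutant M = range scalar_op"
    and \<zeta>: "\<And>T. T \<in> commutant M \<Longrightarrow> norm (radj T \<cdot> \<zeta>) = norm (T \<cdot> \<zeta>)" and T: "T \<in> commutant M"
  shows "(norm (T \<cdot> \<zeta>))\<^sup>2 = (norm \<zeta>)\<^sup>2 * (norm (T \<cdot> \<Omega>))\<^sup>2"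
proof -
  interpret MM: tracial_sub M \<tau> \<Omega> M by unfold_locales simp
  interpret M': vna "commutant M" by standard (rule M.commutant_vna)
  note c = commutant_compose M.commutant_radj_closed
  have K: "\<xi> \<in> MM.K" for \<xi> using dense by (simp add: MM.K_closure)
  have e: "MM.e = id_blinfun" by (rule blinfun_eqI) (simp add: MM.e_fix K)
  \<comment> \<open>For \<open>M\<close> inside itself the projection \<open>e\<close> is the
    identity, so the identity alone is a module embedding and \<open>hs\<close> is the squared norm
    at \<open>\<Omega>\<close>.\<close>
  have emb: "module_embedding \<Omega> M {\<Omega>} (\<lambda>_. id_blinfun)"
    by (auto simp: MM.module_embedding_iff e commutant_id intro!: has_sum_finiteI)
  \<comment> \<open>The scale brings \<open>p\<close> below norm 1, as \<open>averaging\<close>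
    demands; the summand 1 keeps it positive when \<open>T\<close> is 0.\<close>
  define s where "s = (norm T)\<^sup>2 + 1"
  have s: "s > 0" by (simp add: s_def add_nonneg_pos)
  define p where "p = (1 / s) *\<^sub>R (radj T o\<^sub>L T)"
  have pM: "p \<in> commutant M" unfolding p_def by (intro commutant_scaleR c T)
  have np: "norm p \<le> 1"
  proof -
    have "norm (radj T o\<^sub>L T) \<le> norm (radj T) * norm T" by (rule norm_blinfun_compose)
    also have "\<dots> \<le> norm T * norm T" by (intro mult_right_mono norm_radj_le) simp
    also have "\<dots> \<le> s" by (simp add: s_def power2_eq_square)
    finally show ?thesis using s by (simp add: p_def)
  qed
  define G where "G = unitaries (commutant M)"
  have G: "g \<in> commutant M" "radj g o\<^sub>L g = id_blinfun" "g o\<^sub>L radj g = id_blinfun" if "g \<in> G" for g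
    using that by (auto simp: G_def M'.unitaries_iff)
  have GG: "g o\<^sub>L h \<in> G" if "g \<in> G" "h \<in> G" for g h
    using that unfolding G_def by (rule M'.unitaries_compose)
  have idG: "id_blinfun \<in> G" unfolding G_def by (rule M'.unitaries_id)
  obtain x h where x: "\<And>n :: nat. x n \<in> convex hull ((\<lambda>g. g o\<^sub>L p o\<^sub>L radj g) ` G)"
    and lim: "\<And>\<xi>. (\<lambda>n. x n \<cdot> \<xi>) \<longlonglongrightarrow> h \<cdot> \<xi>" and h: "h \<in> commutant M" "\<And>g. g \<in> G \<Longrightarrow> h o\<^sub>L g = g o\<^sub>L h"
  proof (rule MM.averaging[OF emb, of G p])
    show "MM.hs {\<Omega>} (\<lambda>_. id_blinfun) p < \<infinity>" by (simp add: MM.hs_def)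
  qed (use G GG idG pM np in auto)
  have "h \<in> commutant (commutant M)"
    using M'.commutes_if_commutes_unitaries[of h] h commutant_BH by (auto simp: G_def commutant_iff)
  then have "h \<in> M \<inter> commutant M" using h(1) M.bicommutant by simp
  then obtain k where k: "h = scalar_op k" using fac by blast
  \<comment> \<open>The functional of such a \<open>v\<close> takes the same value at all conjugates
    of \<open>p\<close>, hence on their convex hull and at the strong limit.\<close>
  have inv: "inner (h \<cdot> v) v = inner (p \<cdot> v) v"
    if v: "\<And>T. T \<in> commutant M \<Longrightarrow> norm (radj T \<cdot> v) = norm (T \<cdot> v)" for v
  proof -
    have "inner (g \<cdot> p \<cdot> radj g \<cdot> v) v = inner (p \<cdot> v) v" if g: "g \<in> G" for g
    proof -
      have pf: "inner (p \<cdot> \<xi>) \<xi> = (1 / s) * (norm (T \<cdot> \<xi>))\<^sup>2" for \<xi>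
        by (simp add: p_def blinfun.scaleR_left inner_radj' power2_norm_eq_inner)
      have "norm (T \<cdot> radj g \<cdot> v) = norm (radj (T o\<^sub>L radj g) \<cdot> v)"
        using v[of "T o\<^sub>L radj g"] T G(1)[OF g] by (simp add: c)
      also have "\<dots> = norm (T \<cdot> v)" by (simp add: norm_isometry[OF G(2)[OF g]] v[OF T])
      finally show ?thesis using pf[of "radj g \<cdot> v"] pf[of v] by (simp add: inner_radj)
    qed
    then have "(\<lambda>g. g o\<^sub>L p o\<^sub>L radj g) ` G \<subseteq> {X. inner (X \<cdot> v) v = inner (p \<cdot> v) v}" by auto
    moreover have "convex {X. inner (X \<cdot> v) v = inner (p \<cdot> v) v}"
      by (rule convexI) (simp add: blinfun.add_left blinfun.scaleR_left inner_add_left flip: distrib_right)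
    ultimately have "inner (x n \<cdot> v) v = inner (p \<cdot> v) v" for n
      using x[of n] hull_minimal by blast
    moreover have "(\<lambda>n. inner (x n \<cdot> v) v) \<longlonglongrightarrow> inner (h \<cdot> v) v" by (intro tendsto_intros lim)
    ultimately have "(\<lambda>n. inner (p \<cdot> v) v) \<longlonglongrightarrow> inner (h \<cdot> v) v" by simp
    then show ?thesis by (rule LIMSEQ_unique[OF _ tendsto_const])
  qed
  have kv: "inner (h \<cdot> v) v = Re k * (norm v)\<^sup>2" for v
    by (simp add: k inner_eq_Re_cinner cinner_scaleC_left cinner_self)
  have pv: "inner (p \<cdot> v) v = (1 / s) * (norm (T \<cdot> v))\<^sup>2" for v
    by (simp add: p_def blinfun.scaleR_left inner_radj' power2_norm_eq_inner)
  have "norm (radj S \<cdot> \<Omega>) = norm (S \<cdot> \<Omega>)" if "S \<in> commutant M" for S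
    by (rule MM.norm_radj_Omega[OF that]) (rule K)+
  then have "Re k = (1 / s) * (norm (T \<cdot> \<Omega>))\<^sup>2" using inv[of \<Omega>] kv[of \<Omega>] pv[of \<Omega>] by simp
  moreover have "Re k * (norm \<zeta>)\<^sup>2 = (1 / s) * (norm (T \<cdot> \<zeta>))\<^sup>2"
    using inv[OF \<zeta>] kv[of \<zeta>] pv[of \<zeta>] by simp
  ultimately have "(norm (T \<cdot> \<Omega>))\<^sup>2 = s * Re k" "(norm (T \<cdot> \<zeta>))\<^sup>2 = s * (Re k * (norm \<zeta>)\<^sup>2)"
    using s by simp_all
  then show ?thesis by simp
qed

text \<open>Taking \<open>T \<cdot> \<Omega>\<close> to \<open>T \<cdot> \<zeta>\<close> is
  isometric on a dense subspace; the extension commutes with the commutant and so belongs to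
  \<open>M\<close>.\<close>

lemma tracial_vector_isometry:
  assumes \<zeta>: "\<And>T. T \<in> commutant M \<Longrightarrow> norm (T \<cdot> \<zeta>) = norm (T \<cdot> \<Omega>)"
  shows "\<exists>u\<in>M. radj u o\<^sub>L u = id_blinfun \<and> u \<cdot> \<Omega> = \<zeta>"
proof -
  define G where "G = (\<lambda>T. (T \<cdot> \<Omega>, T \<cdot> \<zeta>)) ` commutant M"
  have sub: "subspace G" unfolding G_def by (rule subspace_orbit_pairs)
  have bound: "norm b \<le> 1 * norm a" if "(a, b) \<in> G" for a b
    using that \<zeta> by (auto simp: G_def)
  have "fst ` G = (\<lambda>T. T \<cdot> \<Omega>) ` commutant M" by (auto simp: G_def image_image)
  then have d: "closure (fst ` G) = UNIV" using commutant_dense[of M] by simp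
  obtain u :: "'h \<Rightarrow>\<^sub>L 'h" where u0: "\<forall>(a, b)\<in>G. u \<cdot> a = b"
    using graph_extension[OF sub bound d] by blast
  then have u: "u \<cdot> T \<cdot> \<Omega> = T \<cdot> \<zeta>" if "T \<in> commutant M" for T
    using that by (auto simp: G_def)
  have comm: "u o\<^sub>L S = S o\<^sub>L u" if S: "S \<in> commutant M" for S
  proof (rule blinfun_eq_on_dense[OF commutant_dense[of M]])
    fix v assume "v \<in> (\<lambda>T. T \<cdot> \<Omega>) ` commutant M"
    then obtain T where T: "T \<in> commutant M" "v = T \<cdot> \<Omega>" by blast
    have "u \<cdot> (S o\<^sub>L T) \<cdot> \<Omega> = (S o\<^sub>L T) \<cdot> \<zeta>" by (rule u) (intro commutant_compose S T)
    then show "(u o\<^sub>L S) \<cdot> v = (S o\<^sub>L u) \<cdot> v" using u[OF T(1)] by (simp add: T(2))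
  qed simp
  have "u \<in> BH" unfolding BH_iff by (rule comm) (rule commutant_iop[OF M.subset_BH])
  then have uM: "u \<in> M" using comm by (rule M.in_algebraI)
  have "norm (u \<cdot> \<xi>) = norm \<xi>" for \<xi>
    by (rule commutant_dense_induct[of M]) (auto simp: u \<zeta> intro!: closed_Collect_eq continuous_intros)
  then have "inner (u \<cdot> \<xi>) (u \<cdot> \<xi>) = inner \<xi> \<xi>" for \<xi> by (simp add: dot_square_norm)
  then have "(radj u o\<^sub>L u) - id_blinfun = 0"
    by (intro selfadjoint_form_zero) (simp_all add: blinfun.diff_left inner_diff_left inner_radj')
  moreover have "u \<cdot> \<Omega> = \<zeta>" using u[OF commutant_id] by simp
  ultimately show ?thesis using uM by auto
qed

end

section \<open>Comparison of projections and Goldman's theorem\<close>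

context tracial_sub
begin

text \<open>Comparison of \<open>e\<close> with its complement in the factor
  \<open>commutant B\<close>. The operator \<open>W\<close> is the sum of a maximal orthogonal
  family of partial isometries from below \<open>e\<close> to below \<open>id_blinfun - e\<close>;
  if both projections had a remainder, \<open>factor_cut_nonzero\<close> and polar decomposition
  would supply a further member.\<close>

lemma comparison:
  assumes fac: "B \<inter> commutant B = range scalar_op"
  shows "\<exists>W\<in>commutant B. W o\<^sub>L radj W o\<^sub>L W = W \<and> e o\<^sub>L W = 0 \<and> W o\<^sub>L e = W \<and>
    (radj W o\<^sub>L W = e \<or> W o\<^sub>L radj W = id_blinfun - e)"
proof -
  interpret B': vna "commutant B" by standard (rule B.commutant_vna)
  note c = commutant_compose B.commutant_radj_closed commutant_diff commutant_id e_commutant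
  have fac': "commutant B \<inter> commutant (commutant B) = range scalar_op"
    using fac B.bicommutant by (simp add: Int_commute)
  define P where "P = {V \<in> commutant B. V o\<^sub>L radj V o\<^sub>L V = V \<and> e o\<^sub>L V = 0 \<and> V o\<^sub>L e = V \<and> V \<noteq> 0}"
  define R where "R U V \<longleftrightarrow> radj U o\<^sub>L V = 0 \<and> U o\<^sub>L radj V = 0" for U V :: "'h \<Rightarrow>\<^sub>L 'h"
  obtain \<W> where \<W>: "\<W> \<subseteq> P" "\<forall>U\<in>\<W>. \<forall>V\<in>\<W>. U \<noteq> V \<longrightarrow> R U V"
     "\<forall>U\<in>P. (\<forall>V\<in>\<W>. R U V \<and> R V U) \<longrightarrow> U \<in> \<W>"
    using ex_maximal_pairwise[of P R] by blast
  have P: "V \<in> commutant B" "V o\<^sub>L radj V o\<^sub>L V = V" "e o\<^sub>L V = 0" "V o\<^sub>L e = V" if "V \<in> \<W>" for V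
    using that \<W>(1) by (auto simp: P_def)
  have "\<exists>W\<in>commutant B. W o\<^sub>L radj W o\<^sub>L W = W \<and> (\<forall>U\<in>\<W>. W o\<^sub>L radj U o\<^sub>L U = U) \<and>
    (\<forall>U\<in>\<W>. radj W o\<^sub>L W o\<^sub>L radj U = radj U) \<and>
    (\<forall>P :: 'h \<Rightarrow>\<^sub>L 'h. (\<forall>U\<in>\<W>. P o\<^sub>L U = 0) \<longrightarrow> P o\<^sub>L W = 0) \<and>
    (\<forall>Q :: 'h \<Rightarrow>\<^sub>L 'h. (\<forall>U\<in>\<W>. U o\<^sub>L Q = 0) \<longrightarrow> W o\<^sub>L Q = 0)"
  proof (rule B'.sum_partial_isometries)
    show "radj U o\<^sub>L V = 0 \<and> U o\<^sub>L radj V = 0" if "U \<in> \<W>" "V \<in> \<W>" "U \<noteq> V" for U V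
      using \<W>(2) that unfolding R_def by blast
  qed (use P in auto)
  then obtain W where W: "W \<in> commutant B" "W o\<^sub>L radj W o\<^sub>L W = W"
    and WU: "\<forall>U\<in>\<W>. W o\<^sub>L radj U o\<^sub>L U = U" "\<forall>U\<in>\<W>. radj W o\<^sub>L W o\<^sub>L radj U = radj U"
    and WP: "\<forall>P :: 'h \<Rightarrow>\<^sub>L 'h. (\<forall>U\<in>\<W>. P o\<^sub>L U = 0) \<longrightarrow> P o\<^sub>L W = 0"
    and WQ: "\<forall>Q :: 'h \<Rightarrow>\<^sub>L 'h. (\<forall>U\<in>\<W>. U o\<^sub>L Q = 0) \<longrightarrow> W o\<^sub>L Q = 0"
    by blast
  have eW: "e o\<^sub>L W = 0" using WP P(3) by blast
  have "W o\<^sub>L (id_blinfun - e) = 0"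
    by (rule WQ[rule_format]) (simp add: blinfun_compose_linear P(4))
  then have We: "W o\<^sub>L e = W" by (simp add: blinfun_compose_linear)
  have "radj W o\<^sub>L W = e \<or> W o\<^sub>L radj W = id_blinfun - e"
  proof (rule ccontr)
    assume neg: "\<not> ?thesis"
    \<comment> \<open>\<open>Y\<close> and \<open>Q\<close> are the remainders of
      \<open>id_blinfun - e\<close> and \<open>e\<close> that the family leaves uncovered.\<close>
    define Y where "Y = (id_blinfun - e) - (W o\<^sub>L radj W)"
    define Q where "Q = e - (radj W o\<^sub>L W)"
    have "Y \<in> commutant B" "Y \<noteq> 0" "Q \<in> commutant B" "Q \<noteq> 0"
      using neg by (auto simp: Y_def Q_def intro!: c W)
    then obtain a where a: "a \<in> commutant B" "Y o\<^sub>L a o\<^sub>L Q \<noteq> 0"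
      using B'.factor_cut_nonzero[OF fac'] by blast
    have "Y o\<^sub>L a o\<^sub>L Q \<in> commutant B"
      by (intro commutant_compose a \<open>Y \<in> commutant B\<close> \<open>Q \<in> commutant B\<close>)
    from B'.polar_decomposition[OF this] obtain V where V: "V \<in> commutant B" "V o\<^sub>L radj V o\<^sub>L V = V"
      and V0: "\<forall>P :: 'h \<Rightarrow>\<^sub>L 'h. P o\<^sub>L (Y o\<^sub>L a o\<^sub>L Q) = 0 \<longrightarrow> P o\<^sub>L V = 0"
        "\<forall>S :: 'h \<Rightarrow>\<^sub>L 'h. Y o\<^sub>L a o\<^sub>L Q o\<^sub>L S = 0 \<longrightarrow> V o\<^sub>L S = 0" "V = 0 \<longrightarrow> Y o\<^sub>L a o\<^sub>L Q = 0"
      by blast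
    have Vne: "V \<noteq> 0" using V0(3) a(2) by blast
    have left: "S o\<^sub>L V = 0" if "S o\<^sub>L Y = 0" for S :: "'h \<Rightarrow>\<^sub>L 'h"
      by (rule V0(1)[rule_format]) (simp add: blinfun_compose_assoc[symmetric] that)
    have right: "V o\<^sub>L S = 0" if "Q o\<^sub>L S = 0" for S :: "'h \<Rightarrow>\<^sub>L 'h"
      by (rule V0(2)[rule_format]) (simp add: blinfun_compose_assoc that)
    have eV: "e o\<^sub>L V = 0"
      by (rule left) (simp add: Y_def blinfun_compose_linear blinfun_compose_assoc[symmetric] eW)
    have "V o\<^sub>L (id_blinfun - e) = 0"
      by (rule right) (simp add: Q_def blinfun_compose_linear blinfun_compose_assoc We)
    then have Ve: "V o\<^sub>L e = V" by (simp add: blinfun_compose_linear)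
    have UV: "radj U o\<^sub>L V = 0" "V o\<^sub>L radj U = 0" if U: "U \<in> \<W>" for U
    proof -
      have "W o\<^sub>L radj W o\<^sub>L U = W o\<^sub>L radj W o\<^sub>L (W o\<^sub>L radj U o\<^sub>L U)" using WU(1) U by simp
      also have "\<dots> = (W o\<^sub>L radj W o\<^sub>L W) o\<^sub>L radj U o\<^sub>L U" by (simp only: blinfun_compose_assoc)
      also have "\<dots> = U" using W(2) WU(1) U by simp
      finally have "radj (W o\<^sub>L radj W o\<^sub>L U) = radj U" by simp
      then have 1: "radj U o\<^sub>L (W o\<^sub>L radj W) = radj U" by simp
      have 2: "radj U o\<^sub>L e = 0" "e o\<^sub>L radj U = radj U"
        using arg_cong[OF P(3)[OF U], of radj] arg_cong[OF P(4)[OF U], of radj] by simp_all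
      show "radj U o\<^sub>L V = 0" by (rule left) (simp add: Y_def blinfun_compose_linear 1 2)
      show "V o\<^sub>L radj U = 0" by (rule right) (use WU(2) U in \<open>simp add: Q_def blinfun_compose_linear 2\<close>)
    qed
    have VU: "radj V o\<^sub>L U = 0" "U o\<^sub>L radj V = 0" if U: "U \<in> \<W>" for U
      using arg_cong[OF UV(1)[OF U], of radj] arg_cong[OF UV(2)[OF U], of radj] by simp_all
    have "V \<in> P" using V Vne eV Ve by (simp add: P_def)
    then have "V \<in> \<W>" using \<W>(3) UV VU by (auto simp: R_def)
    then have "radj V o\<^sub>L V = 0" by (rule UV)
    then show False using V(2) Vne by (simp add: blinfun_compose_assoc)
  qed
  then show ?thesis using W eW We by blast
qed

text \<open>The orthogonal projections \<open>e\<close> and \<open>W o\<^sub>L radj W\<close> have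
  trace 1 each, while the identity has trace at most 2. The remaining projection has trace 0 and
  vanishes by faithfulness.\<close>

lemma index_le_2_imp_coisometry:
  assumes emb: "module_embedding \<Omega> B I V" and le: "hs I V id_blinfun \<le> 2"
    and W: "W \<in> commutant B" "W o\<^sub>L radj W o\<^sub>L W = W" "e o\<^sub>L W = 0" "W o\<^sub>L e = W" "radj W o\<^sub>L W = e"
  shows "W o\<^sub>L radj W = id_blinfun - e"
proof -
  define f g where "f = W o\<^sub>L radj W" and "g = id_blinfun - e - f"
  have g: "g \<in> commutant B"
    unfolding g_def f_def
    by (intro commutant_diff commutant_compose commutant_id e_commutant B.commutant_radj_closed W)
  have eW': "radj W o\<^sub>L e = 0" "e o\<^sub>L radj W = radj W"
    using arg_cong[OF W(3), of radj] arg_cong[OF W(4), of radj] by simp_all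
  have ff: "f o\<^sub>L f = f" using W(2) by (simp add: f_def blinfun_compose_assoc[symmetric])
  have ef: "e o\<^sub>L f = 0" "f o\<^sub>L e = 0"
    by (simp_all add: f_def blinfun_compose_assoc eW' blinfun_compose_assoc[symmetric, of e] W(3))
  have rf: "radj f = f" by (simp add: f_def)
  have split: "(norm \<xi>)\<^sup>2 = (norm (e \<cdot> \<xi>))\<^sup>2 + (norm (radj W \<cdot> \<xi>))\<^sup>2 + (norm (g \<cdot> \<xi>))\<^sup>2" for \<xi>
  proof -
    have gg: "radj g o\<^sub>L g = g" by (simp add: g_def rf blinfun_compose_linear ff ef)
    note 1 = norm_e_sq[of \<xi>]
    have "(norm (g \<cdot> \<xi>))\<^sup>2 = inner ((radj g o\<^sub>L g) \<cdot> \<xi>) \<xi>" by (simp add: power2_norm_eq_inner inner_radj')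
    then have 2: "(norm (g \<cdot> \<xi>))\<^sup>2 = inner (g \<cdot> \<xi>) \<xi>" by (simp add: gg)
    have 3: "(norm (radj W \<cdot> \<xi>))\<^sup>2 = inner (f \<cdot> \<xi>) \<xi>" by (simp add: f_def power2_norm_eq_inner inner_radj)
    show ?thesis unfolding 1 2 3
      by (simp add: g_def blinfun.diff_left inner_diff_left power2_norm_eq_inner)
  qed
  have "hs I V id_blinfun = hs I V e + hs I V (radj W) + hs I V g"
    unfolding hs_def blinfun_apply_id_blinfun split[of "_ \<cdot> \<Omega>"]
    by (simp add: ennreal_plus infsum_add nonneg_summable_on_complete)
  moreover have "hs I V e = 1" using hs_proj[OF emb commutant_id] by simp
  moreover have "hs I V (radj W) = 1"
  proof -
    have "(norm (W \<cdot> \<Omega>))\<^sup>2 = inner ((radj W o\<^sub>L W) \<cdot> \<Omega>) \<Omega>" by (simp add: power2_norm_eq_inner inner_radj')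
    also have "\<dots> = 1" by (simp add: W(5) dot_square_norm)
    finally show ?thesis using hs_proj[OF emb B.commutant_radj_closed[OF W(1)]] by (simp add: eW')
  qed
  ultimately have "2 + hs I V g \<le> 2 + 0" using le by (simp add: one_add_one[symmetric] del: one_add_one)
  then have "hs I V g = 0" by (subst (asm) ennreal_add_left_cancel_le) auto
  then have "g = 0" by (rule hs_eq_0D[OF emb g])
  then show ?thesis by (simp add: g_def f_def)
qed

text \<open>Since \<open>u\<close> exchanges \<open>K\<close> with its complement, the conjugate of
  \<open>n\<close> commutes with \<open>e\<close>, so its value at \<open>\<Omega>\<close> lies in
  \<open>K\<close>.\<close>

lemma normalizer_if_exchanges:
  assumes u: "u \<in> M" "radj u o\<^sub>L u = id_blinfun" "u o\<^sub>L radj u = id_blinfun"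
    and ex: "e o\<^sub>L u = u o\<^sub>L (id_blinfun - e)" and n: "n \<in> B"
  shows "u o\<^sub>L n o\<^sub>L radj u \<in> B"
proof -
  have y: "u o\<^sub>L n o\<^sub>L radj u \<in> M" by (intro M.compose_closed M.radj_closed u(1)) (rule BM[OF n])
  have ex': "(id_blinfun - e) o\<^sub>L radj u = radj u o\<^sub>L e" using arg_cong[OF ex, of radj] by simp
  have en: "(id_blinfun - e) o\<^sub>L n = n o\<^sub>L (id_blinfun - e)"
    using e_commute_B[OF n] by (simp add: blinfun_compose_linear)
  have "e o\<^sub>L (u o\<^sub>L n o\<^sub>L radj u) = u o\<^sub>L ((id_blinfun - e) o\<^sub>L n) o\<^sub>L radj u"
    by (simp only: blinfun_compose_assoc[symmetric] ex)
  also have "\<dots> = u o\<^sub>L n o\<^sub>L ((id_blinfun - e) o\<^sub>L radj u)" by (simp only: en blinfun_compose_assoc)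
  also have "\<dots> = (u o\<^sub>L n o\<^sub>L radj u) o\<^sub>L e" by (simp only: ex' blinfun_compose_assoc)
  finally have "e \<cdot> (u o\<^sub>L n o\<^sub>L radj u) \<cdot> \<Omega> = (u o\<^sub>L n o\<^sub>L radj u) \<cdot> e \<cdot> \<Omega>"
    by (metis blinfun_apply_blinfun_compose)
  then have "(u o\<^sub>L n o\<^sub>L radj u) \<cdot> \<Omega> \<in> K" by (metis e_Omega e_fix_iff)
  then show ?thesis by (rule in_B_if_vec_in_K[OF y])
qed

text \<open>This is Goldman's theorem: a subfactor of index at most 2 is regular, hence not singular. For
  index at most 2 the bimodule \<open>L\<^sup>2(M) \<ominus> L\<^sup>2(B)\<close> is generated by one vector, which the uniqueness of the
  trace shows to be a multiple of a unitary that normalizes \<open>B\<close>.\<close>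

lemma singular_imp_index_gt_2:
  assumes facM: "M \<inter> commutant M = range scalar_op" and facB: "B \<inter> commutant B = range scalar_op"
    and fin: "\<And>v. v \<in> M \<Longrightarrow> radj v o\<^sub>L v = id_blinfun \<Longrightarrow> v o\<^sub>L radj v = id_blinfun"
    and sing: "singular_in B M" and proper: "e \<noteq> id_blinfun"
  shows "jones_index \<Omega> B > 2"
proof (rule ccontr)
  assume "\<not> ?thesis"
  then have le: "jones_index \<Omega> B \<le> 2" by simp
  obtain I V where emb: "module_embedding \<Omega> B I V" using module_embedding_exists by blast
  have le': "hs I V id_blinfun \<le> 2" using le jones_index_eq[OF emb] by simp
  obtain W where W: "W \<in> commutant B" "W o\<^sub>L radj W o\<^sub>L W = W" "e o\<^sub>L W = 0" "W o\<^sub>L e = W"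
    "radj W o\<^sub>L W = e \<or> W o\<^sub>L radj W = id_blinfun - e"
    using comparison[OF facB] by blast
  \<comment> \<open>In the first alternative of the comparison, the trace count for index at most 2
    gives the second one too.\<close>
  have WW: "W o\<^sub>L radj W = id_blinfun - e"
    using W(5) index_le_2_imp_coisometry[OF emb le' W(1-4)] by blast
  define \<zeta> where "\<zeta> = W \<cdot> \<Omega>"
  have e\<zeta>: "e \<cdot> \<zeta> = 0" using arg_cong[OF W(3), of "\<lambda>T. T \<cdot> \<Omega>"] by (simp add: \<zeta>_def)
  have ne: "\<Omega> \<noteq> \<zeta>" using e\<zeta> e_Omega norm_Omega by (metis norm_zero zero_neq_one)
  \<comment> \<open>The space is the sum of \<open>K\<close> and a complement that
    \<open>radj W\<close> maps isometrically into \<open>K\<close>. This is a module embedding with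
    two components, indexed by the distinct vectors \<open>\<Omega>\<close> and
    \<open>\<zeta>\<close>.\<close>
  define V' where "V' i = (if i = \<Omega> then e else radj W)" for i
  have eW': "e o\<^sub>L radj W = radj W" using arg_cong[OF W(4), of radj] by simp
  have emb': "module_embedding \<Omega> B {\<Omega>, \<zeta>} V'"
    unfolding module_embedding_iff
  proof (intro conjI ballI allI)
    fix i assume "i \<in> {\<Omega>, \<zeta>}"
    show "V' i \<in> commutant B" "e o\<^sub>L V' i = V' i"
      by (simp_all add: V'_def e_commutant B.commutant_radj_closed W(1) eW')
  next
    fix \<xi>
    have "(norm (radj W \<cdot> \<xi>))\<^sup>2 = inner ((W o\<^sub>L radj W) \<cdot> \<xi>) \<xi>" by (simp add: power2_norm_eq_inner inner_radj)
    then have "(norm \<xi>)\<^sup>2 = (norm (e \<cdot> \<xi>))\<^sup>2 + (norm (radj W \<cdot> \<xi>))\<^sup>2"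
      using norm_e_sq[of \<xi>] by (simp add: WW blinfun.diff_left inner_diff_left power2_norm_eq_inner)
    then show "((\<lambda>i. (norm (V' i \<cdot> \<xi>))\<^sup>2) has_sum (norm \<xi>)\<^sup>2) {\<Omega>, \<zeta>}"
      by (intro has_sum_finiteI) (use ne in \<open>auto simp: V'_def\<close>)
  qed
  have hs': "hs {\<Omega>, \<zeta>} V' X = ennreal ((norm (X \<cdot> \<Omega>))\<^sup>2) + ennreal ((norm (X \<cdot> \<zeta>))\<^sup>2)" for X
    using ne by (simp add: hs_def V'_def) (simp add: \<zeta>_def)
  interpret MM: tracial_sub M \<tau> \<Omega> M by unfold_locales simp
  have KM: "\<xi> \<in> MM.K" for \<xi> using dense by (simp add: MM.K_closure)
  \<comment> \<open>For the two-component embedding \<open>hs\<close> is the sum of the squared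
    norms at \<open>\<Omega>\<close> and \<open>\<zeta>\<close>. Both the sum and its first term are
    invariant under adjoints, so the second term is.\<close>
  have tr\<zeta>: "norm (radj T \<cdot> \<zeta>) = norm (T \<cdot> \<zeta>)" if T: "T \<in> commutant M" for T
  proof -
    have "norm (radj T \<cdot> \<Omega>) = norm (T \<cdot> \<Omega>)" by (rule MM.norm_radj_Omega[OF T]) (rule KM)+
    then have "ennreal ((norm (radj T \<cdot> \<zeta>))\<^sup>2) = ennreal ((norm (T \<cdot> \<zeta>))\<^sup>2)"
      using hs_radj[OF emb' emb' commutant_M_B[OF T]] by (simp add: hs' ennreal_add_left_cancel)
    then show ?thesis by simp
  qed
  define d where "d = norm \<zeta>"
  have scale: "norm (T \<cdot> \<zeta>) = d * norm (T \<cdot> \<Omega>)" if T: "T \<in> commutant M" for T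
  proof -
    have "(norm (T \<cdot> \<zeta>))\<^sup>2 = (d * norm (T \<cdot> \<Omega>))\<^sup>2"
      using tracial_vector_proportional[OF facM tr\<zeta> T] by (simp add: d_def power_mult_distrib)
    then show ?thesis by (simp add: d_def power2_eq_iff_nonneg)
  qed
  have B\<zeta>: "W \<cdot> b \<cdot> \<Omega> = b \<cdot> \<zeta>" if "b \<in> B" for b
    unfolding \<zeta>_def by (rule B.commutant_commutes_apply[OF W(1) that])
  have WeqI: "W = X o\<^sub>L e" if X: "\<And>b. b \<in> B \<Longrightarrow> X \<cdot> b \<cdot> \<Omega> = b \<cdot> \<zeta>" for X
  proof (rule blinfun_eqI)
    fix \<xi>
    have "W \<cdot> e \<cdot> \<xi> = X \<cdot> e \<cdot> \<xi>" by (rule eq_on_K[OF _ e_in]) (simp add: X B\<zeta>)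
    then show "W \<cdot> \<xi> = (X o\<^sub>L e) \<cdot> \<xi>" using W(4) by (metis blinfun_apply_blinfun_compose)
  qed
  have d0: "d > 0"
  proof (rule ccontr)
    assume "\<not> ?thesis"
    then have "\<zeta> = 0" by (simp add: d_def)
    then have "W = 0" using WeqI[of 0] by simp
    then show False using WW proper by simp
  qed
  have "norm (T \<cdot> ((1 / d) *\<^sub>R \<zeta>)) = norm (T \<cdot> \<Omega>)" if "T \<in> commutant M" for T
    using scale[OF that] d0 by (simp add: blinfun.scaleR_right)
  then obtain u where u: "u \<in> M" "radj u o\<^sub>L u = id_blinfun" "u \<cdot> \<Omega> = (1 / d) *\<^sub>R \<zeta>"
    using tracial_vector_isometry by blast
  have u': "u o\<^sub>L radj u = id_blinfun" by (rule fin[OF u(1,2)])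
  \<comment> \<open>Right multiplication by \<open>u\<close>. It agrees with \<open>W\<close> on
    \<open>K\<close> up to the factor \<open>d\<close>, since both commute with \<open>B\<close> and
    their values at \<open>\<Omega>\<close> are proportional.\<close>
  define U where "U = cj (radj u)"
  have U: "U \<in> commutant M" "U o\<^sub>L radj U = id_blinfun" "radj U o\<^sub>L U = id_blinfun"
    using cj_in_commutant[OF M.radj_closed[OF u(1)]] u(2) u'
    by (simp_all add: U_def radj_cj cj_compose[symmetric])
  have UO: "U \<cdot> \<Omega> = (1 / d) *\<^sub>R \<zeta>" using cj_radj_Omega[OF u(1)] u(3) by (simp add: U_def)
  have "W = (d *\<^sub>R U) o\<^sub>L e"
  proof (rule WeqI)
    fix b assume b: "b \<in> B"
    have "U \<cdot> b \<cdot> \<Omega> = b \<cdot> U \<cdot> \<Omega>" by (rule M.commutant_commutes_apply[OF U(1) BM[OF b]])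
    then show "(d *\<^sub>R U) \<cdot> b \<cdot> \<Omega> = b \<cdot> \<zeta>" using d0 by (simp add: UO blinfun.scaleR_left blinfun.scaleR_right)
  qed
  then have "W o\<^sub>L radj W = (d * d) *\<^sub>R (U o\<^sub>L (e o\<^sub>L e) o\<^sub>L radj U)"
    by (simp only: radj_compose radj_scaleR radj_e blinfun_compose_linear blinfun_compose_assoc scaleR_scaleR)
  then have WW2: "id_blinfun - e = (d * d) *\<^sub>R (U o\<^sub>L e o\<^sub>L radj U)" by (simp add: WW)
  have "(U o\<^sub>L e o\<^sub>L radj U) o\<^sub>L (U o\<^sub>L e o\<^sub>L radj U) = U o\<^sub>L e o\<^sub>L (radj U o\<^sub>L U) o\<^sub>L e o\<^sub>L radj U"
    by (simp only: blinfun_compose_assoc)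
  also have "\<dots> = U o\<^sub>L (e o\<^sub>L e) o\<^sub>L radj U" by (simp only: U(3) blinfun_compose_id_right blinfun_compose_assoc)
  finally have idem: "(U o\<^sub>L e o\<^sub>L radj U) o\<^sub>L (U o\<^sub>L e o\<^sub>L radj U) = U o\<^sub>L e o\<^sub>L radj U" by simp
  \<comment> \<open>A nonzero projection is \<open>d * d\<close> times another projection here,
    which forces \<open>d * d = 1\<close>.\<close>
  have "(id_blinfun - e) o\<^sub>L (id_blinfun - e) = id_blinfun - e" by (simp add: blinfun_compose_linear)
  then have "(d * d) *\<^sub>R (id_blinfun - e) = id_blinfun - e"
    unfolding WW2 by (simp add: blinfun_compose_linear idem)
  then have "((d * d) - 1) *\<^sub>R (id_blinfun - e) = 0" by (simp add: scaleR_diff_left)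
  then have dd: "d * d = 1" using proper by simp
  then have "d = 1" using d0 by (metis abs_of_pos abs_square_eq_1 power2_eq_square)
  have ex0: "id_blinfun - e = U o\<^sub>L e o\<^sub>L radj U" using WW2 dd by simp
  \<comment> \<open>Back from right to left multiplications: \<open>cj\<close> turns
    \<open>U\<close> into \<open>radj u\<close>, and the relation says that \<open>u\<close>
    exchanges \<open>K\<close> with its complement.\<close>
  then have "cj (id_blinfun - e) = cj (U o\<^sub>L e o\<^sub>L radj U)" by simp
  then have ex: "id_blinfun - e = radj u o\<^sub>L e o\<^sub>L u"
    by (simp add: cj_diff cj_compose U_def radj_cj)
  have ex1: "e o\<^sub>L u = u o\<^sub>L (id_blinfun - e)"
  proof -
    have "u o\<^sub>L (id_blinfun - e) = (u o\<^sub>L radj u) o\<^sub>L e o\<^sub>L u" by (simp only: ex blinfun_compose_assoc)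
    then show ?thesis by (simp add: u')
  qed
  have ex2: "e o\<^sub>L radj u = radj u o\<^sub>L (id_blinfun - e)"
  proof -
    have "radj (e o\<^sub>L u) = radj (u o\<^sub>L (id_blinfun - e))" by (simp only: ex1)
    then show ?thesis by (simp add: blinfun_compose_linear algebra_simps)
  qed
  have n1: "u o\<^sub>L n o\<^sub>L radj u \<in> B" if "n \<in> B" for n
    by (rule normalizer_if_exchanges[OF u(1,2) u' ex1 that])
  have n2: "radj u o\<^sub>L n o\<^sub>L u \<in> B" if "n \<in> B" for n
    using normalizer_if_exchanges[OF M.radj_closed[OF u(1)] _ _ ex2 that] u(2) u' by simp
  have "conjugate u B = B"
  proof
    show "conjugate u B \<subseteq> B" using n1 by (auto simp: conjugate_def M.adj_radj[OF u(1)])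
    show "B \<subseteq> conjugate u B"
    proof
      fix b assume b: "b \<in> B"
      have "u o\<^sub>L (radj u o\<^sub>L b o\<^sub>L u) o\<^sub>L adj u = (u o\<^sub>L radj u) o\<^sub>L b o\<^sub>L (u o\<^sub>L radj u)"
        by (simp only: M.adj_radj[OF u(1)] blinfun_compose_assoc)
      then have "b = u o\<^sub>L (radj u o\<^sub>L b o\<^sub>L u) o\<^sub>L adj u" by (simp add: u')
      then show "b \<in> conjugate u B" unfolding conjugate_def using n2[OF b] by blast
    qed
  qed
  moreover have "u \<in> unitaries M" using u u' by (simp add: M.unitaries_iff)
  ultimately have "u \<in> B" using sing by (simp add: singular_in_def)
  \<comment> \<open>Membership of \<open>u\<close> in \<open>B\<close> puts \<open>\<zeta>\<close>
    into \<open>K\<close>, while \<open>\<zeta>\<close> is orthogonal to \<open>K\<close>.\<close>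
  then have "e \<cdot> u \<cdot> \<Omega> = u \<cdot> \<Omega>" by (intro e_fix vec_in_K)
  then have "\<zeta> = 0" using e\<zeta> \<open>d = 1\<close> u(3) by simp
  then show False using d0 by (simp add: d_def)
qed

end

section \<open>Strong singularity\<close>

lemma commutant_conjugate:
  assumes u: "u \<in> BH" "radj u o\<^sub>L u = id_blinfun" "u o\<^sub>L radj u = id_blinfun"
  shows "commutant (conjugate u S) = conjugate u (commutant S)"
proof -
  define F where "F x = u o\<^sub>L x o\<^sub>L radj u" for x
  have conj: "conjugate u X = F ` X" for X by (simp add: conjugate_def adj_eq_radj[OF u(1)] F_def)
  have FF: "F x o\<^sub>L F y = F (x o\<^sub>L y)" for x y
  proof -
    have "F x o\<^sub>L F y = u o\<^sub>L x o\<^sub>L (radj u o\<^sub>L u) o\<^sub>L y o\<^sub>L radj u" by (simp only: F_def blinfun_compose_assoc)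
    then show ?thesis by (simp add: u F_def blinfun_compose_assoc)
  qed
  define F' where "F' x = radj u o\<^sub>L x o\<^sub>L u" for x
  have FF': "F (F' x) = x" "F' (F x) = x" for x
  proof -
    have "F (F' x) = (u o\<^sub>L radj u) o\<^sub>L x o\<^sub>L (u o\<^sub>L radj u)" "F' (F x) = (radj u o\<^sub>L u) o\<^sub>L x o\<^sub>L (radj u o\<^sub>L u)"
      by (simp_all only: F_def F'_def blinfun_compose_assoc)
    then show "F (F' x) = x" "F' (F x) = x" by (simp_all add: u)
  qed
  have BH: "F x \<in> BH" "F' x \<in> BH" if "x \<in> BH" for x
    using that u(1) by (simp_all add: F_def F'_def BH_compose)
  show ?thesis unfolding conj
  proof
    show "F ` commutant S \<subseteq> commutant (F ` S)"
      by (auto simp: commutant_iff BH FF)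
    show "commutant (F ` S) \<subseteq> F ` commutant S"
    proof
      fix T assume T: "T \<in> commutant (F ` S)"
      have "F' T o\<^sub>L x = x o\<^sub>L F' T" if x: "x \<in> S" for x
      proof -
        have "F (F' T) o\<^sub>L F x = F x o\<^sub>L F (F' T)" using T x by (simp add: commutant_iff FF')
        then have "F' (F (F' T o\<^sub>L x)) = F' (F (x o\<^sub>L F' T))" by (simp only: FF)
        then show ?thesis by (simp only: FF')
      qed
      then have "F' T \<in> commutant S" using T by (simp add: commutant_iff BH)
      then show "T \<in> F ` commutant S" using FF'(1)[of T] by (metis image_eqI)
    qed
  qed
qed

lemma (in vna) conjugate_vna:
  assumes u: "u \<in> BH" "radj u o\<^sub>L u = id_blinfun" "u o\<^sub>L radj u = id_blinfun"
  shows "von_neumann_algebra (conjugate u A)"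
  unfolding von_neumann_algebra_def
proof (intro conjI ballI)
  show "commutant (commutant (conjugate u A)) = conjugate u A"
    by (simp only: commutant_conjugate[OF u] bicommutant)
  fix x assume "x \<in> conjugate u A"
  then obtain a where a: "a \<in> A" "x = u o\<^sub>L a o\<^sub>L radj u" by (auto simp: conjugate_def adj_eq_radj[OF u(1)])
  have "x \<in> BH" unfolding a(2) by (intro BH_compose u(1) in_BH a(1) BH_radj)
  then have "adj x = u o\<^sub>L radj a o\<^sub>L radj u" by (simp add: adj_eq_radj a(2) blinfun_compose_assoc)
  then show "adj x \<in> conjugate u A" using radj_closed[OF a(1)] by (auto simp: conjugate_def adj_eq_radj[OF u(1)])
qed

lemma has_sum_if_infsum_ennreal:
  assumes "(\<Sum>\<^sub>\<infinity>x\<in>A. ennreal (f x)) = ennreal s" "\<And>x. x \<in> A \<Longrightarrow> 0 \<le> f x" "0 \<le> s"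
  shows "(f has_sum s) A"
proof -
  have "sum f F \<le> s" if F: "finite F" "F \<subseteq> A" for F
  proof -
    have "ennreal (sum f F) = (\<Sum>x\<in>F. ennreal (f x))" using assms(2) F by (intro sum_ennreal[symmetric]) auto
    also have "\<dots> \<le> ennreal s" unfolding assms(1)[symmetric] by (rule finite_sum_le_infsum_ennreal[OF F])
    finally show ?thesis using assms(3) by simp
  qed
  then have "f summable_on A"
    by (intro nonneg_bdd_above_summable_on assms(2)) (auto intro!: bdd_aboveI2)
  then have f: "(f has_sum infsum f A) A" by simp
  then have "ennreal (infsum f A) = ennreal s" using has_sum_ennreal[OF f] assms(1,2) by simp
  then have "infsum f A = s" using assms(2,3) by (simp add: infsum_nonneg)
  then show ?thesis using f by simp
qed

text \<open>The identity and \<open>p\<close> are independent, and dimension 2 leaves no room for a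
  third independent element.\<close>

lemma dim_two_span:
  assumes dim: "cop.dim D = 2" and D: "id_blinfun \<in> D" "p \<in> D" and ind: "p \<notin> range scalar_op"
    and x: "x \<in> D" and nz: "(id_blinfun :: 'h::complex_hilbert_space \<Rightarrow>\<^sub>L 'h) \<noteq> 0"
  shows "\<exists>\<alpha> \<beta>. x = scalar_op \<alpha> + op_scale \<beta> (p :: 'h \<Rightarrow>\<^sub>L 'h)"
proof -
  have sc: "op_scale k id_blinfun = (scalar_op k :: 'h \<Rightarrow>\<^sub>L 'h)" for k by (simp add: op_scale_def)
  obtain S where S: "S \<subseteq> D" "cop.independent S" "D \<subseteq> cop.span S" "card S = cop.dim D"
    using cop.basis_exists by blast
  \<comment> \<open>An infinite set has \<open>card\<close> 0, so the value 2 forces the basis to be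
    finite.\<close>
  have finS: "finite S" using S(4) dim by (metis card.infinite zero_neq_numeral)
  have "p \<notin> cop.span {id_blinfun}" using ind by (auto simp: cop.span_singleton sc)
  moreover have "cop.independent {id_blinfun :: 'h \<Rightarrow>\<^sub>L 'h}" using nz by simp
  ultimately have i2: "cop.independent {p, id_blinfun}" by (rule cop.independent_insertI)
  have pid: "p \<noteq> id_blinfun" using ind sc[of 1] by (metis cop.scale_one rangeI)
  have "x \<in> cop.span {p, id_blinfun}"
  proof (rule ccontr)
    assume nx: "x \<notin> cop.span {p, id_blinfun}"
    then have "cop.independent {x, p, id_blinfun}" using i2 by (rule cop.independent_insertI)
    then have "card {x, p, id_blinfun} \<le> card S"
      using cop.independent_span_bound[OF finS] S(3) D x by blast
    moreover have "x \<noteq> p" "x \<noteq> id_blinfun" using nx cop.span_base[of _ "{p, id_blinfun}"] by auto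
    ultimately show False using pid S(4) dim by simp
  qed
  then obtain \<beta> \<alpha> where "x - op_scale \<beta> p - op_scale \<alpha> id_blinfun = 0"
    by (auto simp: cop.span_breakdown_eq)
  then have "x = scalar_op \<alpha> + op_scale \<beta> p" by (simp add: sc algebra_simps)
  then show ?thesis by blast
qed

section \<open>The averaged projection and the distance of two expectations\<close>

context tracial_sub
begin

text \<open>Membership is tested in each von Neumann algebra containing \<open>M\<close> and
  \<open>e\<close> separately, where strong limits can be taken.\<close>

lemma basic_construction_eq:
  "T \<in> basic_construction \<Omega> M B \<longleftrightarrow> (\<forall>A. von_neumann_algebra A \<and> e \<in> A \<and> M \<subseteq> A \<longrightarrow> T \<in> A)"
  by (auto simp: basic_construction_def generated_vna_def jones_projection_eq)

text \<open>The average \<open>h\<close> of the projections \<open>w u e u\<^sup>* w\<^sup>*\<close> over the unitaries \<open>w\<close> of \<open>B\<close> lies in the relative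
  commutant, hence \<open>h = a e + b (1 - e)\<close>. Everything is conjugated by \<open>J\<close>, so that the operators are in
  the commutant of \<open>B\<close>, where the trace lives.\<close>

lemma average_of_conjugates:
  assumes emb: "module_embedding \<Omega> B I V"
    and two: "\<And>T. T \<in> commutant B \<Longrightarrow> T \<in> basic_construction \<Omega> M B \<Longrightarrow>
      \<exists>\<alpha> \<beta>. T = scalar_op \<alpha> + op_scale \<beta> e"
    and proper: "e \<noteq> id_blinfun" and u: "u \<in> unitaries M"
  defines "a \<equiv> (norm (e \<cdot> u \<cdot> \<Omega>))\<^sup>2"
  shows "\<exists>b\<ge>0. (\<forall>F. finite F \<longrightarrow> F \<subseteq> I \<longrightarrow>
      (\<Sum>i\<in>F. a * (norm (e \<cdot> radj (V i) \<cdot> \<Omega>))\<^sup>2 +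
        b * ((norm (radj (V i) \<cdot> \<Omega>))\<^sup>2 - (norm (e \<cdot> radj (V i) \<cdot> \<Omega>))\<^sup>2)) \<le> 1) \<and>
    (\<forall>\<epsilon>>0. \<exists>w\<in>unitaries B. (norm (e \<cdot> radj u \<cdot> w \<cdot> u \<cdot> \<Omega>))\<^sup>2 < a * a + b * (1 - a) + \<epsilon>)"
proof -
  have uu: "u \<in> M" "radj u o\<^sub>L u = id_blinfun" "u o\<^sub>L radj u = id_blinfun"
    using u by (auto simp: M.unitaries_iff)
  \<comment> \<open>Right multiplication by \<open>radj u\<close>. Thus \<open>p\<close> is the
    image under \<open>cj\<close> of the projection \<open>u o\<^sub>L e o\<^sub>L radj u\<close>,
    and \<open>G\<close> is the image of the unitaries of \<open>B\<close>.\<close>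
  define U where "U = cj u"
  have U: "U \<in> commutant M" "radj U o\<^sub>L U = id_blinfun" "U o\<^sub>L radj U = id_blinfun"
    using cj_in_commutant uu by (simp_all add: U_def radj_cj flip: cj_compose)
  have UB: "U \<in> commutant B" "radj U \<in> commutant B"
    using commutant_M_B[OF U(1)] B.commutant_radj_closed by auto
  define p where "p = U o\<^sub>L e o\<^sub>L radj U"
  define G where "G = cj ` unitaries B"
  have G: "g \<in> commutant M" "radj g o\<^sub>L g = id_blinfun" if g: "g \<in> G" for g
  proof -
    obtain w where w: "w \<in> B" "radj w o\<^sub>L w = id_blinfun" "g = cj w" using g by (auto simp: G_def B.unitaries_iff)
    show "g \<in> commutant M" using cj_in_commutant[OF BM[OF w(1)]] w(3) by simp
    show "radj g o\<^sub>L g = id_blinfun" using w(2) by (simp add: w(3) radj_cj flip: cj_compose)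
  qed
  have GB: "g \<in> commutant B" "radj g \<in> commutant B" if "g \<in> G" for g
    using commutant_M_B[OF G(1)[OF that]] B.commutant_radj_closed by auto
  have GG: "g o\<^sub>L h \<in> G" if gh: "g \<in> G" "h \<in> G" for g h
  proof -
    obtain w v where w: "w \<in> unitaries B" "g = cj w" and v: "v \<in> unitaries B" "h = cj v"
      using gh by (auto simp: G_def)
    have "w o\<^sub>L v \<in> unitaries B" by (rule B.unitaries_compose[OF w(1) v(1)])
    then show ?thesis by (simp add: G_def w(2) v(2) flip: cj_compose)
  qed
  have idG: "id_blinfun \<in> G" unfolding G_def
    by (rule image_eqI[OF _ B.unitaries_id]) simp
  have form: "inner ((g o\<^sub>L p o\<^sub>L radj g) \<cdot> \<xi>) \<xi> = (norm (e \<cdot> radj U \<cdot> radj g \<cdot> \<xi>))\<^sup>2" for g \<xi>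
    by (simp add: p_def power2_norm_eq_inner inner_e inner_radj)
  have hs_e: "hs I V (e o\<^sub>L radj X) = 1" if X: "X \<in> commutant B" "radj X o\<^sub>L X = id_blinfun" for X
    using hs_proj[OF emb B.commutant_radj_closed[OF X(1)]] by (simp add: norm_isometry[OF X(2)])
  have pB: "p \<in> commutant B" unfolding p_def by (intro commutant_compose UB e_commutant)
  have np: "norm p \<le> 1"
  proof (rule norm_blinfun_bound)
    fix \<xi>
    have "norm (p \<cdot> \<xi>) = norm (e \<cdot> radj U \<cdot> \<xi>)" by (simp add: p_def norm_isometry[OF U(2)])
    also have "\<dots> \<le> norm (radj U \<cdot> \<xi>)" by (rule norm_e_le)
    also have "\<dots> = norm \<xi>" by (rule norm_isometry) (simp add: U(3))
    finally show "norm (p \<cdot> \<xi>) \<le> 1 * norm \<xi>" by simp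
  qed simp
  have "hs I V p = 1"
    unfolding p_def blinfun_compose_assoc by (simp add: hs_isometry[OF emb U(2)] hs_e UB U)
  then have hsp: "hs I V p < \<infinity>" by simp
  obtain x h where x: "\<And>n :: nat. x n \<in> convex hull ((\<lambda>g. g o\<^sub>L p o\<^sub>L radj g) ` G)"
    and lim: "\<And>\<xi>. (\<lambda>n. x n \<cdot> \<xi>) \<longlonglongrightarrow> h \<cdot> \<xi>" and h: "h \<in> commutant B" "\<And>g. g \<in> G \<Longrightarrow> h o\<^sub>L g = g o\<^sub>L h"
    by (rule averaging[OF emb GB(1) G(2) GG idG pB np hsp], assumption+) (rule that)
  have hull: "P (x n)" if "convex {X. P X}" "\<And>g. g \<in> G \<Longrightarrow> P (g o\<^sub>L p o\<^sub>L radj g)" for P n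
  proof -
    have "convex hull ((\<lambda>g. g o\<^sub>L p o\<^sub>L radj g) ` G) \<subseteq> {X. P X}"
      by (rule hull_minimal) (use that in auto)
    then show ?thesis using x[of n] by blast
  qed
  have limf: "(\<lambda>n. inner (x n \<cdot> \<xi>) \<xi>) \<longlonglongrightarrow> inner (h \<cdot> \<xi>) \<xi>" for \<xi> by (intro tendsto_intros lim)
  have cj_lin: "linear cj" by (rule linearI) (simp_all add: cj_add cj_scaleR)
  have cjh: "cj h \<in> commutant B"
  proof -
    have BH: "cj h \<in> BH" using h(1) commutant_BH cj_BH by blast
    have "cj h o\<^sub>L w = w o\<^sub>L cj h" if w: "w \<in> unitaries B" for w
    proof -
      have "cj (h o\<^sub>L cj w) = cj (cj w o\<^sub>L h)" using h(2)[of "cj w"] w by (simp add: G_def)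
      then show ?thesis by (simp add: cj_compose)
    qed
    then have "cj h o\<^sub>L y = y o\<^sub>L cj h" if "y \<in> B" for y
      using B.commutes_if_commutes_unitaries[OF BH _ that] by blast
    then show ?thesis using BH by (simp add: commutant_iff)
  qed
  \<comment> \<open>Conjugated back by \<open>J\<close>, the averages are formed from
    \<open>M\<close> and \<open>e\<close>, and their strong limit stays in every von Neumann algebra
    containing these.\<close>
  have "cj h \<in> basic_construction \<Omega> M B"
    unfolding basic_construction_eq
  proof (intro allI impI, elim conjE)
    fix A assume A: "von_neumann_algebra A" "e \<in> A" "M \<subseteq> A"
    interpret A: vna A by standard (rule A(1))
    have "cj (x n) \<in> A" for n
    proof (rule hull)
      show "convex {X. cj X \<in> A}"
        by (rule convexI) (simp add: cj_add cj_scaleR A.add_closed A.scaleR_closed)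
      fix g assume "g \<in> G"
      then obtain w where w: "w \<in> B" "g = cj w" by (auto simp: G_def B.unitaries_iff)
      have "cj (g o\<^sub>L p o\<^sub>L radj g) = w o\<^sub>L (u o\<^sub>L e o\<^sub>L radj u) o\<^sub>L radj w"
        by (simp add: p_def U_def w(2) cj_compose radj_cj)
      also have "\<dots> \<in> A" using A(3) BM[OF w(1)] uu(1)
        by (intro A.compose_closed A(2) A.radj_closed) auto
      finally show "cj (g o\<^sub>L p o\<^sub>L radj g) \<in> A" .
    qed
    then show "cj h \<in> A"
      by (rule A.strong_limit_closed) (unfold cj_apply, rule blinfun.tendsto[OF tendsto_const lim])
  qed
  from two[OF cjh this] obtain \<alpha> \<beta> where ab: "cj h = scalar_op \<alpha> + op_scale \<beta> e" by blast
  \<comment> \<open>The coefficients of \<open>h\<close> on the complement of \<open>K\<close> and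
    on \<open>K\<close>. Only the real quadratic form of \<open>h\<close> is used, so real parts
    suffice.\<close>
  define b where "b = Re \<alpha>"
  define a' where "a' = Re \<alpha> + Re \<beta>"
  have hform: "inner (h \<cdot> \<xi>) \<xi> = a' * (norm (e \<cdot> \<xi>))\<^sup>2 + b * ((norm \<xi>)\<^sup>2 - (norm (e \<cdot> \<xi>))\<^sup>2)" for \<xi>
  proof -
    define \<eta> where "\<eta> = J \<cdot> \<xi>"
    have "cinner (e \<cdot> \<eta>) \<eta> = cinner (e \<cdot> e \<cdot> \<eta>) \<eta>" by simp
    also have "\<dots> = cinner (e \<cdot> \<eta>) (e \<cdot> \<eta>)" by (simp only: cinner_radj[OF e_BH] radj_e)
    finally have ee: "cinner (e \<cdot> \<eta>) \<eta> = complex_of_real ((norm (e \<cdot> \<eta>))\<^sup>2)" by (simp add: cinner_self)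
    have "inner (h \<cdot> \<xi>) \<xi> = inner (cj h \<cdot> \<eta>) \<eta>" by (simp add: \<eta>_def inner_J)
    also have "\<dots> = Re \<alpha> * (norm \<eta>)\<^sup>2 + Re \<beta> * (norm (e \<cdot> \<eta>))\<^sup>2"
      unfolding ab inner_eq_Re_cinner
      by (simp add: blinfun.add_left cinner_add_left cinner_scaleC_left ee cinner_self)
    finally show ?thesis by (simp add: \<eta>_def e_J_apply a'_def b_def algebra_simps)
  qed
  have conv_eq: "convex {X :: 'h \<Rightarrow>\<^sub>L 'h. inner (X \<cdot> \<xi>) \<xi> = c}" for \<xi> c
    by (rule convexI) (simp add: blinfun.add_left blinfun.scaleR_left inner_add_left flip: distrib_right)
  have conv_ge: "convex {X :: 'h \<Rightarrow>\<^sub>L 'h. c \<le> inner (X \<cdot> \<xi>) \<xi>}" for \<xi> c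
  proof (rule convexI)
    fix X Y :: "'h \<Rightarrow>\<^sub>L 'h" and s t :: real
    assume XY: "X \<in> {X. c \<le> inner (X \<cdot> \<xi>) \<xi>}" "Y \<in> {X. c \<le> inner (X \<cdot> \<xi>) \<xi>}"
      and st: "0 \<le> s" "0 \<le> t" "s + t = 1"
    have "c = s * c + t * c" using st(3) by (simp flip: distrib_right)
    also have "\<dots> \<le> s * inner (X \<cdot> \<xi>) \<xi> + t * inner (Y \<cdot> \<xi>) \<xi>"
      using XY st by (intro add_mono mult_left_mono) auto
    finally show "s *\<^sub>R X + t *\<^sub>R Y \<in> {X. c \<le> inner (X \<cdot> \<xi>) \<xi>}"
      by (simp add: blinfun.add_left blinfun.scaleR_left inner_add_left)
  qed
  \<comment> \<open>At \<open>\<Omega>\<close> every conjugate of \<open>p\<close> has the value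
    \<open>a\<close>: the unitary of \<open>B\<close> passes through \<open>radj U\<close> and
    \<open>e\<close> and preserves the norm. At \<open>\<Omega>\<close> the form of \<open>h\<close>
    is the coefficient on \<open>K\<close>.\<close>
  have aa: "a' = a"
  proof -
    have "inner (x n \<cdot> \<Omega>) \<Omega> = a" for n
    proof (rule hull[OF conv_eq])
      fix g assume "g \<in> G"
      then obtain w where w: "w \<in> B" "radj w o\<^sub>L w = id_blinfun" "g = cj w" by (auto simp: G_def B.unitaries_iff)
      have UM: "radj U \<in> commutant M" using M.commutant_radj_closed[OF U(1)] .
      have "e \<cdot> radj U \<cdot> radj g \<cdot> \<Omega> = e \<cdot> radj U \<cdot> w \<cdot> \<Omega>"
        using cj_radj_Omega[OF BM[OF w(1)]] by (simp add: w(3) radj_cj)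
      also have "\<dots> = e \<cdot> w \<cdot> radj U \<cdot> \<Omega>" by (simp only: M.commutant_commutes_apply[OF UM BM[OF w(1)]])
      also have "\<dots> = w \<cdot> e \<cdot> radj U \<cdot> \<Omega>" using e_commute_B[OF w(1)] by (metis blinfun_apply_blinfun_compose)
      finally have "norm (e \<cdot> radj U \<cdot> radj g \<cdot> \<Omega>) = norm (e \<cdot> radj U \<cdot> \<Omega>)" by (simp add: norm_isometry[OF w(2)])
      also have "\<dots> = norm (e \<cdot> u \<cdot> \<Omega>)" using cj_radj_Omega[OF uu(1)] by (simp add: U_def radj_cj)
      finally show "inner ((g o\<^sub>L p o\<^sub>L radj g) \<cdot> \<Omega>) \<Omega> = a" by (simp only: form a_def)
    qed
    then have "(\<lambda>n. a) \<longlonglongrightarrow> inner (h \<cdot> \<Omega>) \<Omega>" using limf[of \<Omega>] by simp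
    then have "inner (h \<cdot> \<Omega>) \<Omega> = a" by (rule LIMSEQ_unique[OF _ tendsto_const])
    then show ?thesis by (simp add: hform)
  qed
  have a01: "0 \<le> a" "a \<le> 1"
  proof -
    have "norm (e \<cdot> u \<cdot> \<Omega>) \<le> norm (u \<cdot> \<Omega>)" by (rule norm_e_le)
    then have "norm (e \<cdot> u \<cdot> \<Omega>) \<le> 1" by (simp add: norm_isometry[OF uu(2)])
    then show "0 \<le> a" "a \<le> 1" by (simp_all add: a_def power_le_one)
  qed
  \<comment> \<open>The form of \<open>h\<close> at a nonzero vector orthogonal to \<open>K\<close>
    is \<open>b\<close> times its squared norm, and it is a limit of nonnegative numbers.\<close>
  have b0: "0 \<le> b"
  proof -
    obtain v where "e \<cdot> v \<noteq> id_blinfun \<cdot> v" using proper blinfun_eqI by blast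
    then have \<xi>: "v - e \<cdot> v \<noteq> 0" by simp
    define \<xi> where "\<xi> = v - e \<cdot> v"
    have "0 \<le> inner (x n \<cdot> \<xi>) \<xi>" for n by (rule hull[OF conv_ge]) (simp only: form zero_le_power2)
    then have "0 \<le> inner (h \<cdot> \<xi>) \<xi>" by (intro LIMSEQ_le_const[OF limf]) auto
    moreover have "e \<cdot> \<xi> = 0" by (simp add: \<xi>_def blinfun.diff_right)
    ultimately have "0 \<le> b * (norm \<xi>)\<^sup>2" by (simp add: hform)
    then show ?thesis using \<xi> by (simp add: \<xi>_def zero_le_mult_iff)
  qed
  \<comment> \<open>Each conjugate of \<open>p\<close> has trace 1, so its finite partial traces are
    at most 1. These bounds are convex and, being finite sums, pass to the strong limit.\<close>
  have sums: "(\<Sum>i\<in>F. inner (h \<cdot> radj (V i) \<cdot> \<Omega>) (radj (V i) \<cdot> \<Omega>)) \<le> 1" if F: "finite F" "F \<subseteq> I" for F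
  proof (rule LIMSEQ_le_const2)
    show "(\<lambda>n. \<Sum>i\<in>F. inner (x n \<cdot> radj (V i) \<cdot> \<Omega>) (radj (V i) \<cdot> \<Omega>)) \<longlonglongrightarrow>
        (\<Sum>i\<in>F. inner (h \<cdot> radj (V i) \<cdot> \<Omega>) (radj (V i) \<cdot> \<Omega>))"
      by (intro tendsto_sum limf)
    have "(\<Sum>i\<in>F. inner (x n \<cdot> radj (V i) \<cdot> \<Omega>) (radj (V i) \<cdot> \<Omega>)) \<le> 1" for n
    proof (rule hull)
      show "convex {X. (\<Sum>i\<in>F. inner (X \<cdot> radj (V i) \<cdot> \<Omega>) (radj (V i) \<cdot> \<Omega>)) \<le> 1}"
        by (rule convexI)
          (simp add: blinfun.add_left blinfun.scaleR_left inner_add_left sum.distrib convex_bound_le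
            flip: sum_distrib_left)
      fix g assume g: "g \<in> G"
      have "ennreal (\<Sum>i\<in>F. (norm (e \<cdot> radj U \<cdot> radj g \<cdot> radj (V i) \<cdot> \<Omega>))\<^sup>2) =
          (\<Sum>i\<in>F. ennreal ((norm (e \<cdot> radj U \<cdot> radj g \<cdot> radj (V i) \<cdot> \<Omega>))\<^sup>2))"
        by (rule sum_ennreal[symmetric]) simp
      also have "\<dots> \<le> hs I V (e o\<^sub>L radj (g o\<^sub>L U))"
        unfolding hs_def by (simp add: finite_sum_le_infsum_ennreal[OF F] del: sum_ennreal)
      also have "\<dots> = 1"
      proof (rule hs_e)
        show "g o\<^sub>L U \<in> commutant B" by (intro commutant_compose GB g UB)
        have "radj (g o\<^sub>L U) o\<^sub>L (g o\<^sub>L U) = radj U o\<^sub>L (radj g o\<^sub>L g) o\<^sub>L U"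
          by (simp only: radj_compose blinfun_compose_assoc)
        then show "radj (g o\<^sub>L U) o\<^sub>L (g o\<^sub>L U) = id_blinfun" by (simp add: G(2)[OF g] U(2))
      qed
      finally show "(\<Sum>i\<in>F. inner ((g o\<^sub>L p o\<^sub>L radj g) \<cdot> radj (V i) \<cdot> \<Omega>) (radj (V i) \<cdot> \<Omega>)) \<le> 1"
        by (simp only: form) simp
    qed
    then show "\<exists>N. \<forall>n\<ge>N. (\<Sum>i\<in>F. inner (x n \<cdot> radj (V i) \<cdot> \<Omega>) (radj (V i) \<cdot> \<Omega>)) \<le> 1" by blast
  qed
  \<comment> \<open>If every unitary failed, the forms of all conjugates at
    \<open>J \<cdot> u \<cdot> \<Omega>\<close> would exceed the value of the form of
    \<open>h\<close> there by at least \<open>\<epsilon>\<close>, and so would their limit.\<close>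
  have ex: "\<exists>w\<in>unitaries B. (norm (e \<cdot> radj u \<cdot> w \<cdot> u \<cdot> \<Omega>))\<^sup>2 < a * a + b * (1 - a) + \<epsilon>" if eps: "\<epsilon> > 0" for \<epsilon>
  proof (rule ccontr)
    assume neg: "\<not> ?thesis"
    define \<xi> where "\<xi> = J \<cdot> u \<cdot> \<Omega>"
    have "a * a + b * (1 - a) + \<epsilon> \<le> inner (x n \<cdot> \<xi>) \<xi>" for n
    proof (rule hull[OF conv_ge])
      fix g assume "g \<in> G"
      then obtain w where w: "w \<in> unitaries B" "g = cj w" by (auto simp: G_def)
      have "radj w \<in> unitaries B" using w(1) by (simp add: B.unitaries_iff B.radj_closed)
      then have "a * a + b * (1 - a) + \<epsilon> \<le> (norm (e \<cdot> radj u \<cdot> radj w \<cdot> u \<cdot> \<Omega>))\<^sup>2" using neg by force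
      also have "norm (e \<cdot> radj u \<cdot> radj w \<cdot> u \<cdot> \<Omega>) = norm (e \<cdot> radj U \<cdot> radj g \<cdot> \<xi>)"
        by (simp add: U_def w(2) radj_cj \<xi>_def e_J_apply)
      finally show "a * a + b * (1 - a) + \<epsilon> \<le> inner ((g o\<^sub>L p o\<^sub>L radj g) \<cdot> \<xi>) \<xi>" by (simp only: form)
    qed
    then have "a * a + b * (1 - a) + \<epsilon> \<le> inner (h \<cdot> \<xi>) \<xi>" by (intro LIMSEQ_le_const[OF limf]) auto
    also have "\<dots> = a * a + b * (1 - a)"
      by (simp add: hform aa \<xi>_def e_J_apply norm_isometry[OF uu(2)]) (simp add: a_def)
    finally show False using eps by simp
  qed
  show ?thesis
  proof (intro exI[of _ b] conjI allI impI)
    fix F assume "finite F" "F \<subseteq> I"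
    then show "(\<Sum>i\<in>F. a * (norm (e \<cdot> radj (V i) \<cdot> \<Omega>))\<^sup>2 +
        b * ((norm (radj (V i) \<cdot> \<Omega>))\<^sup>2 - (norm (e \<cdot> radj (V i) \<cdot> \<Omega>))\<^sup>2)) \<le> 1"
      using sums[of F] by (simp only: hform aa)
  qed (use b0 ex in auto)
qed

text \<open>The supremum is tested at unitaries \<open>w\<close> of \<open>B\<close>. The first
  expectation fixes \<open>w\<close>, so by Pythagoras the gap depends only on the second
  expectation of \<open>w\<close>, which is the conjugate by \<open>u\<close> of the expectation
  onto \<open>B\<close> of \<open>radj u o\<^sub>L w o\<^sub>L u\<close>.\<close>

lemma norm_inf2_lower_bound:
  assumes u: "u \<in> unitaries M" and r: "0 \<le> r" "r\<^sup>2 \<le> 1 - c"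
    and ex: "\<And>\<epsilon>. \<epsilon> > 0 \<Longrightarrow> \<exists>w\<in>unitaries B. (norm (e \<cdot> radj u \<cdot> w \<cdot> u \<cdot> \<Omega>))\<^sup>2 < c + \<epsilon>"
  shows "ereal r \<le> norm_inf2 M \<tau> (\<lambda>x. cond_exp M \<tau> B x - cond_exp M \<tau> (conjugate u B) x)"
proof -
  have uu: "u \<in> M" "radj u o\<^sub>L u = id_blinfun" "u o\<^sub>L radj u = id_blinfun"
    using u by (auto simp: M.unitaries_iff)
  have con: "conjugate u B = (\<lambda>x. u o\<^sub>L x o\<^sub>L radj u) ` B" by (simp add: conjugate_def M.adj_radj[OF uu(1)])
  have "von_neumann_algebra (conjugate u B)" by (rule B.conjugate_vna[OF M.in_BH[OF uu(1)] uu(2,3)])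
  moreover have "conjugate u B \<subseteq> M"
    unfolding con by (intro image_subsetI M.compose_closed M.radj_closed uu(1) BM)
  ultimately interpret C: tracial_sub M \<tau> \<Omega> "conjugate u B" by unfold_locales
  have gap: "norm2 \<tau> (cond_exp M \<tau> B w - cond_exp M \<tau> (conjugate u B) w)
      = sqrt (1 - (norm (e \<cdot> radj u \<cdot> w \<cdot> u \<cdot> \<Omega>))\<^sup>2)"
    and wM: "w \<in> M" and w1: "norm w \<le> 1" if w: "w \<in> unitaries B" for w
  proof -
    have ww: "w \<in> B" "radj w o\<^sub>L w = id_blinfun" using w by (auto simp: B.unitaries_iff)
    show wM: "w \<in> M" by (rule BM[OF ww(1)])
    show "norm w \<le> 1" by (rule norm_blinfun_bound) (simp_all add: norm_isometry[OF ww(2)])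
    define y where "y = radj u o\<^sub>L w o\<^sub>L u"
    have y: "y \<in> M" unfolding y_def by (intro M.compose_closed M.radj_closed uu wM)
    have yw: "u o\<^sub>L y o\<^sub>L radj u = w"
    proof -
      have "u o\<^sub>L y o\<^sub>L radj u = (u o\<^sub>L radj u) o\<^sub>L w o\<^sub>L (u o\<^sub>L radj u)" by (simp only: y_def blinfun_compose_assoc)
      then show ?thesis by (simp add: uu(3))
    qed
    \<comment> \<open>The product of \<open>u\<close> and \<open>U\<close> is the isometry that
      implements conjugation by \<open>u\<close> on vectors: it takes
      \<open>x \<cdot> \<Omega>\<close> to the vector of
      \<open>u o\<^sub>L x o\<^sub>L radj u\<close>.\<close>
    define U where "U = cj u"
    have U: "U \<in> commutant M" "radj U o\<^sub>L U = id_blinfun"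
      using cj_in_commutant uu by (simp_all add: U_def radj_cj flip: cj_compose)
    have UO: "radj u \<cdot> \<Omega> = U \<cdot> \<Omega>" using cj_Omega[OF uu(1)] by (simp add: U_def)
    have move: "u \<cdot> x \<cdot> radj u \<cdot> \<Omega> = u \<cdot> U \<cdot> x \<cdot> \<Omega>" if "x \<in> M" for x
      by (simp only: UO M.commutant_commutes_apply[OF U(1) that])
    have iso: "inner (u \<cdot> U \<cdot> \<xi>) (u \<cdot> U \<cdot> \<eta>) = inner \<xi> \<eta>" for \<xi> \<eta>
    proof -
      have "inner (u \<cdot> U \<cdot> \<xi>) (u \<cdot> U \<cdot> \<eta>) = inner (U \<cdot> \<xi>) ((radj u o\<^sub>L u) \<cdot> U \<cdot> \<eta>)" by (simp add: inner_radj)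
      also have "\<dots> = inner \<xi> ((radj U o\<^sub>L U) \<cdot> \<eta>)" by (simp add: uu(2) inner_radj)
      finally show ?thesis by (simp add: U(2))
    qed
    have Ce: "C.e \<cdot> w \<cdot> \<Omega> = u \<cdot> U \<cdot> e \<cdot> y \<cdot> \<Omega>"
    proof (rule C.e_eqI)
      have cu: "u o\<^sub>L cexp y o\<^sub>L radj u \<in> conjugate u B" unfolding con using cexp_in[OF y] by blast
      have "(u o\<^sub>L cexp y o\<^sub>L radj u) \<cdot> \<Omega> = u \<cdot> U \<cdot> e \<cdot> y \<cdot> \<Omega>"
        using move[OF BM[OF cexp_in[OF y]]] by (simp add: cexp_Omega[OF y])
      then show "u \<cdot> U \<cdot> e \<cdot> y \<cdot> \<Omega> \<in> C.K" using C.vec_in_K[OF cu] by simp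
      have wO: "w \<cdot> \<Omega> = u \<cdot> U \<cdot> y \<cdot> \<Omega>" using move[OF y] arg_cong[OF yw, of "\<lambda>T. T \<cdot> \<Omega>"] by simp
      have "inner (w \<cdot> \<Omega> - u \<cdot> U \<cdot> e \<cdot> y \<cdot> \<Omega>) (z \<cdot> \<Omega>) = 0" if z: "z \<in> conjugate u B" for z
      proof -
        obtain n where n: "n \<in> B" "z = u o\<^sub>L n o\<^sub>L radj u" using z by (auto simp: con)
        have "z \<cdot> \<Omega> = u \<cdot> U \<cdot> n \<cdot> \<Omega>" using move[OF BM[OF n(1)]] by (simp add: n(2))
        then have "inner (w \<cdot> \<Omega> - u \<cdot> U \<cdot> e \<cdot> y \<cdot> \<Omega>) (z \<cdot> \<Omega>) = inner (y \<cdot> \<Omega> - e \<cdot> y \<cdot> \<Omega>) (n \<cdot> \<Omega>)"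
          by (simp add: wO inner_diff_left iso)
        then show ?thesis using e_orth[OF vec_in_K[OF n(1)]] by simp
      qed
      note 0 = this
      show "inner (w \<cdot> \<Omega> - u \<cdot> U \<cdot> e \<cdot> y \<cdot> \<Omega>) v = 0" if v: "v \<in> C.K" for v
        using v
      proof (rule C.K_induct)
        show "closed {v. inner (w \<cdot> \<Omega> - u \<cdot> U \<cdot> e \<cdot> y \<cdot> \<Omega>) v = 0}"
          by (intro closed_Collect_eq continuous_intros)
      qed (rule 0)
    qed
    have ny: "norm (e \<cdot> y \<cdot> \<Omega>) = norm (C.e \<cdot> w \<cdot> \<Omega>)"
      unfolding Ce using iso[of "e \<cdot> y \<cdot> \<Omega>" "e \<cdot> y \<cdot> \<Omega>"] by (simp add: norm_eq_sqrt_inner)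
    have mem: "cexp w - C.cexp w \<in> M"
      by (intro M.diff_closed BM cexp_in C.BM C.cexp_in wM)
    have "norm2 \<tau> (cexp w - C.cexp w) = norm ((cexp w - C.cexp w) \<cdot> \<Omega>)" by (rule norm2_eq[OF mem])
    also have "\<dots> = norm (w \<cdot> \<Omega> - C.e \<cdot> w \<cdot> \<Omega>)"
      by (simp add: blinfun.diff_left cexp_fix[OF ww(1)] C.cexp_Omega[OF wM])
    also have "\<dots> = sqrt (1 - (norm (C.e \<cdot> w \<cdot> \<Omega>))\<^sup>2)"
    proof -
      have "(norm (w \<cdot> \<Omega> - C.e \<cdot> w \<cdot> \<Omega>))\<^sup>2 = inner (w \<cdot> \<Omega>) (w \<cdot> \<Omega>) - inner (C.e \<cdot> w \<cdot> \<Omega>) (w \<cdot> \<Omega>)"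
        by (simp add: power2_norm_eq_inner inner_diff_left inner_diff_right C.inner_e)
      also have "inner (w \<cdot> \<Omega>) (w \<cdot> \<Omega>) = 1"
        by (simp add: dot_square_norm norm_isometry[OF ww(2)])
      also have "inner (C.e \<cdot> w \<cdot> \<Omega>) (w \<cdot> \<Omega>) = (norm (C.e \<cdot> w \<cdot> \<Omega>))\<^sup>2"
        by (rule C.norm_e_sq[symmetric])
      finally show ?thesis by (metis norm_ge_zero real_sqrt_abs abs_of_nonneg)
    qed
    finally show "norm2 \<tau> (cond_exp M \<tau> B w - cond_exp M \<tau> (conjugate u B) w)
      = sqrt (1 - (norm (e \<cdot> radj u \<cdot> w \<cdot> u \<cdot> \<Omega>))\<^sup>2)"
      using ny by (simp add: cond_exp_eq[OF wM] C.cond_exp_eq[OF wM] y_def)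
  qed
  show ?thesis unfolding norm_inf2_def le_SUP_iff
  proof (intro allI impI)
    fix z assume z: "z < ereal r"
    \<comment> \<open>For \<open>z\<close> minus infinity \<open>real_of_ereal\<close> is 0, which
      may fail to be below \<open>r\<close>. For negative \<open>z\<close> the value -1 is a
      placeholder, and any unitary serves.\<close>
    define s where "s = (if z < 0 then - 1 else real_of_ereal z)"
    have zs: "z \<le> ereal s \<or> z < 0" and sr: "s < r" and s0: "0 \<le> s \<or> z < 0"
      using z r(1) by (cases z; auto simp: s_def)+
    obtain w where w: "w \<in> unitaries B"
        "z < 0 \<or> (norm (e \<cdot> radj u \<cdot> w \<cdot> u \<cdot> \<Omega>))\<^sup>2 < c + (r\<^sup>2 - s\<^sup>2)"
    proof (cases "z < 0")
      case True
      then show ?thesis using B.unitaries_id that by blast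
    next
      case False
      then have "s\<^sup>2 < r\<^sup>2" using sr s0 by (intro power_strict_mono) auto
      then show ?thesis using ex[of "r\<^sup>2 - s\<^sup>2"] that by auto
    qed
    have le1: "(norm (e \<cdot> radj u \<cdot> w \<cdot> u \<cdot> \<Omega>))\<^sup>2 \<le> 1"
    proof -
      have ww: "radj w o\<^sub>L w = id_blinfun" using w(1) by (simp add: B.unitaries_iff)
      have "norm (e \<cdot> radj u \<cdot> w \<cdot> u \<cdot> \<Omega>) \<le> norm (radj u \<cdot> w \<cdot> u \<cdot> \<Omega>)" by (rule norm_e_le)
      also have "\<dots> = 1" by (simp add: norm_isometry uu ww)
      finally show ?thesis by (simp add: power_le_one)
    qed
    have "z < ereal (sqrt (1 - (norm (e \<cdot> radj u \<cdot> w \<cdot> u \<cdot> \<Omega>))\<^sup>2))"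
    proof (cases "z < 0")
      case True
      also have "0 \<le> ereal (sqrt (1 - (norm (e \<cdot> radj u \<cdot> w \<cdot> u \<cdot> \<Omega>))\<^sup>2))" using le1 by simp
      finally show ?thesis .
    next
      case False
      then have "s\<^sup>2 < 1 - (norm (e \<cdot> radj u \<cdot> w \<cdot> u \<cdot> \<Omega>))\<^sup>2" using w(2) r(2) by simp
      then have "s < sqrt (1 - (norm (e \<cdot> radj u \<cdot> w \<cdot> u \<cdot> \<Omega>))\<^sup>2)" by (rule real_less_rsqrt)
      then show ?thesis using zs False by (metis ereal_less_eq(3) less_ereal.simps(1) order_le_less_trans)
    qed
    then show "\<exists>x\<in>{x \<in> M. norm x \<le> 1}.
        z < ereal (norm2 \<tau> (cond_exp M \<tau> B x - cond_exp M \<tau> (conjugate u B) x))"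
      using gap[OF w(1)] wM[OF w(1)] w1[OF w(1)] by (intro bexI[of _ w]) auto
  qed
qed

end

theorem theorem3p1:
  fixes M N :: "('h::complex_hilbert_space \<Rightarrow>\<^sub>L 'h) set"
    and \<tau> :: "('h \<Rightarrow>\<^sub>L 'h) \<Rightarrow> complex"
    and \<Omega> :: 'h
  assumes "II1_factor M"
    and "normal_faithful_tracial_state M \<tau>"
    and "acts_on_L2 M \<tau> \<Omega>"
    and "subfactor N M"
    and "singular_in N M"
    and "cop.dim (commutant N \<inter> basic_construction \<Omega> M N) = 2"
  shows "(jones_index \<Omega> N < \<infinity> \<longrightarrow>
            strongly_singular_with
              (sqrt ((enn2real (jones_index \<Omega> N) - 2) / (enn2real (jones_index \<Omega> N) - 1))) M \<tau> N)
       \<and> (jones_index \<Omega> N = \<infinity> \<longrightarrow> strongly_singular M \<tau> N)"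
proof -
  have vM: "von_neumann_algebra M" and facM: "M \<inter> commutant M = range scalar_op"
    and nz: "(id_blinfun :: 'h \<Rightarrow>\<^sub>L 'h) \<noteq> 0"
    using assms(1) by (auto simp: II1_factor_def is_factor_def)
  have vN: "von_neumann_algebra N" and facN: "N \<inter> commutant N = range scalar_op" and NM: "N \<subseteq> M"
    using assms(4) by (auto simp: subfactor_def is_factor_def)
  interpret tracial_sub M \<tau> \<Omega> N by unfold_locales (rule vM assms(2,3) vN NM)+
  have fin: "v o\<^sub>L radj v = id_blinfun" if "v \<in> M" "radj v o\<^sub>L v = id_blinfun" for v
    using assms(1) that M.adj_radj[OF that(1)] by (auto simp: II1_factor_def)
  let ?D = "commutant N \<inter> basic_construction \<Omega> M N"
  have idD: "id_blinfun \<in> ?D"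
    by (auto simp: commutant_id basic_construction_eq intro: vna.id_closed[OF vna.intro])
  have eD: "e \<in> ?D" by (auto simp: e_commutant basic_construction_eq)
  \<comment> \<open>If \<open>e\<close> were the identity, \<open>N\<close> would be
    \<open>M\<close> and the relative commutant would consist of scalars, so its dimension would be
    at most 1.\<close>
  have proper: "e \<noteq> id_blinfun"
  proof
    assume e: "e = id_blinfun"
    have "K = UNIV" using e_in by (auto simp: e)
    then have "M = N" using in_B_if_vec_in_K NM by blast
    then have "commutant N = commutant M" by simp
    moreover have "basic_construction \<Omega> M N \<subseteq> M"
      using vM M.id_closed by (auto simp: basic_construction_eq e)
    ultimately have "?D \<subseteq> M \<inter> commutant M" by blast
    also have "\<dots> = range (\<lambda>k. op_scale k id_blinfun)" by (simp add: facM op_scale_def)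
    also have "\<dots> = cop.span {id_blinfun}" by (rule cop.span_singleton[symmetric])
    finally have "cop.dim ?D \<le> card {id_blinfun :: 'h \<Rightarrow>\<^sub>L 'h}" by (rule cop.dim_le_card) simp
    then show False using assms(6) by simp
  qed
  have "e \<notin> range scalar_op"
  proof
    assume "e \<in> range scalar_op"
    then obtain k where k: "e = scalar_op k" by blast
    then have "k *\<^sub>C \<Omega> = \<Omega>" using e_Omega by simp
    then have "cinner (k *\<^sub>C \<Omega>) \<Omega> = cinner \<Omega> \<Omega>" by simp
    then have "k = 1" by (simp add: cinner_scaleC_left cinner_self)
    then have "e = id_blinfun" by (intro blinfun_eqI) (simp add: k scaleC_one)
    then show False using proper by simp
  qed
  then have two: "\<exists>\<alpha> \<beta>. T = scalar_op \<alpha> + op_scale \<beta> e"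
    if "T \<in> commutant N" "T \<in> basic_construction \<Omega> M N" for T
    using dim_two_span[OF assms(6) idD eD _ _ nz] that by blast
  have gt2: "jones_index \<Omega> N > 2"
    by (rule singular_imp_index_gt_2[OF facM facN fin assms(5) proper])
  obtain I V where emb: "module_embedding \<Omega> N I V" using module_embedding_exists by blast
  \<comment> \<open>The diagonal contributions to the trace of \<open>e\<close> and of the identity:
    \<open>f\<close> sums to 1 and \<open>g\<close> to the index.\<close>
  define f where "f i = (norm (e \<cdot> radj (V i) \<cdot> \<Omega>))\<^sup>2" for i
  define g where "g i = (norm (radj (V i) \<cdot> \<Omega>))\<^sup>2" for i
  have idx: "jones_index \<Omega> N = (\<Sum>\<^sub>\<infinity>i\<in>I. ennreal (g i))"
    using jones_index_eq[OF emb] by (simp add: hs_def g_def)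
  have "(\<Sum>\<^sub>\<infinity>i\<in>I. ennreal (f i)) = ennreal 1"
    using hs_proj[OF emb commutant_id] by (simp add: hs_def f_def)
  then have f1: "(f has_sum 1) I" by (rule has_sum_if_infsum_ennreal) (simp_all add: f_def)
  have fle: "sum f F \<le> 1" if "finite F" "F \<subseteq> I" for F
    by (rule has_sum_mono2[OF has_sum_finite[OF that(1)] f1 that(2)]) (simp add: f_def)
  \<comment> \<open>\<open>k\<close> is the squared distance of \<open>u\<close> from its
    expectation, so the coefficient of the average on \<open>K\<close> is \<open>1 - k\<close>. The
    bound is stated for all admissible \<open>r\<close>, which leaves to the two cases only the
    choice of \<open>r\<close>.\<close>
  have main: "\<exists>b\<ge>0. (\<forall>F. finite F \<longrightarrow> F \<subseteq> I \<longrightarrow> (\<Sum>i\<in>F. (1 - k) * f i + b * (g i - f i)) \<le> 1) \<and>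
     (\<forall>r\<ge>0. r\<^sup>2 \<le> 1 - ((1 - k) * (1 - k) + b * k) \<longrightarrow>
        ereal r \<le> norm_inf2 M \<tau> (\<lambda>x. cond_exp M \<tau> N x - cond_exp M \<tau> (conjugate u N) x))"
    and k01: "0 \<le> k" "k \<le> 1"
    if u: "u \<in> unitaries M" and k: "k = (norm2 \<tau> (u - cond_exp M \<tau> N u))\<^sup>2" for u k
  proof -
    have uu: "u \<in> M" "radj u o\<^sub>L u = id_blinfun" using u by (auto simp: M.unitaries_iff)
    have "u - cond_exp M \<tau> N u \<in> M" using uu(1) cexp_in BM by (simp add: cond_exp_eq M.diff_closed)
    then have "k = (norm (u \<cdot> \<Omega> - e \<cdot> u \<cdot> \<Omega>))\<^sup>2"
      using k by (simp add: norm2_eq blinfun.diff_left cond_exp_Omega[OF uu(1)])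
    also have "\<dots> = inner (u \<cdot> \<Omega>) (u \<cdot> \<Omega>) - inner (e \<cdot> u \<cdot> \<Omega>) (u \<cdot> \<Omega>)"
      by (simp add: power2_norm_eq_inner inner_diff_left inner_diff_right inner_e)
    also have "inner (u \<cdot> \<Omega>) (u \<cdot> \<Omega>) = 1" by (simp add: dot_square_norm norm_isometry[OF uu(2)])
    also have "inner (e \<cdot> u \<cdot> \<Omega>) (u \<cdot> \<Omega>) = (norm (e \<cdot> u \<cdot> \<Omega>))\<^sup>2"
      by (rule norm_e_sq[symmetric])
    finally have ka: "(norm (e \<cdot> u \<cdot> \<Omega>))\<^sup>2 = 1 - k" by simp
    show "k \<le> 1" using zero_le_power2[of "norm (e \<cdot> u \<cdot> \<Omega>)"] unfolding ka by simp
    show "0 \<le> k" by (simp add: k)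
    from average_of_conjugates[OF emb two proper u] obtain b where b: "0 \<le> b"
      "\<And>F. finite F \<Longrightarrow> F \<subseteq> I \<Longrightarrow> (\<Sum>i\<in>F. (1 - k) * f i + b * (g i - f i)) \<le> 1"
      "\<And>\<epsilon>. \<epsilon> > 0 \<Longrightarrow> \<exists>w\<in>unitaries N. (norm (e \<cdot> radj u \<cdot> w \<cdot> u \<cdot> \<Omega>))\<^sup>2 < (1 - k) * (1 - k) + b * k + \<epsilon>"
      unfolding ka f_def[symmetric] g_def[symmetric] by auto
    show "\<exists>b\<ge>0. (\<forall>F. finite F \<longrightarrow> F \<subseteq> I \<longrightarrow> (\<Sum>i\<in>F. (1 - k) * f i + b * (g i - f i)) \<le> 1) \<and>
     (\<forall>r\<ge>0. r\<^sup>2 \<le> 1 - ((1 - k) * (1 - k) + b * k) \<longrightarrow>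
        ereal r \<le> norm_inf2 M \<tau> (\<lambda>x. cond_exp M \<tau> N x - cond_exp M \<tau> (conjugate u N) x))"
      using b norm_inf2_lower_bound[OF u _ _ b(3)] by blast
  qed
  have n0: "0 \<le> norm2 \<tau> x" if "x \<in> M" for x using that by (simp add: norm2_eq)
  have cM: "u - cond_exp M \<tau> N u \<in> M" if "u \<in> unitaries M" for u
    using that cexp_in BM by (simp add: M.unitaries_iff cond_exp_eq M.diff_closed)
  show ?thesis
  proof (intro conjI impI)
    assume finite: "jones_index \<Omega> N < \<infinity>"
    define l where "l = enn2real (jones_index \<Omega> N)"
    have le: "jones_index \<Omega> N = ennreal l" using finite by (simp add: l_def)
    have l2: "2 < l" using gt2 unfolding le by (simp add: ennreal_less_iff flip: ennreal_numeral)
    have g1: "(g has_sum l) I" using idx le l2 by (intro has_sum_if_infsum_ennreal) (simp_all add: g_def)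
    define q where "q = (l - 2) / (l - 1)"
    have q: "0 < q" "q \<le> 1" using l2 by (simp_all add: q_def)
    show "strongly_singular_with (sqrt ((enn2real (jones_index \<Omega> N) - 2) / (enn2real (jones_index \<Omega> N) - 1))) M \<tau> N"
      unfolding strongly_singular_with_def l_def[symmetric] q_def[symmetric]
    proof (intro conjI ballI)
      show "0 < sqrt q" "sqrt q \<le> 1" using q by simp_all
      fix u assume u: "u \<in> unitaries M"
      define k where "k = (norm2 \<tau> (u - cond_exp M \<tau> N u))\<^sup>2"
      obtain b where b: "0 \<le> b" "\<And>F. finite F \<Longrightarrow> F \<subseteq> I \<Longrightarrow> (\<Sum>i\<in>F. (1 - k) * f i + b * (g i - f i)) \<le> 1"
        and r: "\<And>r. 0 \<le> r \<Longrightarrow> r\<^sup>2 \<le> 1 - ((1 - k) * (1 - k) + b * k) \<Longrightarrow>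
          ereal r \<le> norm_inf2 M \<tau> (\<lambda>x. cond_exp M \<tau> N x - cond_exp M \<tau> (conjugate u N) x)"
        using main[OF u k_def] by blast
      note k01 = k01[OF u k_def]
      \<comment> \<open>Summed over all of \<open>I\<close>, the finite inequalities become (1 - k)
        + b (l - 1) \<le> 1.\<close>
      have "((\<lambda>i. (1 - k - b) * f i + b * g i) has_sum (1 - k - b) * 1 + b * l) I"
        by (intro has_sum_add has_sum_cmult_right f1 g1)
      moreover have "(1 - k - b) * f i + b * g i = (1 - k) * f i + b * (g i - f i)" for i
        by (simp add: algebra_simps)
      ultimately have "((\<lambda>i. (1 - k) * f i + b * (g i - f i)) has_sum (1 - k - b) * 1 + b * l) I"
        by simp
      then have "(1 - k - b) * 1 + b * l \<le> 1" by (rule has_sum_le_finite_sums) (rule b(2))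
      then have bk: "b \<le> k / (l - 1)" using l2 by (simp add: field_simps)
      \<comment> \<open>The target is linear in \<open>k\<close>, so one factor \<open>k\<close> is
        estimated by 1.\<close>
      have "b * k \<le> k / (l - 1) * k" by (rule mult_right_mono[OF bk k01(1)])
      also have "\<dots> \<le> k / (l - 1) * 1" using k01 l2 by (intro mult_left_mono) auto
      finally have bk': "b * k \<le> k / (l - 1)" by simp
      have "q = 1 - 1 / (l - 1)" using l2 by (simp add: q_def field_simps)
      then have "q * k = k - k / (l - 1)" by (simp only: left_diff_distrib mult_1 times_divide_eq_left)
      also have "\<dots> \<le> 1 - ((1 - k) * (1 - k) + b * k)"
      proof -
        have "k * k \<le> k" using k01 by (simp add: mult_left_le)
        then show ?thesis using bk' by (simp add: algebra_simps)
      qed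
      finally show "ereal (sqrt q * norm2 \<tau> (u - cond_exp M \<tau> N u))
          \<le> norm_inf2 M \<tau> (\<lambda>x. cond_exp M \<tau> N x - cond_exp M \<tau> (conjugate u N) x)"
        using q n0[OF cM[OF u]] by (intro r) (simp_all add: power_mult_distrib k_def)
    qed
  next
    assume infinite: "jones_index \<Omega> N = \<infinity>"
    show "strongly_singular M \<tau> N"
      unfolding strongly_singular_def strongly_singular_with_def
    proof (intro conjI ballI)
      fix u assume u: "u \<in> unitaries M"
      define k where "k = (norm2 \<tau> (u - cond_exp M \<tau> N u))\<^sup>2"
      obtain b where b: "0 \<le> b" "\<And>F. finite F \<Longrightarrow> F \<subseteq> I \<Longrightarrow> (\<Sum>i\<in>F. (1 - k) * f i + b * (g i - f i)) \<le> 1"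
        and r: "\<And>r. 0 \<le> r \<Longrightarrow> r\<^sup>2 \<le> 1 - ((1 - k) * (1 - k) + b * k) \<Longrightarrow>
          ereal r \<le> norm_inf2 M \<tau> (\<lambda>x. cond_exp M \<tau> N x - cond_exp M \<tau> (conjugate u N) x)"
        using main[OF u k_def] by blast
      note k01 = k01[OF u k_def]
      \<comment> \<open>A positive \<open>b\<close> would bound all finite parts of the sum defining
        the index by \<open>1 + 1 / b\<close>.\<close>
      have "b = 0"
      proof (rule ccontr)
        assume "b \<noteq> 0"
        then have b0: "0 < b" using b(1) by simp
        have "(\<Sum>\<^sub>\<infinity>i\<in>I. ennreal (g i)) \<le> ennreal (1 + 1 / b)"
        proof (rule infsum_ennreal_leI)
          fix F assume F: "finite F" "F \<subseteq> I"
          have "0 \<le> (1 - k) * sum f F" using k01 by (simp add: f_def sum_nonneg)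
          moreover have "(1 - k) * sum f F + b * (sum g F - sum f F) \<le> 1"
            using b(2)[OF F] by (simp add: sum.distrib sum_distrib_left sum_subtractf[symmetric])
          ultimately have "b * (sum g F - sum f F) \<le> 1" by linarith
          then have "sum g F - sum f F \<le> 1 / b" using b0 by (simp add: field_simps)
          then have "sum g F \<le> 1 + 1 / b" using fle[OF F] by linarith
          then show "(\<Sum>i\<in>F. ennreal (g i)) \<le> ennreal (1 + 1 / b)"
            by (subst sum_ennreal) (simp_all add: g_def ennreal_leI)
        qed
        then show False using infinite idx by (simp add: top_unique)
      qed
      \<comment> \<open>With \<open>b = 0\<close> the available bound is 1 - (1 - k)^2 = 2 k - k^2,
        which is at least \<open>k\<close>.\<close>
      moreover have "k * k \<le> k" using k01 by (simp add: mult_left_le)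
      ultimately have "k \<le> 1 - ((1 - k) * (1 - k) + b * k)" by (simp add: algebra_simps)
      then show "ereal (1 * norm2 \<tau> (u - cond_exp M \<tau> N u))
          \<le> norm_inf2 M \<tau> (\<lambda>x. cond_exp M \<tau> N x - cond_exp M \<tau> (conjugate u N) x)"
        using n0[OF cM[OF u]] by (intro r) (simp_all add: k_def)
    qed simp_all
  qed
qed

end
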